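(* The regular genus of $\mathbb{S}^2\times\mathbb{S}^1\times\mathbb{S}^1$ is $6$, i.e. $\mathcal{G}(\mathbb{S}^2\times\mathbb{S}^1\times\mathbb{S}^1)=6$. Moreover, this value is attained by a crystallization of $\mathbb{S}^2\times\mathbb{S}^1\times\mathbb{S}^1$ with $40$ vertices, i.e. there is a $40$-vertex crystallization $\Gamma$ of $\mathbb{S}^2\times\mathbb{S}^1\times\mathbb{S}^1$ with $\rho(\Gamma)=6$.
   Context: All manifolds and maps are in the PL category. An $(n+1)$-regular colored graph $(\Gamma,\gamma)$ is a finite multigraph without loops, regular of degree $n+1$, together with a proper edge-coloring $\gamma:E(\Gamma)\to\Delta_n=\{0,1,\dots,n\}$ (adjacent edges get different colors). For $\mathcal C\subseteq\Delta_n$, $\Gamma_{\mathcal C}$ is the spanning subgraph with edges of colors in $\mathcal C$, and $g_{\mathcal C}$ is its number of connected components. From $\Gamma$ one builds an $n$-dimensional simplicial cell complex $\mathcal K(\Gamma)$: take an $n$-simplex $\sigma(v)$ with vertices labeled by $\Delta_n$ for each vertex $v$, and for each $j$-colored edge $v_1v_2$ identify the $(n-1)$-faces of $\sigma(v_1),\sigma(v_2)$ opposite to their $j$-labeled vertices, matching equally labeled vertices. $\Gamma$ is a gem of a closed $n$-manifold $M$ if $|\mathcal K(\Gamma)|$ is PL homeomorphic to $M$; it is a crystallization of $M$ if moreover $\Gamma_{\Delta_n\setminus\{j\}}$ is connected for every $j$. For a gem $\Gamma$ of a closed connected $n$-manifold ($n\ge 3$) and a cyclic permutation $\varepsilon=(\varepsilon_0,\dots,\varepsilon_n)$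 of $\Delta_n$, set $\chi_\varepsilon(\Gamma)=\sum_{i\in\mathbb Z_{n+1}} g_{\{\varepsilon_i,\varepsilon_{i+1}\}}+(1-n)\frac{|V(\Gamma)|}{2}$ and $\rho_\varepsilon(\Gamma)=1-\chi_\varepsilon(\Gamma)/2$ (this is the genus, resp. half the genus, of the orientable, resp. non-orientable, surface into which $\Gamma$ embeds regularly with respect to $\varepsilon$). The regular genus of $\Gamma$ is $\rho(\Gamma)=\min_\varepsilon\rho_\varepsilon(\Gamma)$, and the regular genus of $M$ is $\mathcal G(M)=\min\{\rho(\Gamma): \Gamma \text{ a gem of } M\}$. *)

theory Defs
  imports "HOL-Analysis.Analysis"
begin

text \<open>An (n+1)-regular colored graph with color set the finite type 'c (so n+1 = CARD('c)),
 vertex set V, encoded by its colour classes: for each colour c, adj c is the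
 fixed-point-free involution of V sending a vertex to the other endpoint of its
 unique c-coloured edge.  (Properly edge-coloured (n+1)-regular loopless multigraphs
 correspond exactly to such families of perfect matchings.)\<close>

definition colored_graph :: "'v set \<Rightarrow> ('c::finite \<Rightarrow> 'v \<Rightarrow> 'v) \<Rightarrow> bool" where
  "colored_graph V adj \<longleftrightarrow> finite V \<and>
     (\<forall>c. \<forall>v\<in>V. adj c v \<in> V \<and> adj c v \<noteq> v \<and> adj c (adj c v) = v)"

text \<open>Connectivity relation of the subgraph Gamma_C and its number of components g_C.\<close>
definition sub_rel :: "'v set \<Rightarrow> ('c \<Rightarrow> 'v \<Rightarrow> 'v) \<Rightarrow> 'c set \<Rightarrow> ('v \<times> 'v) set" where
  "sub_rel V adj C = ({(v, w). v \<in> V \<and> (\<exists>c\<in>C. w = adj c v)})\<^sup>* \<inter> (V \<times> V)"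

definition g_comp :: "'v set \<Rightarrow> ('c \<Rightarrow> 'v \<Rightarrow> 'v) \<Rightarrow> 'c set \<Rightarrow> nat" where
  "g_comp V adj C = card (V // sub_rel V adj C)"

text \<open>Cyclic permutations eps = (eps_0,...,eps_n) of the colour set, as lists.\<close>
definition cyc_perms :: "'c::finite list set" where
  "cyc_perms = {eps. distinct eps \<and> set eps = UNIV}"

definition chi_eps :: "'v set \<Rightarrow> ('c::finite \<Rightarrow> 'v \<Rightarrow> 'v) \<Rightarrow> 'c list \<Rightarrow> real" where
  "chi_eps V adj eps =
     (\<Sum>i<CARD('c). real (g_comp V adj {eps ! i, eps ! ((i + 1) mod CARD('c))}))
     + (1 - (real CARD('c) - 1)) * real (card V) / 2"

definition rho_eps :: "'v set \<Rightarrow> ('c::finite \<Rightarrow> 'v \<Rightarrow> 'v) \<Rightarrow> 'c list \<Rightarrow> real" where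
  "rho_eps V adj eps = 1 - chi_eps V adj eps / 2"

definition reg_genus_graph :: "'v set \<Rightarrow> ('c::finite \<Rightarrow> 'v \<Rightarrow> 'v) \<Rightarrow> real" where
  "reg_genus_graph V adj = Min (rho_eps V adj ` cyc_perms)"

text \<open>Geometry: the standard simplex in real^'c, the vertex labelled j being axis j 1;
 the face opposite the j-labelled vertex is where the j-th coordinate vanishes.\<close>
definition std_simplex :: "(real^'c::finite) set" where
  "std_simplex = {x. (\<forall>i. 0 \<le> x $ i) \<and> (\<Sum>i\<in>UNIV. x $ i) = 1}"

text \<open>Gluing: for each j-coloured edge v w, the point x of the j-face of sigma(v)
 is identified with the point x of the j-face of sigma(w) (equal labels matched).\<close>
definition glue_rel :: "'v set \<Rightarrow> ('c::finite \<Rightarrow> 'v \<Rightarrow> 'v) \<Rightarrow> (('v \<times> (real^'c)) \<times> ('v \<times> (real^'c))) set" where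
  "glue_rel V adj = {((v, x), (w, y)). v \<in> V \<and> x \<in> std_simplex \<and>
       (\<exists>j. x $ j = 0 \<and> w = adj j v \<and> y = x)}"

text \<open>Piecewise-linear map on a polyhedron S: S is a finite union of geometric simplices
 on each of which f is affine.\<close>
definition pl_on :: "'a::euclidean_space set \<Rightarrow> ('a \<Rightarrow> 'b::real_vector) \<Rightarrow> bool" where
  "pl_on S f \<longleftrightarrow> (\<exists>T. finite T \<and> \<Union>T = S \<and>
     (\<forall>t\<in>T. (\<exists>k. k simplex t) \<and> (\<exists>g c. linear g \<and> (\<forall>x\<in>t. f x = g x + c))))"

text \<open>Gamma is a gem of the polyhedron P (with its standard PL structure): there is a map
 from the disjoint union of the simplices sigma(v), PL on each simplex, which induces a
 bijection from |K(Gamma)| onto P.  Since |K(Gamma)| is compact and P Hausdorff, this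
 induced map is a PL homeomorphism.\<close>
definition gem_of :: "'v set \<Rightarrow> ('c::finite \<Rightarrow> 'v \<Rightarrow> 'v) \<Rightarrow> 'a::euclidean_space set \<Rightarrow> bool" where
  "gem_of V adj P \<longleftrightarrow> colored_graph V adj \<and>
     (\<exists>f :: 'v \<Rightarrow> real^'c \<Rightarrow> 'a.
        (\<forall>v\<in>V. pl_on std_simplex (f v)) \<and>
        (\<Union>v\<in>V. f v ` std_simplex) = P \<and>
        (\<forall>v\<in>V. \<forall>w\<in>V. \<forall>x\<in>std_simplex. \<forall>y\<in>std_simplex.
            f v x = f w y \<longleftrightarrow> ((v, x), (w, y)) \<in> (glue_rel V adj)\<^sup>*))"

definition crystallization_of :: "'v set \<Rightarrow> ('c::finite \<Rightarrow> 'v \<Rightarrow> 'v) \<Rightarrow> 'a::euclidean_space set \<Rightarrow> bool" where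
  "crystallization_of V adj P \<longleftrightarrow> gem_of V adj P \<and> (\<forall>j. g_comp V adj (UNIV - {j}) = 1)"

text \<open>Regular genus of the manifold P (dimension CARD('c) - 1); vertices of gems are taken
 in nat, which is no restriction since gems are finite.\<close>
definition reg_genus_mfd :: "'c::finite itself \<Rightarrow> 'a::euclidean_space set \<Rightarrow> real" where
  "reg_genus_mfd _ P = Inf {reg_genus_graph V adj | (V :: nat set) (adj :: 'c \<Rightarrow> nat \<Rightarrow> nat). gem_of V adj P}"

text \<open>S^2 x S^1 x S^1 as the polyhedron (boundary of the cube) x (boundary of square)^2.\<close>
definition S2S1S1 :: "((real^3) \<times> (real^2) \<times> (real^2)) set" where
  "S2S1S1 = frontier (cbox (- 1) 1) \<times> frontier (cbox (- 1) 1) \<times> frontier (cbox (- 1) 1)"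

end

(* Lower bound: let F0 be the number of vertices and F1 = S + S' the number of edges of |K(Gamma)|,
   where S counts the edges joining labels that are not consecutive in eps and S' the others. The Euler
   characteristic of the polyhedron vanishes, so F0 - F1 + F2 - F3 + F4 = 0, and every link of an edge
   is a closed surface, of Euler characteristic at most 2; together these give rho_eps >= 1 - 2 F0 + S.
   For labels a, b the graph K_ab of the edges joining them meets every simplex and every facet of the
   complex. Hence a combination of the two angle functions of S^2 x S^1 x S^1 that lifts to the reals on
   K_ab lifts on all of |K(Gamma)|, which is impossible, so K_ab has first Betti number at least 2.
   Summing over the five pairs of nonconsecutive labels gives S >= 2 F0 + 5, hence rho_eps >= 6.

   Upper bound: the double of a triangle, crossed twice with the real line and triangulated by staircases,
   modulo a lattice acting on the triangle by rotations, gives 40 simplices with 5 vertices. *)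

theory Submission
  imports Defs
begin

section \<open>Colored graphs and their components\<close>

text \<open>\<open>gem_of\<close> supplies only a map, affine in pieces, that is bijective after
  gluing, so both topological inputs are extracted from it by elementary means. The Euler
  characteristic is an integral of indicator functions that gives 1 to every nonempty compact convex
  set; it depends on the polyhedron only, and its value 0 is read off from the 40-vertex gem, so the
  construction for the upper bound also feeds the lower one. Betti numbers enter by counting
  unknowns against equations: a violated inequality would give a linear system a nontrivial
  solution, which is then shown to vanish. For links this is an orthogonality argument; for the
  graphs \<open>K_ab\<close> real combinations of logarithms are glued over all simplices, and their
  periods may be dense but are countable.

  The lattice of the upper bound rotates the triangle, so the quotient is a twisted product. It is
  untwisted by an isotopy from the identity to the rotation by a third of a turn, and this isotopy
  has to be piecewise linear jointly in point and time, hence the formulas in \<open>min\<close> and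
  \<open>max\<close>.\<close>

lemma homogeneous_system_nontrivial_solution_coeff:
  fixes a :: "'e \<Rightarrow> 'x \<Rightarrow> real"
  assumes "finite E" "finite X" "card E < card X"
  shows "\<exists>y. (\<exists>x\<in>X. y x \<noteq> 0) \<and> (\<forall>x. x \<notin> X \<longrightarrow> y x = 0) \<and> (\<forall>e\<in>E. (\<Sum>x\<in>X. a e x * y x) = 0)"
  using assms
proof (induction E arbitrary: X a rule: finite_induct)
  case empty
  then obtain p where "p \<in> X" by (metis all_not_in_conv card.empty less_irrefl)
  then show ?case by (intro exI[of _ "\<lambda>x. if x = p then 1 else 0"]) auto
next
  case (insert e E)
  show ?case
  proof (cases "\<forall>x\<in>X. a e x = 0")
    case True
    have "card E < card X" using insert by simp
    from insert.IH[OF insert.prems(1) this, of a] True show ?thesis by auto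
  next
    case False
    then obtain p where p: "p \<in> X" "a e p \<noteq> 0" by auto
    have fX: "finite (X - {p})" "card E < card (X - {p})" using insert p by auto
    \<comment> \<open>Gaussian elimination: the equation \<open>e\<close> is solved for the unknown
      \<open>p\<close> and substituted into the others.\<close>
    obtain y where y: "\<exists>x\<in>X - {p}. y x \<noteq> 0" "\<forall>x. x \<notin> X - {p} \<longrightarrow> y x = 0"
      "\<forall>f\<in>E. (\<Sum>x\<in>X - {p}. (a f x - a f p * a e x / a e p) * y x) = 0"
      using insert.IH[OF fX, of "\<lambda>f x. a f x - a f p * a e x / a e p"] by auto
    define q where "q = (\<Sum>x\<in>X - {p}. a e x * y x)"
    define y' where "y' = y(p := - q / a e p)"
    have S: "(\<Sum>x\<in>X. a f x * y' x) = a f p * (- q / a e p) + (\<Sum>x\<in>X - {p}. a f x * y x)" for f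
    proof -
      have "(\<Sum>x\<in>X. a f x * y' x) = a f p * y' p + (\<Sum>x\<in>X - {p}. a f x * y' x)"
        using p insert.prems(1) by (simp add: sum.remove)
      also have "(\<Sum>x\<in>X - {p}. a f x * y' x) = (\<Sum>x\<in>X - {p}. a f x * y x)"
        by (intro sum.cong) (auto simp: y'_def)
      finally show ?thesis by (simp add: y'_def)
    qed
    have "(\<Sum>x\<in>X. a f x * y' x) = 0" if "f \<in> insert e E" for f
    proof (cases "f = e")
      case True
      then show ?thesis using p by (simp add: S q_def)
    next
      case False
      then have "f \<in> E" using that by auto
      then have "0 = (\<Sum>x\<in>X - {p}. (a f x - a f p * a e x / a e p) * y x)" using y by auto
      also have "\<dots> = (\<Sum>x\<in>X - {p}. a f x * y x) - (\<Sum>x\<in>X - {p}. (a f p / a e p) * (a e x * y x))"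
        by (simp add: sum_subtractf algebra_simps)
      also have "(\<Sum>x\<in>X - {p}. (a f p / a e p) * (a e x * y x)) = a f p / a e p * q"
        unfolding q_def by (rule sum_distrib_left[symmetric])
      finally show ?thesis by (simp add: S)
    qed
    moreover have "\<exists>x\<in>X. y' x \<noteq> 0" using y(1) by (auto simp: y'_def)
    moreover have "\<forall>x. x \<notin> X \<longrightarrow> y' x = 0" using y(2) p by (auto simp: y'_def)
    ultimately show ?thesis by blast
  qed
qed

text \<open>The equations are functionals known only to be linear, so that the systems below can be
  written with lookups at representatives instead of coefficient matrices; the coefficients are the
  values at unit vectors.\<close>

lemma homogeneous_system_nontrivial_solution:
  fixes L :: "'e \<Rightarrow> ('x \<Rightarrow> real) \<Rightarrow> real"
  assumes "finite E" "finite X" "card E < card X"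
    and lin: "\<And>e y y' c. e \<in> E \<Longrightarrow> L e (\<lambda>x. y x + c * y' x) = L e y + c * L e y'"
  obtains y where "\<exists>x\<in>X. y x \<noteq> 0" "\<And>x. x \<notin> X \<Longrightarrow> y x = 0" "\<And>e. e \<in> E \<Longrightarrow> L e y = 0"
proof -
  define \<delta> where "\<delta> p = (\<lambda>x. if x = p then 1 else 0 :: real)" for p :: 'x
  obtain y where y: "\<exists>x\<in>X. y x \<noteq> 0" "\<forall>x. x \<notin> X \<longrightarrow> y x = 0"
    "\<forall>e\<in>E. (\<Sum>x\<in>X. L e (\<delta> x) * y x) = 0"
    using homogeneous_system_nontrivial_solution_coeff[OF assms(1-3), of "\<lambda>e x. L e (\<delta> x)"] by auto
  have "L e y = 0" if e: "e \<in> E" for e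
  proof -
    have L0: "L e (\<lambda>_. 0) = 0" using lin[OF e, of "\<lambda>_. 0" 1 "\<lambda>_. 0"] by simp
    have "L e (\<lambda>x. \<Sum>p\<in>Y. y p * \<delta> p x) = (\<Sum>x\<in>Y. L e (\<delta> x) * y x)" if "finite Y" for Y
      using that
    proof (induction Y rule: finite_induct)
      case empty show ?case using L0 by simp
    next
      case (insert p Y)
      have "(\<lambda>x. \<Sum>q\<in>insert p Y. y q * \<delta> q x) = (\<lambda>x. (\<Sum>q\<in>Y. y q * \<delta> q x) + y p * \<delta> p x)"
        using insert by (auto simp: add.commute)
      then have "L e (\<lambda>x. \<Sum>q\<in>insert p Y. y q * \<delta> q x) = L e (\<lambda>x. \<Sum>q\<in>Y. y q * \<delta> q x) + y p * L e (\<delta> p)"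
        using lin[OF e, of "\<lambda>x. \<Sum>q\<in>Y. y q * \<delta> q x" "y p" "\<delta> p"] by simp
      then show ?case using insert by simp
    qed
    moreover have "(\<lambda>x. \<Sum>p\<in>X. y p * \<delta> p x) = y"
    proof
      fix x
      show "(\<Sum>p\<in>X. y p * \<delta> p x) = y x"
      proof (cases "x \<in> X")
        case True
        then show ?thesis using assms(2) by (simp add: \<delta>_def if_distrib sum.delta cong: if_cong)
      next
        case False
        then show ?thesis using y(2) by (auto simp: \<delta>_def intro!: sum.neutral)
      qed
    qed
    ultimately show ?thesis using assms(2) y(3) e by metis
  qed
  then show thesis using y that by metis
qed

section \<open>Components of color subgraphs as equivalence classes\<close>

definition comp_of :: "'v set \<Rightarrow> ('c \<Rightarrow> 'v \<Rightarrow> 'v) \<Rightarrow> 'c set \<Rightarrow> 'v \<Rightarrow> 'v set" where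
  "comp_of V adj C v = sub_rel V adj C `` {v}"

locale cgraph =
  fixes V :: "'v set" and adj :: "'c::finite \<Rightarrow> 'v \<Rightarrow> 'v"
  assumes cgraph: "colored_graph V adj"
begin

lemma finite_V: "finite V" using cgraph by (simp add: colored_graph_def)

lemma adj_V [simp]: "v \<in> V \<Longrightarrow> adj c v \<in> V" using cgraph by (simp add: colored_graph_def)

lemma adj_adj [simp]: "v \<in> V \<Longrightarrow> adj c (adj c v) = v" using cgraph by (simp add: colored_graph_def)

lemma adj_neq: "v \<in> V \<Longrightarrow> adj c v \<noteq> v" using cgraph by (simp add: colored_graph_def)

lemma sub_rel_adj: "v \<in> V \<Longrightarrow> c \<in> C \<Longrightarrow> (v, adj c v) \<in> sub_rel V adj C"
  unfolding sub_rel_def by auto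

lemma equiv_sub_rel: "equiv V (sub_rel V adj C)"
proof (rule equivI)
  let ?r = "{(v, w). v \<in> V \<and> (\<exists>c\<in>C. w = adj c v)}"
  have "sym ?r" by (auto simp: sym_def) (metis adj_adj)
  then have "sym (?r\<^sup>*)" by (rule sym_rtrancl)
  then show "sym (sub_rel V adj C)" unfolding sub_rel_def by (auto simp: sym_def)
  show "sub_rel V adj C \<subseteq> V \<times> V" by (auto simp: sub_rel_def)
  show "refl_on V (sub_rel V adj C)" by (auto simp: sub_rel_def refl_on_def)
  show "trans (sub_rel V adj C)" unfolding sub_rel_def by (auto simp: trans_def)
qed

lemma sub_rel_invariant:
  assumes "(v, w) \<in> sub_rel V adj C"
    and "\<And>v c. v \<in> V \<Longrightarrow> c \<in> C \<Longrightarrow> h (adj c v) = h v"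
  shows "h v = h w"
proof -
  have "(v, w) \<in> {(v, w). v \<in> V \<and> (\<exists>c\<in>C. w = adj c v)}\<^sup>*" using assms(1) by (simp add: sub_rel_def)
  then show ?thesis by (induction rule: rtrancl_induct) (use assms(2) in auto)
qed

lemma quotient_eq: "V // sub_rel V adj C = comp_of V adj C ` V"
  by (auto simp: quotient_def comp_of_def)

lemma g_comp_eq: "g_comp V adj C = card (comp_of V adj C ` V)"
  by (simp add: g_comp_def quotient_eq)

lemma comp_of_eq_iff: "v \<in> V \<Longrightarrow> w \<in> V \<Longrightarrow> comp_of V adj C v = comp_of V adj C w \<longleftrightarrow> (v, w) \<in> sub_rel V adj C"
  unfolding comp_of_def using eq_equiv_class_iff[OF equiv_sub_rel] by blast

lemma comp_of_adj [simp]: "v \<in> V \<Longrightarrow> c \<in> C \<Longrightarrow> comp_of V adj C (adj c v) = comp_of V adj C v"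
  using comp_of_eq_iff sub_rel_adj by (metis adj_V)

lemma comp_of_self: "v \<in> V \<Longrightarrow> v \<in> comp_of V adj C v"
  unfolding comp_of_def using equiv_class_self[OF equiv_sub_rel] by blast

lemma comp_of_subset: "comp_of V adj C v \<subseteq> V"
  unfolding comp_of_def sub_rel_def by auto

lemma comp_of_eqI: "v \<in> V \<Longrightarrow> w \<in> comp_of V adj C v \<Longrightarrow> comp_of V adj C w = comp_of V adj C v"
  using comp_of_eq_iff comp_of_subset unfolding comp_of_def
  by (metis Image_singleton_iff equiv_class_eq equiv_sub_rel)

definition rep :: "'v set \<Rightarrow> 'v" where "rep K = (SOME v. v \<in> K)"

lemma rep_comp: assumes "v \<in> V"
  shows "rep (comp_of V adj C v) \<in> V" "comp_of V adj C (rep (comp_of V adj C v)) = comp_of V adj C v"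
    "(rep (comp_of V adj C v), v) \<in> sub_rel V adj C"
proof -
  have r: "rep (comp_of V adj C v) \<in> comp_of V adj C v"
    unfolding rep_def using comp_of_self[OF assms] by (rule someI)
  then show 1: "rep (comp_of V adj C v) \<in> V" using comp_of_subset by blast
  show 2: "comp_of V adj C (rep (comp_of V adj C v)) = comp_of V adj C v"
    by (rule comp_of_eqI[OF assms r])
  then show "(rep (comp_of V adj C v), v) \<in> sub_rel V adj C"
    using comp_of_eq_iff 1 assms by blast
qed

lemma comp_of_empty: "v \<in> V \<Longrightarrow> comp_of V adj {} v = {v}"
  by (auto simp: comp_of_def sub_rel_def)

lemma g_comp_empty: "g_comp V adj {} = card V"
proof -
  have "comp_of V adj {} ` V = (\<lambda>v. {v}) ` V" using comp_of_empty by auto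
  then show ?thesis by (simp add: g_comp_eq card_image)
qed

lemma comp_of_singleton: assumes "v \<in> V" shows "comp_of V adj {c} v = {v, adj c v}"
proof
  show "{v, adj c v} \<subseteq> comp_of V adj {c} v"
    using comp_of_self comp_of_adj assms by (metis adj_V empty_subsetI insert_subset singletonI)
  show "comp_of V adj {c} v \<subseteq> {v, adj c v}"
  proof
    fix w assume "w \<in> comp_of V adj {c} v"
    then have "(v, w) \<in> sub_rel V adj {c}" by (simp add: comp_of_def)
    then have "{v, adj c v} = {w, adj c w}"
      by (rule sub_rel_invariant[where h = "\<lambda>v. {v, adj c v}"]) auto
    then show "w \<in> {v, adj c v}" by auto
  qed
qed

lemma g_comp_singleton: "2 * g_comp V adj {c} = card V"
proof -
  have "2 * card (V // sub_rel V adj {c}) = card (\<Union>(V // sub_rel V adj {c}))"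
  proof (rule card_partition)
    show "finite (V // sub_rel V adj {c})" using finite_V by (simp add: quotient_eq)
    show "finite (\<Union> (V // sub_rel V adj {c}))"
      using finite_V Union_quotient[OF equiv_sub_rel] by simp
    show "\<And>K. K \<in> V // sub_rel V adj {c} \<Longrightarrow> card K = 2"
      using adj_neq by (auto simp: quotient_eq comp_of_singleton card_2_iff)
    show "\<And>K L. K \<in> V // sub_rel V adj {c} \<Longrightarrow> L \<in> V // sub_rel V adj {c} \<Longrightarrow> K \<noteq> L \<Longrightarrow> K \<inter> L = {}"
      using quotient_disj[OF equiv_sub_rel] by blast
  qed
  then show ?thesis using Union_quotient[OF equiv_sub_rel] by (simp add: g_comp_def)
qed

lemma sum_adj: "(\<Sum>v\<in>V. h (adj c v)) = (\<Sum>v\<in>V. h v)"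
  by (rule sum.reindex_bij_witness[of _ "adj c" "adj c"]) auto

text \<open>A closed surface has Euler characteristic at most 2. The unknowns below are a value for each
  face and each vertex. The face part of each edge equation is
  orthogonal to the vertex part, because the face differences at the three edges of a vertex cancel;
  hence both parts vanish, and a solution is determined by one face and one vertex per component.\<close>

lemma g_comp_triple_le:
  "g_comp V adj {a, b} + g_comp V adj {b, c} + g_comp V adj {c, a} + card V
    \<le> g_comp V adj {a} + g_comp V adj {b} + g_comp V adj {c} + 2 * g_comp V adj {a, b, c}"
proof (rule ccontr)
  assume neg: "\<not> ?thesis"
  let ?K = "comp_of V adj"
  \<comment> \<open>The first entry of a pair is a tag: in \<open>X\<close>, 0 to 2 for the faces of
    the three color pairs and 3 for the vertices; in \<open>E\<close>, 0 to 2 for the edges of the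
    three colors, 3 and 4 for the two normalizations of each component.\<close>
  define X where "X = {0::nat} \<times> ?K {a,b} ` V \<union> {1} \<times> ?K {b,c} ` V \<union> {2} \<times> ?K {c,a} ` V \<union> {3} \<times> ?K {} ` V"
  define E where "E = {0::nat} \<times> ?K {a} ` V \<union> {1} \<times> ?K {b} ` V \<union> {2} \<times> ?K {c} ` V
     \<union> {3} \<times> ?K {a,b,c} ` V \<union> {4} \<times> ?K {a,b,c} ` V"
  define L :: "nat \<times> 'v set \<Rightarrow> (nat \<times> 'v set \<Rightarrow> real) \<Rightarrow> real" where "L e y = (let v = rep (snd e) in
     if fst e = 0 then y (0, ?K {a,b} v) - y (2, ?K {c,a} v) + y (3, ?K {} v) + y (3, ?K {} (adj a v))
     else if fst e = 1 then y (1, ?K {b,c} v) - y (0, ?K {a,b} v) + y (3, ?K {} v) + y (3, ?K {} (adj b v))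
     else if fst e = 2 then y (2, ?K {c,a} v) - y (1, ?K {b,c} v) + y (3, ?K {} v) + y (3, ?K {} (adj c v))
     else if fst e = 3 then y (0, ?K {a,b} v)
     else y (3, ?K {} v))" for e y
  have fin: "finite X" "finite E" using finite_V by (auto simp: X_def E_def)
  have "card X = g_comp V adj {a, b} + g_comp V adj {b, c} + g_comp V adj {c, a} + card V"
    unfolding X_def using finite_V
    by (subst card_Un_disjoint; (force simp: g_comp_eq card_cartesian_product g_comp_empty[symmetric])?)+
  moreover have "card E = g_comp V adj {a} + g_comp V adj {b} + g_comp V adj {c} + 2 * g_comp V adj {a, b, c}"
    unfolding E_def using finite_V
    by (subst card_Un_disjoint; (force simp: g_comp_eq card_cartesian_product)?)+
  ultimately have "card E < card X" using neg by simp
  moreover have "L e (\<lambda>x. y x + k * y' x) = L e y + k * L e y'" for e y y' k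
    by (simp add: L_def Let_def algebra_simps)
  ultimately obtain y where y: "\<exists>x\<in>X. y x \<noteq> 0" "\<And>e. e \<in> E \<Longrightarrow> L e y = 0"
    using homogeneous_system_nontrivial_solution[OF fin(2) fin(1), of L] by metis
  define P Q R s where "P v = y (0, ?K {a,b} v)" and "Q v = y (1, ?K {b,c} v)" and "R v = y (2, ?K {c,a} v)"
    and "s v = y (3, ?K {} v)" for v
  have invP: "P (adj a v) = P v" "P (adj b v) = P v" if "v \<in> V" for v using that by (auto simp: P_def)
  have invQ: "Q (adj b v) = Q v" "Q (adj c v) = Q v" if "v \<in> V" for v using that by (auto simp: Q_def)
  have invR: "R (adj c v) = R v" "R (adj a v) = R v" if "v \<in> V" for v using that by (auto simp: R_def)
  \<comment> \<open>Each edge equation is imposed at one representative endpoint only; its left side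
    is symmetric in the two endpoints, so it holds at both.\<close>
  have symm: "h v = 0" if "v \<in> V" "\<And>v. v \<in> V \<Longrightarrow> h (adj d v) = h v" "h (rep (?K {d} v)) = 0" for d v and h :: "'v \<Rightarrow> real"
    using sub_rel_invariant[OF rep_comp(3)[OF that(1)], of "{d}" h] that by auto
  have ea: "P v - R v + s v + s (adj a v) = 0" if v: "v \<in> V" for v
    by (rule symm[OF v, of "\<lambda>v. P v - R v + s v + s (adj a v)" a])
       (use invP invR y(2)[of "(0, ?K {a} v)"] v in \<open>auto simp: L_def Let_def E_def P_def R_def s_def\<close>)
  have eb: "Q v - P v + s v + s (adj b v) = 0" if v: "v \<in> V" for v
    by (rule symm[OF v, of "\<lambda>v. Q v - P v + s v + s (adj b v)" b])
       (use invP invQ y(2)[of "(1, ?K {b} v)"] v in \<open>auto simp: L_def Let_def E_def P_def Q_def s_def\<close>)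
  have ec: "R v - Q v + s v + s (adj c v) = 0" if v: "v \<in> V" for v
    by (rule symm[OF v, of "\<lambda>v. R v - Q v + s v + s (adj c v)" c])
       (use invQ invR y(2)[of "(2, ?K {c} v)"] v in \<open>auto simp: L_def Let_def E_def Q_def R_def s_def\<close>)
  \<comment> \<open>Here \<open>h\<close> is the face difference across the edges of color
    \<open>d\<close>. Pairing the edge equation with \<open>h\<close> and exchanging endpoints turns
    the square sum of \<open>h\<close> into a multiple of its pairing with \<open>s\<close>; as the
    three differences add up to 0 at every vertex, so do the three square sums.\<close>
  have sw: "(\<Sum>v\<in>V. (h v)\<^sup>2) = - 2 * (\<Sum>v\<in>V. h v * s v)"
    if "\<And>v. v \<in> V \<Longrightarrow> h v + s v + s (adj d v) = 0" "\<And>v. v \<in> V \<Longrightarrow> h (adj d v) = h v" for h d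
  proof -
    have "(\<Sum>v\<in>V. (h v)\<^sup>2) = (\<Sum>v\<in>V. - (h v * s v) - h v * s (adj d v))"
    proof (rule sum.cong)
      fix v assume "v \<in> V"
      then have "h v = - s v - s (adj d v)" using that(1)[of v] by simp
      then have "h v * h v = h v * (- s v - s (adj d v))" by simp
      then show "(h v)\<^sup>2 = - (h v * s v) - h v * s (adj d v)" by (simp add: power2_eq_square algebra_simps)
    qed simp
    also have "\<dots> = - (\<Sum>v\<in>V. h v * s v) - (\<Sum>v\<in>V. h v * s (adj d v))" by (simp add: sum_subtractf sum_negf)
    also have "(\<Sum>v\<in>V. h v * s (adj d v)) = (\<Sum>v\<in>V. h (adj d v) * s (adj d v))"
      by (rule sum.cong) (use that(2) in auto)
    also have "\<dots> = (\<Sum>v\<in>V. h v * s v)" by (rule sum_adj)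
    finally show ?thesis by simp
  qed
  have "(\<Sum>v\<in>V. (P v - R v)\<^sup>2) + (\<Sum>v\<in>V. (Q v - P v)\<^sup>2) + (\<Sum>v\<in>V. (R v - Q v)\<^sup>2)
      = - 2 * ((\<Sum>v\<in>V. (P v - R v) * s v) + (\<Sum>v\<in>V. (Q v - P v) * s v) + (\<Sum>v\<in>V. (R v - Q v) * s v))"
    using sw[of "\<lambda>v. P v - R v" a] sw[of "\<lambda>v. Q v - P v" b] sw[of "\<lambda>v. R v - Q v" c]
      ea eb ec invP invQ invR by simp
  also have "\<dots> = 0" by (simp add: sum.distrib[symmetric] algebra_simps)
  finally have z: "(\<Sum>v\<in>V. (P v - R v)\<^sup>2 + (Q v - P v)\<^sup>2 + (R v - Q v)\<^sup>2) = 0" by (simp add: sum.distrib)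
  have eq: "P v = R v \<and> Q v = P v" if "v \<in> V" for v
  proof -
    have "(P v - R v)\<^sup>2 + (Q v - P v)\<^sup>2 + (R v - Q v)\<^sup>2 = 0"
      using z that finite_V by (subst (asm) sum_nonneg_eq_0_iff) auto
    then have "(P v - R v)\<^sup>2 = 0" "(Q v - P v)\<^sup>2 = 0" by (smt (verit) zero_le_power2)+
    then show ?thesis by simp
  qed
  have "P v = 0" if v: "v \<in> V" for v
  proof -
    have "P (rep (?K {a,b,c} v)) = P v"
      by (rule sub_rel_invariant[OF rep_comp(3)[OF v]]) (use eq invP invQ invR in auto)
    then show ?thesis using y(2)[of "(3, ?K {a,b,c} v)"] v by (auto simp: L_def E_def P_def)
  qed
  moreover have "s v = 0" if v: "v \<in> V" for v
  proof -
    \<comment> \<open>The vertex part changes sign along every edge, so only its absolute value is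
      constant on a component; this covers orientable and nonorientable surfaces alike.\<close>
    have "\<bar>s (rep (?K {a,b,c} v))\<bar> = \<bar>s v\<bar>"
      by (rule sub_rel_invariant[OF rep_comp(3)[OF v]]) (use eq ea eb ec in \<open>auto simp: abs_if, (smt (verit))+\<close>)
    then show ?thesis using y(2)[of "(4, ?K {a,b,c} v)"] v by (auto simp: L_def E_def s_def)
  qed
  ultimately have "\<forall>x\<in>X. y x = 0" using eq
    by (auto simp: X_def P_def Q_def R_def s_def)
  then show False using y(1) by blast
qed

end

section \<open>The Euler characteristic of unions of convex sets\<close>

text \<open>Compare the vanishing sum at a right endpoint \<open>b\<close> with the one just to the
  right of \<open>b\<close>: the difference is the total coefficient of the intervals that end at
  \<open>b\<close>. Every interval has exactly one right endpoint.\<close>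

lemma sum_coeffs_intervals_eq_0:
  fixes \<alpha> \<beta> c :: "'i \<Rightarrow> real"
  assumes "finite I" and le: "\<And>i. i \<in> I \<Longrightarrow> \<alpha> i \<le> \<beta> i"
    and zero: "\<And>t. (\<Sum>i\<in>I. if t \<in> {\<alpha> i..\<beta> i} then c i else 0) = 0"
  shows "sum c I = 0"
proof -
  have z: "(\<Sum>i | i \<in> I \<and> \<beta> i = b. c i) = 0" if "b \<in> \<beta> ` I" for b
  proof -
    define D where "D = {x \<in> \<alpha> ` I \<union> \<beta> ` I. x > b}"
    have fD: "finite D" using assms(1) by (simp add: D_def)
    \<comment> \<open>A point to the right of \<open>b\<close> and before every later endpoint;
      after the last endpoint any larger number will do.\<close>
    define t where "t = (if D = {} then b + 1 else (b + Min D) / 2)"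
    have t: "b < t" "\<And>x. x \<in> D \<Longrightarrow> t < x"
    proof -
      show "b < t"
      proof (cases "D = {}")
        case False
        then have "b < Min D" using Min_in[OF fD False] by (auto simp: D_def)
        then show ?thesis using False by (simp add: t_def)
      qed (simp add: t_def)
      fix x assume x: "x \<in> D"
      then have "D \<noteq> {}" "Min D \<le> x" using fD by auto
      moreover have "b < x" using x by (simp add: D_def)
      ultimately show "t < x" by (simp add: t_def)
    qed
    have "(\<Sum>i | i \<in> I \<and> \<beta> i = b. c i) = (\<Sum>i\<in>I. if \<beta> i = b then c i else 0)"
      using assms(1) by (simp add: sum.If_cases Int_def)
    also have "\<dots> = (\<Sum>i\<in>I. (if b \<in> {\<alpha> i..\<beta> i} then c i else 0) - (if t \<in> {\<alpha> i..\<beta> i} then c i else 0))"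
    proof (rule sum.cong)
      fix i assume i: "i \<in> I"
      consider "\<beta> i < b" | "\<beta> i = b" | "\<beta> i > b" "\<alpha> i \<le> b" | "\<beta> i > b" "\<alpha> i > b" by linarith
      then show "(if \<beta> i = b then c i else 0)
        = (if b \<in> {\<alpha> i..\<beta> i} then c i else 0) - (if t \<in> {\<alpha> i..\<beta> i} then c i else 0)"
      proof cases
        case 3
        then have "t < \<beta> i" using i by (intro t(2)) (auto simp: D_def)
        then show ?thesis using 3 t(1) by auto
      next
        case 4
        then have "t < \<alpha> i" using i by (intro t(2)) (auto simp: D_def)
        then show ?thesis using 4 by auto
      qed (use t(1) le[OF i] in auto)
    qed simp
    also have "\<dots> = 0" by (simp only: sum_subtractf zero)
    finally show ?thesis .
  qed
  have "sum c I = (\<Sum>b\<in>\<beta> ` I. \<Sum>i | i \<in> I \<and> \<beta> i = b. c i)"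
    using assms(1) by (rule sum.image_gen)
  also have "\<dots> = 0" using z by simp
  finally show ?thesis .
qed

text \<open>\<open>B\<close> is the set of free coordinates. Fixing one of them at \<open>t\<close>
  gives a thinner slice, to which the induction hypothesis applies; the values \<open>t\<close>
  whose slice meets a given compact convex set form an interval, so
  \<open>sum_coeffs_intervals_eq_0\<close> finishes the step.\<close>

lemma sum_coeffs_convex_slice_eq_0:
  fixes Q :: "'i \<Rightarrow> 'a::euclidean_space set" and c :: "'i \<Rightarrow> real"
  assumes "finite B" "B \<subseteq> Basis" "finite I"
    and "\<And>i. i \<in> I \<Longrightarrow> compact (Q i) \<and> convex (Q i)"
    and "\<And>x. \<forall>b\<in>Basis - B. x \<bullet> b = p \<bullet> b \<Longrightarrow> (\<Sum>i\<in>I. c i * indicat_real (Q i) x) = 0"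
  shows "(\<Sum>i\<in>I. if Q i \<inter> {x. \<forall>b\<in>Basis - B. x \<bullet> b = p \<bullet> b} \<noteq> {} then c i else 0) = 0"
  using assms
proof (induction B arbitrary: p rule: finite_induct)
  case empty
  have "{x. \<forall>b\<in>Basis - {}. x \<bullet> b = p \<bullet> b} = {p}" by (auto intro: euclidean_eqI)
  moreover have "(\<Sum>i\<in>I. c i * indicat_real (Q i) p) = 0" using empty(4) by simp
  ultimately show ?case by (simp add: indicator_def of_bool_def mult_if_delta if_distrib cong: if_cong)
next
  case (insert b B)
  define A where "A = {x. \<forall>b'\<in>Basis - insert b B. x \<bullet> b' = p \<bullet> b'}"
  define J where "J = {i \<in> I. Q i \<inter> A \<noteq> {}}"
  have b: "b \<in> Basis" "b \<notin> B" using insert by auto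
  have Aeq: "A = (\<Inter>b'\<in>Basis - insert b B. {x. b' \<bullet> x = p \<bullet> b'})"
    by (auto simp: A_def inner_commute)
  have clA: "closed A" "convex A" unfolding Aeq by (auto intro!: closed_INT convex_INT closed_hyperplane convex_hyperplane)
  have "\<exists>\<alpha> \<beta>. (\<lambda>x. x \<bullet> b) ` (Q i \<inter> A) = {\<alpha>..\<beta>} \<and> \<alpha> \<le> \<beta>" if "i \<in> J" for i
  proof -
    have Q: "compact (Q i)" "convex (Q i)" "Q i \<inter> A \<noteq> {}" using that insert.prems(3) by (auto simp: J_def)
    have "compact ((\<lambda>x. x \<bullet> b) ` (Q i \<inter> A))"
      using Q clA by (intro compact_continuous_image compact_Int_closed continuous_intros)
    moreover have "connected ((\<lambda>x. x \<bullet> b) ` (Q i \<inter> A))"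
      using Q clA by (intro connected_continuous_image convex_connected convex_Int continuous_intros)
    ultimately obtain u v where "(\<lambda>x. x \<bullet> b) ` (Q i \<inter> A) = {u..v}"
      using connected_compact_interval_1[of "(\<lambda>x. x \<bullet> b) ` (Q i \<inter> A)"] by auto
    moreover have "{u..v} \<noteq> {}" using Q(3) calculation by (metis image_is_empty)
    then have "u \<le> v" by simp
    ultimately show ?thesis by blast
  qed
  then obtain \<alpha> \<beta> where ab: "\<And>i. i \<in> J \<Longrightarrow> (\<lambda>x. x \<bullet> b) ` (Q i \<inter> A) = {\<alpha> i..\<beta> i} \<and> \<alpha> i \<le> \<beta> i"
    by metis
  have "sum c J = 0"
  proof (rule sum_coeffs_intervals_eq_0[of J \<alpha> \<beta>])
    show "finite J" using insert.prems by (simp add: J_def)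
    fix t :: real
    define q where "q = p + (t - p \<bullet> b) *\<^sub>R b"
    have qb: "q \<bullet> b = t" using b by (simp add: q_def inner_add_left)
    have qb': "q \<bullet> b' = p \<bullet> b'" if "b' \<in> Basis - insert b B" for b'
      using b that by (auto simp: q_def inner_add_left inner_Basis)
    have At: "{x. \<forall>b'\<in>Basis - B. x \<bullet> b' = q \<bullet> b'} = {x \<in> A. x \<bullet> b = t}"
    proof -
      have "Basis - B = insert b (Basis - insert b B)" using b by auto
      then show ?thesis using qb qb' by (auto simp: A_def)
    qed
    have "(\<Sum>i\<in>I. if Q i \<inter> {x. \<forall>b'\<in>Basis - B. x \<bullet> b' = q \<bullet> b'} \<noteq> {} then c i else 0) = 0"
    proof (rule insert.IH)
      fix x assume "\<forall>b'\<in>Basis - B. x \<bullet> b' = q \<bullet> b'"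
      then have "x \<in> A" using At by blast
      then show "(\<Sum>i\<in>I. c i * indicat_real (Q i) x) = 0" using insert.prems(4) by (simp add: A_def)
    qed (use insert in auto)
    also have "(\<Sum>i\<in>I. if Q i \<inter> {x. \<forall>b'\<in>Basis - B. x \<bullet> b' = q \<bullet> b'} \<noteq> {} then c i else 0)
       = (\<Sum>i\<in>J. if t \<in> {\<alpha> i..\<beta> i} then c i else 0)"
    proof (rule sum.mono_neutral_cong_right)
      show "\<forall>i\<in>I - J. (if Q i \<inter> {x. \<forall>b'\<in>Basis - B. x \<bullet> b' = q \<bullet> b'} \<noteq> {} then c i else 0) = 0"
        unfolding At by (auto simp: J_def)
      fix i assume "i \<in> J"
      then have "{\<alpha> i..\<beta> i} = (\<lambda>x. x \<bullet> b) ` (Q i \<inter> A)" using ab by simp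
      then have "t \<in> {\<alpha> i..\<beta> i} \<longleftrightarrow> Q i \<inter> {x \<in> A. x \<bullet> b = t} \<noteq> {}"
        by auto
      then show "(if Q i \<inter> {x. \<forall>b'\<in>Basis - B. x \<bullet> b' = q \<bullet> b'} \<noteq> {} then c i else 0) =
         (if t \<in> {\<alpha> i..\<beta> i} then c i else 0)" unfolding At by simp
    qed (use insert.prems in \<open>auto simp: J_def\<close>)
    finally show "(\<Sum>i\<in>J. if t \<in> {\<alpha> i..\<beta> i} then c i else 0) = 0" .
  qed (use ab in auto)
  moreover have "sum c J = (\<Sum>i\<in>I. if Q i \<inter> A \<noteq> {} then c i else 0)"
    unfolding J_def using insert.prems(2) by (rule sum.inter_filter)
  ultimately show ?case unfolding A_def by simp
qed

lemma sum_coeffs_convex_eq_0: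
  fixes Q :: "'i \<Rightarrow> 'a::euclidean_space set" and c :: "'i \<Rightarrow> real"
  assumes "finite I" "\<And>i. i \<in> I \<Longrightarrow> compact (Q i) \<and> convex (Q i) \<and> Q i \<noteq> {}"
    and "\<And>x. (\<Sum>i\<in>I. c i * indicat_real (Q i) x) = 0"
  shows "sum c I = 0"
  using sum_coeffs_convex_slice_eq_0[of Basis I Q 0 c] assms by simp

text \<open>Since compact convex sets are contractible, \<open>n\<close> is the Euler characteristic of \<open>\<phi>\<close>, as an integral.\<close>

definition euler_rep :: "'a::euclidean_space set set \<Rightarrow> ('a \<Rightarrow> real) \<Rightarrow> real \<Rightarrow> bool" where
  "euler_rep \<P> \<phi> n \<longleftrightarrow> (\<exists>l. (\<forall>(c, Q) \<in> set l. Q \<in> \<P> \<and> compact Q \<and> convex Q \<and> Q \<noteq> {}) \<and>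
     (\<forall>x. \<phi> x = (\<Sum>(c, Q)\<leftarrow>l. c * indicat_real Q x)) \<and> n = (\<Sum>(c, Q)\<leftarrow>l. c))"

lemma euler_rep_add:
  assumes "euler_rep \<P> \<phi> m" "euler_rep \<P> \<psi> n"
  shows "euler_rep \<P> (\<lambda>x. \<phi> x + \<psi> x) (m + n)"
proof -
  obtain l where "\<forall>(c, Q) \<in> set l. Q \<in> \<P> \<and> compact Q \<and> convex Q \<and> Q \<noteq> {}"
     "\<forall>x. \<phi> x = (\<Sum>(c, Q)\<leftarrow>l. c * indicat_real Q x)" "m = (\<Sum>(c, Q)\<leftarrow>l. c)"
    using assms(1) unfolding euler_rep_def by blast
  moreover obtain l' where "\<forall>(c, Q) \<in> set l'. Q \<in> \<P> \<and> compact Q \<and> convex Q \<and> Q \<noteq> {}"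
     "\<forall>x. \<psi> x = (\<Sum>(c, Q)\<leftarrow>l'. c * indicat_real Q x)" "n = (\<Sum>(c, Q)\<leftarrow>l'. c)"
    using assms(2) unfolding euler_rep_def by blast
  ultimately show ?thesis unfolding euler_rep_def by (intro exI[of _ "l @ l'"]) auto
qed

lemma euler_rep_scale:
  assumes "euler_rep \<P> \<phi> m" shows "euler_rep \<P> (\<lambda>x. k * \<phi> x) (k * m)"
proof -
  obtain l where l: "\<forall>(c, Q) \<in> set l. Q \<in> \<P> \<and> compact Q \<and> convex Q \<and> Q \<noteq> {}"
     "\<forall>x. \<phi> x = (\<Sum>(c, Q)\<leftarrow>l. c * indicat_real Q x)" "m = (\<Sum>(c, Q)\<leftarrow>l. c)"
    using assms(1) unfolding euler_rep_def by blast
  have "(\<Sum>(c, Q)\<leftarrow>map (\<lambda>(c, Q). (k * c, Q)) l. c * g Q) = k * (\<Sum>(c, Q)\<leftarrow>l. c * g Q)" for g :: "'a set \<Rightarrow> real"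
    by (induction l) (auto simp: algebra_simps)
  from this this[of "\<lambda>_. 1"] l show ?thesis unfolding euler_rep_def
    by (intro exI[of _ "map (\<lambda>(c, Q). (k * c, Q)) l"]) auto
qed

lemma euler_rep_0: "euler_rep \<P> (\<lambda>x. 0) 0"
  unfolding euler_rep_def by (intro exI[of _ "[]"]) auto

lemma euler_rep_empty: "euler_rep \<P> (indicat_real {}) 0"
  using euler_rep_0 by (simp add: indicator_def[abs_def])

lemma euler_rep_diff:
  assumes "euler_rep \<P> \<phi> m" "euler_rep \<P> \<psi> n"
  shows "euler_rep \<P> (\<lambda>x. \<phi> x - \<psi> x) (m - n)"
  using euler_rep_add[OF assms(1) euler_rep_scale[OF assms(2), of "- 1"]] by simp

lemma euler_rep_sum:
  assumes "finite S" "\<And>s. s \<in> S \<Longrightarrow> euler_rep \<P> (\<phi> s) (m s)"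
  shows "euler_rep \<P> (\<lambda>x. \<Sum>s\<in>S. \<phi> s x) (sum m S)"
  using assms by (induction S rule: finite_induct) (auto simp: euler_rep_0 intro: euler_rep_add)

lemma euler_rep_indicator:
  "compact Q \<Longrightarrow> convex Q \<Longrightarrow> Q \<in> \<P> \<Longrightarrow> Q \<noteq> {} \<Longrightarrow> euler_rep \<P> (indicat_real Q) 1"
  unfolding euler_rep_def by (intro exI[of _ "[(1, Q)]"]) auto

lemma euler_rep_mono: "euler_rep \<P> \<phi> n \<Longrightarrow> \<P> \<subseteq> \<P>' \<Longrightarrow> euler_rep \<P>' \<phi> n"
  unfolding euler_rep_def case_prod_beta by blast

text \<open>The two families may differ: a representation by small sets, inside the pieces of a
  piecewise affine map, can thus be evaluated by comparison with one that uses a large convex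
  set.\<close>

lemma euler_rep_unique:
  assumes "euler_rep \<P> \<phi> m" "euler_rep \<P>' \<phi> n" shows "m = n"
proof -
  have "euler_rep UNIV (\<lambda>x. \<phi> x - \<phi> x) (m - n)"
    using assms euler_rep_mono by (intro euler_rep_diff) blast+
  then obtain l where l: "\<forall>(c, Q) \<in> set l. compact Q \<and> convex Q \<and> Q \<noteq> {}"
     "\<forall>x. \<phi> x - \<phi> x = (\<Sum>(c, Q)\<leftarrow>l. c * indicat_real Q x)" "m - n = (\<Sum>(c, Q)\<leftarrow>l. c)"
    unfolding euler_rep_def by blast
  have "sum (\<lambda>i. fst (l ! i)) {..<length l} = 0"
  proof (rule sum_coeffs_convex_eq_0[of _ "\<lambda>i. snd (l ! i)"])
    show "compact (snd (l ! i)) \<and> convex (snd (l ! i)) \<and> snd (l ! i) \<noteq> {}" if "i \<in> {..<length l}" for i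
      using l(1) that by (auto simp: case_prod_beta)
    show "(\<Sum>i<length l. fst (l ! i) * indicat_real (snd (l ! i)) x) = 0" for x
      using l(2) by (auto simp: case_prod_beta sum_list_sum_nth atLeast0LessThan)
  qed simp
  then show ?thesis using l(3) by (simp add: case_prod_beta sum_list_sum_nth atLeast0LessThan)
qed

text \<open>Inclusion and exclusion, one member of \<open>U\<close> at a time. The number stays
  unspecified because \<open>euler_rep_unique\<close> determines it afterwards; what matters is that
  all sets used lie inside members of \<open>U\<close>.\<close>

lemma euler_rep_Int_Union:
  assumes "finite U" "\<And>t. t \<in> U \<Longrightarrow> compact t \<and> convex t" "compact F" "convex F"
  shows "\<exists>n. euler_rep {Q. \<exists>t\<in>U. Q \<subseteq> t} (indicat_real (F \<inter> \<Union>U)) n"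
  using assms
proof (induction U arbitrary: F rule: finite_induct)
  case empty
  have "F \<inter> \<Union>{} = {}" by simp
  then show ?case using euler_rep_empty by metis
next
  case (insert t U)
  let ?P = "{Q. \<exists>t\<in>insert t U. Q \<subseteq> t}"
  have Ft: "compact (F \<inter> t)" "convex (F \<inter> t)"
    using insert by (auto intro: compact_Int convex_Int)
  have "\<exists>n. euler_rep ?P (indicat_real (F \<inter> t)) n"
  proof (cases "F \<inter> t = {}")
    case True
    then show ?thesis using euler_rep_empty by metis
  next
    case False
    then show ?thesis using euler_rep_indicator[of "F \<inter> t" ?P] Ft by auto
  qed
  then obtain k where k: "euler_rep ?P (indicat_real (F \<inter> t)) k" ..
  obtain m where m: "euler_rep ?P (indicat_real (F \<inter> \<Union>U)) m"
    using insert.IH[of F] insert.prems by (auto intro: euler_rep_mono)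
  obtain n where n: "euler_rep ?P (indicat_real ((F \<inter> t) \<inter> \<Union>U)) n"
    using insert.IH[of "F \<inter> t"] insert.prems Ft by (auto intro: euler_rep_mono)
  have "euler_rep ?P (\<lambda>x. indicat_real (F \<inter> t) x + indicat_real (F \<inter> \<Union>U) x
      - indicat_real ((F \<inter> t) \<inter> \<Union>U) x) (k + m - n)"
    by (intro euler_rep_diff euler_rep_add k m n)
  also have "(\<lambda>x. indicat_real (F \<inter> t) x + indicat_real (F \<inter> \<Union>U) x
      - indicat_real ((F \<inter> t) \<inter> \<Union>U) x) = indicat_real (F \<inter> \<Union>(insert t U))"
    by (rule ext, case_tac "x \<in> F"; case_tac "x \<in> t"; case_tac "x \<in> \<Union>U"; simp)
  finally show ?case by blast
qed

text \<open>Each set of the representation lies in a piece where \<open>f\<close> is affine, so its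
  image is again compact and convex; injectivity on \<open>X\<close> makes the indicators of the
  images add up as before.\<close>

lemma euler_rep_affine_image:
  fixes f :: "'a::euclidean_space \<Rightarrow> 'b::euclidean_space"
  assumes "euler_rep \<P> (indicat_real S) n" "inj_on f X" "S \<subseteq> X"
    and pieces: "\<And>Q. Q \<in> \<P> \<Longrightarrow> Q \<subseteq> X \<and> (\<exists>g c. linear g \<and> (\<forall>x\<in>Q. f x = g x + c))"
  shows "euler_rep UNIV (indicat_real (f ` S)) n"
proof -
  obtain l where l: "\<forall>(c, Q) \<in> set l. Q \<in> \<P> \<and> compact Q \<and> convex Q \<and> Q \<noteq> {}"
     "\<forall>x. indicat_real S x = (\<Sum>(c, Q)\<leftarrow>l. c * indicat_real Q x)" "n = (\<Sum>(c, Q)\<leftarrow>l. c)"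
    using assms(1) unfolding euler_rep_def by blast
  let ?l = "map (\<lambda>(c, Q). (c, f ` Q)) l"
  have lQ: "Q \<in> \<P>" "compact Q" "convex Q" "Q \<noteq> {}" if "(c, Q) \<in> set l" for c Q
    using l(1) that by auto
  have lX: "Q \<subseteq> X" if "(c, Q) \<in> set l" for c Q using lQ(1)[OF that] pieces by blast
  have "compact (f ` Q) \<and> convex (f ` Q) \<and> f ` Q \<noteq> {}" if "(c, Q) \<in> set l" for c Q
  proof -
    have Q: "Q \<in> \<P>" "compact Q" "convex Q" "Q \<noteq> {}" using lQ[OF that] by auto
    obtain g d where g: "linear g" "\<forall>x\<in>Q. f x = g x + d" using pieces Q(1) by blast
    have "f ` Q = (+) d ` g ` Q" using g(2) by (force simp: add.commute)
    then show ?thesis using Q g(1)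
      by (auto intro!: compact_translation convex_translation compact_continuous_image convex_linear_image
          linear_continuous_on simp: linear_conv_bounded_linear)
  qed
  then have 1: "\<forall>(c, Q) \<in> set ?l. Q \<in> UNIV \<and> compact Q \<and> convex Q \<and> Q \<noteq> {}" by auto
  have 2: "indicat_real (f ` S) y = (\<Sum>(c, Q)\<leftarrow>?l. c * indicat_real Q y)" for y
  proof (cases "y \<in> f ` X")
    case True
    then obtain x where x: "x \<in> X" "y = f x" by auto
    have ind: "indicat_real (f ` Q) y = indicat_real Q x" if "Q \<subseteq> X" for Q
      using that x assms(2) by (auto simp: indicator_def dest: inj_onD)
    have "(\<Sum>(c, Q)\<leftarrow>?l. c * indicat_real Q y) = (\<Sum>(c, Q)\<leftarrow>l. c * indicat_real (f ` Q) y)"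
      by (simp add: o_def split_def)
    also have "\<dots> = (\<Sum>(c, Q)\<leftarrow>l. c * indicat_real Q x)"
      using ind lX by (intro arg_cong[of _ _ sum_list] map_cong) auto
    finally show ?thesis using l(2) ind[OF assms(3)] by simp
  next
    case False
    have "(\<Sum>(c, Q)\<leftarrow>?l. c * indicat_real Q y) = (\<Sum>(c, Q)\<leftarrow>l. c * indicat_real (f ` Q) y)"
      by (simp add: o_def split_def)
    also have "\<dots> = (\<Sum>(c, Q)\<leftarrow>l. 0)"
    proof (intro arg_cong[of _ _ sum_list] map_cong refl)
      fix p assume "p \<in> set l"
      then have "y \<notin> f ` snd p" using False lX[of "fst p" "snd p"] by auto
      then show "(case p of (c, Q) \<Rightarrow> c * indicat_real (f ` Q) y) = (case p of (c, Q) \<Rightarrow> 0)"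
        by (simp add: split_def)
    qed
    finally show ?thesis using False assms(3) by (auto simp: indicator_def split_def)
  qed
  show ?thesis unfolding euler_rep_def
    by (intro exI[of _ ?l]) (use 1 2 l(3) in \<open>auto simp: o_def split_def\<close>)
qed

section \<open>The Euler characteristic of a gem\<close>

locale gem_map = cgraph V adj for V :: "'v set" and adj :: "'c::finite \<Rightarrow> 'v \<Rightarrow> 'v" +
  fixes f :: "'v \<Rightarrow> real^'c \<Rightarrow> 'a::euclidean_space" and P :: "'a set"
  assumes pl: "v \<in> V \<Longrightarrow> pl_on std_simplex (f v)"
    and cover: "(\<Union>v\<in>V. f v ` std_simplex) = P"
    and glue: "v \<in> V \<Longrightarrow> w \<in> V \<Longrightarrow> x \<in> std_simplex \<Longrightarrow> y \<in> std_simplex \<Longrightarrow>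
        f v x = f w y \<longleftrightarrow> ((v, x), (w, y)) \<in> (glue_rel V adj)\<^sup>*"

lemma gem_of_iff: "gem_of V adj P \<longleftrightarrow> (\<exists>f. gem_map V adj f P)"
  unfolding gem_of_def gem_map_def gem_map_axioms_def cgraph_def by auto

text \<open>For a point of the simplex these are the colors of the facets that contain it, hence the
  colors along which it is glued to other simplices.\<close>

definition zeros :: "real^'c::finite \<Rightarrow> 'c set" where "zeros x = {j. x $ j = 0}"

definition open_face :: "'c::finite set \<Rightarrow> (real^'c) set" where
  "open_face B = {x \<in> std_simplex. zeros x = - B}"

definition closed_face :: "'c::finite set \<Rightarrow> (real^'c) set" where
  "closed_face B = {x \<in> std_simplex. - B \<subseteq> zeros x}"

lemma axis_std_simplex: "axis b 1 \<in> std_simplex"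
  by (auto simp: std_simplex_def axis_def if_distrib sum.delta cong: if_cong)

lemma zeros_axis: "zeros (axis b 1 :: real^'c::finite) = - {b}"
  by (auto simp: zeros_def axis_def)

lemma zeros_neq_UNIV: "x \<in> std_simplex \<Longrightarrow> zeros x \<noteq> UNIV"
proof
  assume x: "x \<in> std_simplex" "zeros x = UNIV"
  then have "x $ i = 0" for i by (auto simp: zeros_def)
  then show False using x by (simp add: std_simplex_def)
qed

lemma closed_face_eq:
  "closed_face B = {x. (\<Sum>i\<in>UNIV. x $ i) = 1} \<inter> (\<Inter>i. {x. 0 \<le> x $ i}) \<inter> (\<Inter>i\<in>-B. {x. x $ i = 0})"
  by (auto simp: closed_face_def std_simplex_def zeros_def)

lemma closed_face_UNIV: "closed_face UNIV = std_simplex"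
  by (auto simp: closed_face_def)

lemma closed_closed_face: "closed (closed_face B)"
  unfolding closed_face_eq
  by (intro closed_Int closed_INT ballI closed_Collect_eq closed_Collect_le continuous_intros)

lemma bounded_std_simplex: "bounded (std_simplex :: (real^'c::finite) set)"
proof -
  have "std_simplex \<subseteq> cbox (0 :: real^'c) (\<chi> i. 1)"
  proof
    fix x :: "real^'c" assume x: "x \<in> std_simplex"
    have "x $ i \<le> 1" for i
      using x member_le_sum[of i UNIV "\<lambda>i. x $ i"] by (auto simp: std_simplex_def)
    then show "x \<in> cbox 0 (\<chi> i. 1)" using x by (auto simp: std_simplex_def mem_box_cart)
  qed
  then show ?thesis using bounded_cbox bounded_subset by blast
qed

lemma compact_closed_face: "compact (closed_face B)"
  using closed_closed_face bounded_std_simplex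
  by (auto simp: compact_eq_bounded_closed closed_face_def intro: bounded_subset)

lemma convex_closed_face: "convex (closed_face B)"
proof -
  have 1: "convex {x :: real^'c::finite. (\<Sum>i\<in>UNIV. x $ i) = 1}"
    by (auto simp: convex_def sum.distrib sum_distrib_left[symmetric])
  have 2: "convex {x :: real^'c. 0 \<le> x $ i}" for i by (auto simp: convex_def)
  have 3: "convex {x :: real^'c. x $ i = 0}" for i by (auto simp: convex_def)
  show ?thesis unfolding closed_face_eq by (intro convex_Int convex_INT 1 2 3)
qed

lemma closed_face_eq_Union: "closed_face B = (\<Union>B'\<in>Pow B - {{}}. open_face B')"
proof -
  have "x \<in> (\<Union>B'\<in>Pow B - {{}}. open_face B')" if x: "x \<in> closed_face B" for x
  proof (rule UN_I)
    show "- zeros x \<in> Pow B - {{}}" using x zeros_neq_UNIV by (auto simp: closed_face_def)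
    show "x \<in> open_face (- zeros x)" using x by (auto simp: closed_face_def open_face_def)
  qed
  then show ?thesis by (auto simp: closed_face_def open_face_def)
qed

lemma sum_minus_one_power_card_Pow:
  assumes "finite B" "B \<noteq> {}" shows "(\<Sum>S\<in>Pow B. (- 1) ^ card S) = (0::real)"
proof -
  obtain b where b: "b \<in> B" using assms by auto
  define A where "A = B - {b}"
  have A: "B = insert b A" "b \<notin> A" "finite A" using b assms by (auto simp: A_def)
  have inj: "inj_on (insert b) (Pow A)" using A by (auto simp: inj_on_def)
  have "(\<Sum>S\<in>Pow B. (- 1) ^ card S) = (\<Sum>S\<in>Pow A. (- 1 :: real) ^ card S) + (\<Sum>S\<in>insert b ` Pow A. (- 1) ^ card S)"
    unfolding A(1) Pow_insert using A by (intro sum.union_disjoint) auto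
  also have "(\<Sum>S\<in>insert b ` Pow A. (- 1 :: real) ^ card S) = (\<Sum>S\<in>Pow A. - ((- 1) ^ card S))"
    unfolding sum.reindex[OF inj] o_def
  proof (rule sum.cong)
    fix S assume "S \<in> Pow A"
    then have "finite S" "b \<notin> S" using A finite_subset by auto
    then show "(- 1 :: real) ^ card (insert b S) = - ((- 1) ^ card S)" by simp
  qed simp
  finally show ?thesis by (simp add: sum_negf)
qed

text \<open>A component of the subgraph with the colors \<open>- B\<close> is a cell of the complex
  with vertex labels \<open>B\<close>, of dimension \<open>card B - 1\<close>; the sum is the
  alternating count of cells.\<close>

definition euler_number :: "'v set \<Rightarrow> ('c::finite \<Rightarrow> 'v \<Rightarrow> 'v) \<Rightarrow> real" where
  "euler_number V adj = (\<Sum>B\<in>Pow UNIV - {{}}. (- 1) ^ (card B + 1) * real (g_comp V adj (- B)))"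

lemma (in cgraph) glue_rel_iff:
  assumes "v \<in> V" "x \<in> std_simplex"
  shows "((v, x), (w, y)) \<in> (glue_rel V adj)\<^sup>* \<longleftrightarrow> y = x \<and> (v, w) \<in> sub_rel V adj (zeros x)"
proof
  assume "((v, x), (w, y)) \<in> (glue_rel V adj)\<^sup>*"
  then show "y = x \<and> (v, w) \<in> sub_rel V adj (zeros x)"
  proof (induction rule: rtrancl_induct2)
    case refl
    then show ?case using assms(1) equiv_sub_rel by (auto simp: sub_rel_def)
  next
    case (step w y w' y')
    then obtain j where "w' = adj j w" "y' = y" "y $ j = 0" "w \<in> V" by (auto simp: glue_rel_def)
    moreover from this step have "(w, w') \<in> sub_rel V adj (zeros x)" by (auto intro: sub_rel_adj simp: zeros_def)
    ultimately show ?case using step equiv_sub_rel by (meson equivE transD)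
  qed
next
  assume a: "y = x \<and> (v, w) \<in> sub_rel V adj (zeros x)"
  then have "(v, w) \<in> {(v, w). v \<in> V \<and> (\<exists>c\<in>zeros x. w = adj c v)}\<^sup>*" by (simp add: sub_rel_def)
  then have "((v, x), (w, x)) \<in> (glue_rel V adj)\<^sup>*"
  proof (induction rule: rtrancl_induct)
    case (step w w')
    then have "((w, x), (w', x)) \<in> glue_rel V adj" using assms(2) by (auto simp: glue_rel_def zeros_def)
    then show ?case using step by auto
  qed simp
  then show "((v, x), (w, y)) \<in> (glue_rel V adj)\<^sup>*" using a by simp
qed

context gem_map
begin

lemma f_eq_iff:
  assumes "v \<in> V" "w \<in> V" "x \<in> std_simplex" "y \<in> std_simplex"
  shows "f v x = f w y \<longleftrightarrow> x = y \<and> comp_of V adj (zeros x) v = comp_of V adj (zeros x) w"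
  using glue[OF assms] glue_rel_iff[OF assms(1,3)] comp_of_eq_iff[OF assms(1,2)] by auto

lemma f_inj: "v \<in> V \<Longrightarrow> inj_on (f v) std_simplex"
  using f_eq_iff by (auto simp: inj_on_def)

lemma f_adj: "v \<in> V \<Longrightarrow> x \<in> std_simplex \<Longrightarrow> x $ c = 0 \<Longrightarrow> f (adj c v) x = f v x"
  using f_eq_iff[of "adj c v" v x x] by (simp add: zeros_def)

text \<open>A closed face has the value 1, being convex; removing its proper open faces leaves the
  alternating sign. The representation must use only sets inside pieces where \<open>f v\<close> is
  affine, so that \<open>euler_rep_affine_image\<close> applies.\<close>

lemma euler_rep_image:
  assumes v: "v \<in> V" and B: "B \<noteq> {}"
  shows "euler_rep UNIV (indicat_real (f v ` open_face B)) ((- 1) ^ (card B + 1))"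
proof -
  obtain T where T: "finite T" "\<Union>T = std_simplex" "\<And>t. t \<in> T \<Longrightarrow> \<exists>k. k simplex t"
     "\<And>t. t \<in> T \<Longrightarrow> \<exists>g c. linear g \<and> (\<forall>x\<in>t. f v x = g x + c)"
    using pl[OF v] unfolding pl_on_def by auto
  define \<P> where "\<P> = {Q. \<exists>t\<in>T. Q \<subseteq> t}"
  \<comment> \<open>Cutting the face along the pieces gives some number; comparison with the face as
    a single convex set shows that it is 1.\<close>
  have closed: "euler_rep \<P> (indicat_real (closed_face B)) 1" if nB: "B \<noteq> {}" for B
  proof -
    have sub: "closed_face B \<inter> \<Union>T = closed_face B" unfolding T(2) by (auto simp: closed_face_def)
    obtain b where "b \<in> B" using nB by auto
    then have ne: "closed_face B \<noteq> {}"
      using axis_std_simplex[of b] zeros_axis[of b] by (auto simp: closed_face_def)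
    have "\<exists>n. euler_rep \<P> (indicat_real (closed_face B \<inter> \<Union>T)) n"
      unfolding \<P>_def
      by (rule euler_rep_Int_Union)
        (use T compact_simplex convex_simplex compact_closed_face convex_closed_face in blast)+
    then obtain n where n: "euler_rep \<P> (indicat_real (closed_face B)) n" unfolding sub ..
    moreover have "euler_rep UNIV (indicat_real (closed_face B)) 1"
      using ne compact_closed_face convex_closed_face by (intro euler_rep_indicator) auto
    ultimately show ?thesis using euler_rep_unique by blast
  qed
  have "euler_rep \<P> (indicat_real (open_face B)) ((- 1) ^ (card B + 1))" if "B \<noteq> {}" for B
    using that
  proof (induction "card B" arbitrary: B rule: less_induct)
    case less
    let ?S = "Pow B - {{}, B}"
    have "euler_rep \<P> (\<lambda>x. indicat_real (closed_face B) x - (\<Sum>B'\<in>?S. indicat_real (open_face B') x))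
        (1 - (\<Sum>B'\<in>?S. (- 1) ^ (card B' + 1)))"
    proof (intro euler_rep_diff closed euler_rep_sum less)
      fix B' assume "B' \<in> ?S"
      then show "card B' < card B" "B' \<noteq> {}" by (auto intro!: psubset_card_mono)
    qed (use less in auto)
    also have "(\<lambda>x. indicat_real (closed_face B) x - (\<Sum>B'\<in>?S. indicat_real (open_face B') x))
       = indicat_real (open_face B)"
    proof
      fix x
      have "indicat_real (closed_face B) x = (\<Sum>B'\<in>Pow B - {{}}. indicat_real (open_face B') x)"
      proof (cases "x \<in> closed_face B")
        case True
        then obtain B0 where B0: "B0 \<in> Pow B - {{}}" "x \<in> open_face B0"
          unfolding closed_face_eq_Union by auto
        have "(\<Sum>B'\<in>Pow B - {{}}. indicat_real (open_face B') x) = (\<Sum>B'\<in>Pow B - {{}}. if B0 = B' then 1 else 0)"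
          using B0 by (intro sum.cong) (auto simp: open_face_def indicator_def)
        also have "\<dots> = 1" using B0 by (subst sum.delta') auto
        finally show ?thesis using True by simp
      next
        case False
        then have "\<forall>B'\<in>Pow B - {{}}. indicat_real (open_face B') x = 0"
          unfolding closed_face_eq_Union by auto
        then show ?thesis using False by simp
      qed
      also have "Pow B - {{}} = insert B ?S" using less.prems by auto
      finally show "indicat_real (closed_face B) x - (\<Sum>B'\<in>?S. indicat_real (open_face B') x)
        = indicat_real (open_face B) x" by simp
    qed
    also have "1 - (\<Sum>B'\<in>?S. (- 1) ^ (card B' + 1)) = (- 1 :: real) ^ (card B + 1)"
    proof -
      have P: "Pow B = insert {} (insert B ?S)" by auto
      have "sum g (insert {} (insert B ?S)) = g {} + (g B + sum g ?S)" for g :: "'c set \<Rightarrow> real"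
        using less.prems by (subst sum.insert; (subst sum.insert)?) auto
      from this[of "\<lambda>S. (- 1) ^ card S"]
      have "(\<Sum>S\<in>Pow B. (- 1 :: real) ^ card S) = 1 + ((- 1) ^ card B + (\<Sum>B'\<in>?S. (- 1) ^ card B'))"
        unfolding P[symmetric] by simp
      moreover have "(\<Sum>S\<in>Pow B. (- 1 :: real) ^ card S) = 0"
        using less.prems by (intro sum_minus_one_power_card_Pow) auto
      ultimately show ?thesis by (simp add: sum_negf)
    qed
    finally show ?case .
  qed
  then have o: "euler_rep \<P> (indicat_real (open_face B)) ((- 1) ^ (card B + 1))" using B .
  show ?thesis
  proof (rule euler_rep_affine_image[OF o f_inj[OF v]])
    show "open_face B \<subseteq> std_simplex" by (auto simp: open_face_def)
    show "Q \<subseteq> std_simplex \<and> (\<exists>g c. linear g \<and> (\<forall>x\<in>Q. f v x = g x + c))" if Q: "Q \<in> \<P>" for Q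
    proof -
      obtain t where t: "t \<in> T" "Q \<subseteq> t" using Q unfolding \<P>_def by auto
      moreover obtain g c where "linear g" "\<forall>x\<in>t. f v x = g x + c" using T(4)[OF t(1)] by blast
      ultimately show ?thesis using T(2) by blast
    qed
  qed
qed

text \<open>\<open>P\<close> is the disjoint union of its open cells: a point determines the label
  set \<open>B\<close> of its coordinates and one component of the colors \<open>- B\<close>, whose
  representative supplies the simplex to map from.\<close>

lemma euler_rep_P: "euler_rep UNIV (indicat_real P) (euler_number V adj)"
proof -
  let ?K = "\<lambda>B. comp_of V adj (- B) ` V"
  let ?S = "Pow UNIV - {{}} :: 'c set set"
  define J where "J = Sigma ?S ?K"
  have finK: "finite (?K B)" for B using finite_V by simp
  have finJ: "finite J" unfolding J_def using finK by (intro finite_SigmaI) auto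
  have "euler_rep UNIV (\<lambda>y. \<Sum>(B, K)\<in>J. indicat_real (f (rep K) ` open_face B) y)
    (\<Sum>(B, K)\<in>J. (- 1) ^ (card B + 1))"
    unfolding split_def
    by (rule euler_rep_sum[OF finJ]) (auto simp: J_def simp del: power_Suc intro!: euler_rep_image[simplified] rep_comp(1))
  also have "(\<Sum>(B, K)\<in>J. (- 1 :: real) ^ (card B + 1)) = euler_number V adj"
    unfolding J_def euler_number_def using finK
    by (subst sum.Sigma[symmetric]) (auto simp: g_comp_eq mult.commute)
  also have "(\<lambda>y. \<Sum>(B, K)\<in>J. indicat_real (f (rep K) ` open_face B) y) = indicat_real P"
  proof
    fix y
    show "(\<Sum>(B, K)\<in>J. indicat_real (f (rep K) ` open_face B) y) = indicat_real P y"
    proof (cases "y \<in> P")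
      case True
      then obtain v x where v: "v \<in> V" "x \<in> std_simplex" "y = f v x" using cover by auto
      define B0 where "B0 = - zeros x"
      define K0 where "K0 = comp_of V adj (- B0) v"
      have J0: "(B0, K0) \<in> J" using v zeros_neq_UNIV by (auto simp: J_def B0_def K0_def)
      have ind: "indicat_real (f (rep K) ` open_face B) y = (if (B0, K0) = (B, K) then 1 else 0)"
        if BK: "(B, K) \<in> J" for B K
      proof -
        obtain w where w: "w \<in> V" "K = comp_of V adj (- B) w" using BK by (auto simp: J_def)
        have "y \<in> f (rep K) ` open_face B \<longleftrightarrow> (\<exists>z\<in>open_face B. f v x = f (rep K) z)" using v by auto
        also have "\<dots> \<longleftrightarrow> (\<exists>z\<in>open_face B. x = z \<and> comp_of V adj (zeros x) v = comp_of V adj (zeros x) (rep K))"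
          using f_eq_iff[OF v(1) _ v(2)] rep_comp(1)[OF w(1)] w(2) by (auto simp: open_face_def)
        also have "\<dots> \<longleftrightarrow> B = B0 \<and> K = K0"
          using v rep_comp(2)[OF w(1), of "- B"] w(2) by (auto simp: open_face_def B0_def K0_def)
        finally show ?thesis by (auto simp: indicator_def)
      qed
      have "(\<Sum>(B, K)\<in>J. indicat_real (f (rep K) ` open_face B) y) = (\<Sum>p\<in>J. if (B0, K0) = p then 1 else 0)"
      proof (rule sum.cong)
        fix p assume "p \<in> J"
        then show "(case p of (B, K) \<Rightarrow> indicat_real (f (rep K) ` open_face B) y) = (if (B0, K0) = p then 1 else 0)"
          by (cases p) (simp only: prod.case ind)
      qed simp
      also have "\<dots> = 1" using J0 finJ by (subst sum.delta') auto
      finally show ?thesis using True by simp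
    next
      case False
      have "y \<notin> f (rep K) ` open_face B" if "(B, K) \<in> J" for B K
        using that False cover rep_comp(1) by (auto simp: J_def open_face_def)
      then show ?thesis using False by (auto intro!: sum.neutral)
    qed
  qed
  finally show ?thesis .
qed

end

lemma euler_number_unique:
  assumes "gem_of V adj P" "gem_of W adj' P" shows "euler_number V adj = euler_number W adj'"
proof -
  obtain f g where "gem_map V adj f P" "gem_map W adj' g P" using assms unfolding gem_of_iff by blast
  then show ?thesis using euler_rep_unique[OF gem_map.euler_rep_P gem_map.euler_rep_P] by blast
qed

section \<open>First homology\<close>

text \<open>A connected set of reals with two points is uncountable. Countability takes the place of
  discreteness, since the periods of a real combination of two angles may be dense.\<close>

lemma continuous_countable_range_constant:
  fixes h :: "'a::topological_space \<Rightarrow> real"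
  assumes "connected S" "continuous_on S h" "countable C" "h ` S \<subseteq> C" "x \<in> S" "y \<in> S"
  shows "h x = h y"
proof (rule ccontr)
  assume "h x \<noteq> h y"
  then have "uncountable (h ` S)"
    using connected_uncountable[OF connected_continuous_image[OF assms(2,1)], of "h x" "h y"] assms by blast
  then show False using assms countable_subset by blast
qed

lemma pl_on_imp_continuous_on:
  fixes f :: "'a::euclidean_space \<Rightarrow> 'b::euclidean_space"
  assumes "pl_on S f" shows "continuous_on S f"
proof -
  obtain T where T: "finite T" "\<Union>T = S" "\<And>t. t \<in> T \<Longrightarrow> \<exists>k. k simplex t"
     "\<And>t. t \<in> T \<Longrightarrow> \<exists>g c. linear g \<and> (\<forall>x\<in>t. f x = g x + c)"
    using assms unfolding pl_on_def by auto
  have "continuous_on (\<Union>t\<in>T. id t) f"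
  proof (rule continuous_on_closed_Union[OF T(1)])
    fix t assume t: "t \<in> T"
    show "closed (id t)" using T(3)[OF t] closed_simplex by auto
    obtain g c where g: "linear g" "\<forall>x\<in>t. f x = g x + c" using T(4)[OF t] by blast
    have "continuous_on t (\<lambda>x. g x + c)"
      using g(1) by (intro continuous_intros linear_continuous_on) (simp add: linear_conv_bounded_linear)
    then show "continuous_on (id t) f" using g(2) by (simp cong: continuous_on_cong)
  qed
  then show ?thesis using T(2) by simp
qed

context gem_map
begin

lemma f_continuous: "v \<in> V \<Longrightarrow> continuous_on std_simplex (f v)"
  using pl pl_on_imp_continuous_on by blast

lemma compact_std: "compact (std_simplex :: (real^'c) set)"
  using compact_closed_face[of UNIV] by (simp add: closed_face_UNIV)

lemma convex_std: "convex (std_simplex :: (real^'c) set)"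
  using convex_closed_face[of UNIV] by (simp add: closed_face_UNIV)

text \<open>By compactness each \<open>f v\<close> has a continuous inverse on its closed image, and
  finitely many such images cover \<open>P\<close>; functions on \<open>P\<close> can thus be built
  simplex by simplex.\<close>

lemma continuous_on_P:
  assumes "\<And>v. v \<in> V \<Longrightarrow> continuous_on std_simplex (u v)"
    and "\<And>v x. v \<in> V \<Longrightarrow> x \<in> std_simplex \<Longrightarrow> U (f v x) = u v x"
  shows "continuous_on P U"
  unfolding cover[symmetric]
proof (rule continuous_on_closed_Union[OF finite_V])
  fix v assume v: "v \<in> V"
  show "closed (f v ` std_simplex)"
    using compact_continuous_image[OF f_continuous[OF v] compact_std] compact_imp_closed by blast
  have "continuous_on (f v ` std_simplex) (u v \<circ> the_inv_into std_simplex (f v))"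
    using continuous_on_inv_into[OF f_continuous[OF v] compact_std f_inj[OF v]] assms(1)[OF v]
    by (intro continuous_on_compose) (simp_all add: the_inv_into_onto f_inj v)
  then show "continuous_on (f v ` std_simplex) U"
    by (rule continuous_on_eq) (use v f_inj[OF v] assms(2) in \<open>auto simp: the_inv_into_f_f\<close>)
qed

text \<open>If there were too few edges with the labels \<open>a\<close>, \<open>b\<close>, some
  coefficients \<open>m\<close>, \<open>n\<close> and potentials at the vertices, not all zero,
  would make the increment of the combined angle along every such edge the difference of the
  potentials at its ends. The combined angle then has a continuous branch \<open>U\<close> on all of
  \<open>P\<close>, which the two loops refute unless \<open>m\<close> and \<open>n\<close> vanish;
  connectedness of \<open>P\<close> then annihilates the potentials.\<close>

lemma g_comp_pair_ge:
  fixes z\<^sub>1 z\<^sub>2 :: "'a \<Rightarrow> complex" and \<gamma>\<^sub>1 \<gamma>\<^sub>2 :: "real \<Rightarrow> 'a"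
  assumes conn: "connected P" and ab: "a \<noteq> b"
    and z: "continuous_on P z\<^sub>1" "continuous_on P z\<^sub>2" "\<And>p. p \<in> P \<Longrightarrow> z\<^sub>1 p \<noteq> 0" "\<And>p. p \<in> P \<Longrightarrow> z\<^sub>2 p \<noteq> 0"
    and \<gamma>\<^sub>1: "continuous_on {0..1} \<gamma>\<^sub>1" "\<gamma>\<^sub>1 ` {0..1} \<subseteq> P" "\<gamma>\<^sub>1 0 = \<gamma>\<^sub>1 1"
    and \<gamma>\<^sub>2: "continuous_on {0..1} \<gamma>\<^sub>2" "\<gamma>\<^sub>2 ` {0..1} \<subseteq> P" "\<gamma>\<^sub>2 0 = \<gamma>\<^sub>2 1"
    and L\<^sub>1: "continuous_on {0..1} L\<^sub>1" "\<And>t. t \<in> {0..1} \<Longrightarrow> z\<^sub>1 (\<gamma>\<^sub>1 t) = exp (L\<^sub>1 t)" "Im (L\<^sub>1 1) \<noteq> Im (L\<^sub>1 0)"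
    and L\<^sub>2: "continuous_on {0..1} L\<^sub>2" "\<And>t. t \<in> {0..1} \<Longrightarrow> z\<^sub>2 (\<gamma>\<^sub>2 t) = exp (L\<^sub>2 t)" "Im (L\<^sub>2 1) \<noteq> Im (L\<^sub>2 0)"
    and c: "\<And>t. t \<in> {0..1} \<Longrightarrow> z\<^sub>2 (\<gamma>\<^sub>1 t) = exp k\<^sub>2" "\<And>t. t \<in> {0..1} \<Longrightarrow> z\<^sub>1 (\<gamma>\<^sub>2 t) = exp k\<^sub>1"
  shows "g_comp V adj (- {a}) + g_comp V adj (- {b}) + 1 \<le> g_comp V adj (- {a, b})"
proof (rule ccontr)
  assume neg: "\<not> ?thesis"
  let ?K = "comp_of V adj"
  let ?e = "\<lambda>c. axis c 1 :: real^'c"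
  have log_ex: "\<exists>l. continuous_on std_simplex l \<and> (\<forall>x\<in>std_simplex. z (f v x) = exp (l x))"
    if "v \<in> V" "continuous_on P z" "\<And>p. p \<in> P \<Longrightarrow> z p \<noteq> 0" for z :: "'a \<Rightarrow> complex" and v
  proof -
    have "continuous_on std_simplex (\<lambda>x. z (f v x))"
      using f_continuous[OF that(1)] that(1) cover
      by (intro continuous_on_compose2[OF that(2)]) auto
    moreover have "\<And>x. x \<in> std_simplex \<Longrightarrow> z (f v x) \<noteq> 0" using that cover by blast
    ultimately show ?thesis
      using continuous_logarithm_on_contractible[OF _ convex_imp_contractible[OF convex_std]] by metis
  qed
  obtain l\<^sub>1 where l\<^sub>1: "\<And>v. v \<in> V \<Longrightarrow> continuous_on std_simplex (l\<^sub>1 v)"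
     "\<And>v x. v \<in> V \<Longrightarrow> x \<in> std_simplex \<Longrightarrow> z\<^sub>1 (f v x) = exp (l\<^sub>1 v x)"
    using log_ex[OF _ z(1,3)] by metis
  obtain l\<^sub>2 where l\<^sub>2: "\<And>v. v \<in> V \<Longrightarrow> continuous_on std_simplex (l\<^sub>2 v)"
     "\<And>v x. v \<in> V \<Longrightarrow> x \<in> std_simplex \<Longrightarrow> z\<^sub>2 (f v x) = exp (l\<^sub>2 v x)"
    using log_ex[OF _ z(2,4)] by metis
  have "\<gamma>\<^sub>1 0 \<in> P" using \<gamma>\<^sub>1(2) by auto
  then obtain v0 where v0: "v0 \<in> V" using cover by auto
  \<comment> \<open>Unknowns: the potentials at the vertices labeled \<open>a\<close> (tag 0) and
    \<open>b\<close> (tag 1), and the coefficients of the two angles (tags 2 and 3). Equations: one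
    for each edge with the labels \<open>a\<close>, \<open>b\<close>, and the vanishing of the
    potential at one vertex.\<close>
  define X where "X = {0::nat} \<times> ?K (-{a}) ` V \<union> {1} \<times> ?K (-{b}) ` V \<union> {(2, {}), (3, {})}"
  define E where "E = insert (1, {}) ({0::nat} \<times> ?K (-{a,b}) ` V)"
  define D where "D l v = Im (l v (?e b)) - Im (l v (?e a))" for l :: "'v \<Rightarrow> real^'c \<Rightarrow> complex" and v
  define L :: "nat \<times> 'v set \<Rightarrow> (nat \<times> 'v set \<Rightarrow> real) \<Rightarrow> real" where
    "L e y = (if fst e = 0 then let v = rep (snd e) in
        y (2, {}) * D l\<^sub>1 v + y (3, {}) * D l\<^sub>2 v - (y (1, ?K (-{b}) v) - y (0, ?K (-{a}) v))
      else y (0, ?K (-{a}) v0))" for e y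
  have fin: "finite X" "finite E" using finite_V by (auto simp: X_def E_def)
  have "card X = g_comp V adj (-{a}) + g_comp V adj (-{b}) + 2"
    unfolding X_def using finite_V
    by (subst card_Un_disjoint; (force simp: g_comp_eq card_cartesian_product)?)+
  moreover have "card E = g_comp V adj (-{a,b}) + 1"
    unfolding E_def using finite_V
    by (subst card_insert_disjoint) (auto simp: g_comp_eq card_cartesian_product)
  ultimately have "card E < card X" using neg by simp
  moreover have "L e (\<lambda>x. y x + k * y' x) = L e y + k * L e y'" for e y y' k
    by (simp add: L_def Let_def algebra_simps)
  ultimately obtain y where y: "\<exists>x\<in>X. y x \<noteq> 0" "\<And>e. e \<in> E \<Longrightarrow> L e y = 0"
    using homogeneous_system_nontrivial_solution[OF fin(2) fin(1), of L] by metis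
  define m n where "m = y (2, {})" and "n = y (3, {})"
  define A B where "A v = y (0, ?K (-{a}) v)" and "B v = y (1, ?K (-{b}) v)" for v
  define \<Theta> where "\<Theta> v x = m * Im (l\<^sub>1 v x) + n * Im (l\<^sub>2 v x)" for v x
  \<comment> \<open>The possible ambiguities of \<open>\<Theta>\<close>: each logarithm is
    determined only up to integral multiples of 2 pi i.\<close>
  define \<Lambda> where "\<Lambda> = (\<lambda>(i::int, j::int). m * (2 * of_int i * pi) + n * (2 * of_int j * pi)) ` UNIV"
  have cnt: "countable \<Lambda>" unfolding \<Lambda>_def by (intro countable_image) simp
  have im: "\<exists>i::int. Im p = Im q + 2 * of_int i * pi" if "exp p = exp q" for p q :: complex
    using that unfolding exp_eq by (auto simp: algebra_simps)
  have \<Theta>c: "continuous_on std_simplex (\<Theta> v)" if "v \<in> V" for v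
    unfolding \<Theta>_def using l\<^sub>1(1) l\<^sub>2(1) that by (intro continuous_intros) auto
  have \<Theta>diff: "\<Theta> w x - \<Theta> v x = \<Theta> w x' - \<Theta> v x'"
    if vw: "v \<in> V" "w \<in> V" and F: "convex F" "F \<subseteq> std_simplex" "\<And>x. x \<in> F \<Longrightarrow> f v x = f w x" "x \<in> F" "x' \<in> F"
    for v w F x x'
  proof (rule continuous_countable_range_constant[OF convex_connected[OF F(1)] _ cnt _ F(4,5)])
    show "continuous_on F (\<lambda>x. \<Theta> w x - \<Theta> v x)"
      using \<Theta>c vw F(2) by (intro continuous_intros) (auto intro: continuous_on_subset)
    show "(\<lambda>x. \<Theta> w x - \<Theta> v x) ` F \<subseteq> \<Lambda>"
    proof safe
      fix x assume x: "x \<in> F"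
      then have xs: "x \<in> std_simplex" "f w x = f v x" using F by auto
      obtain i where i: "Im (l\<^sub>1 w x) = Im (l\<^sub>1 v x) + 2 * of_int i * pi"
        using im[of "l\<^sub>1 w x" "l\<^sub>1 v x"] l\<^sub>1(2)[OF vw(1) xs(1)] l\<^sub>1(2)[OF vw(2) xs(1)] xs(2) by auto
      obtain j where j: "Im (l\<^sub>2 w x) = Im (l\<^sub>2 v x) + 2 * of_int j * pi"
        using im[of "l\<^sub>2 w x" "l\<^sub>2 v x"] l\<^sub>2(2)[OF vw(1) xs(1)] l\<^sub>2(2)[OF vw(2) xs(1)] xs(2) by auto
      have "\<Theta> w x - \<Theta> v x = m * (2 * of_int i * pi) + n * (2 * of_int j * pi)"
        by (simp add: \<Theta>_def i j algebra_simps)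
      then show "\<Theta> w x - \<Theta> v x \<in> \<Lambda>" unfolding \<Lambda>_def by (auto intro!: image_eqI[of _ _ "(i, j)"])
    qed
  qed
  have face: "\<Theta> (adj c v) x - \<Theta> v x = \<Theta> (adj c v) x' - \<Theta> v x'"
    if "v \<in> V" "x \<in> std_simplex" "x' \<in> std_simplex" "x $ c = 0" "x' $ c = 0" for v c x x'
    by (rule \<Theta>diff[of _ _ "closed_face (-{c})"])
       (rule convex_closed_face | use that f_adj in \<open>force simp: closed_face_def zeros_def\<close>)+
  have Ainv: "A (adj c v) = A v" if "v \<in> V" "c \<noteq> a" for v c using that by (simp add: A_def)
  have Binv: "B (adj c v) = B v" if "v \<in> V" "c \<noteq> b" for v c using that by (simp add: B_def)
  have e0: "?e c $ d = 0" if "d \<noteq> c" for c d using that by (simp add: axis_def)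
  have AB: "\<Theta> v (?e b) - \<Theta> v (?e a) = B v - A v" if v: "v \<in> V" for v
  proof -
    define h where "h v = \<Theta> v (?e b) - \<Theta> v (?e a) - (B v - A v)" for v
    have "h (rep (?K (-{a,b}) v)) = h v"
    proof (rule sub_rel_invariant[OF rep_comp(3)[OF v]])
      fix v c assume vc: "v \<in> V" "c \<in> -{a,b}"
      then have "\<Theta> (adj c v) (?e b) - \<Theta> v (?e b) = \<Theta> (adj c v) (?e a) - \<Theta> v (?e a)"
        using e0 axis_std_simplex by (intro face) auto
      then show "h (adj c v) = h v" using Ainv Binv vc by (simp add: h_def)
    qed
    moreover have "h (rep (?K (-{a,b}) v)) = 0"
      using y(2)[of "(0, ?K (-{a,b}) v)"] v
      by (simp add: L_def E_def h_def \<Theta>_def Let_def D_def m_def n_def A_def B_def algebra_simps)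
    ultimately show ?thesis by (simp add: h_def)
  qed
  \<comment> \<open>The branch on the simplex \<open>v\<close>, shifted so that its value at the
    vertex labeled \<open>a\<close> is the potential.\<close>
  define u where "u v x = A v + \<Theta> v x - \<Theta> v (?e a)" for v x
  \<comment> \<open>Two branches differ by a constant on a common facet. A facet opposite a label
    other than \<open>a\<close> contains the vertex labeled \<open>a\<close>, where both equal the
    potential; the facet opposite \<open>a\<close> contains the vertex labeled \<open>b\<close>,
    where \<open>AB\<close> does the same.\<close>
  have uadj: "u (adj c v) x = u v x" if v: "v \<in> V" "x \<in> std_simplex" "x $ c = 0" for v c x
  proof (cases "c = a")
    case False
    then have "\<Theta> (adj c v) x - \<Theta> v x = \<Theta> (adj c v) (?e a) - \<Theta> v (?e a)"
      using v e0 axis_std_simplex by (intro face) auto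
    then show ?thesis using Ainv[OF v(1) False] by (simp add: u_def)
  next
    case True
    then have "\<Theta> (adj c v) x - \<Theta> v x = \<Theta> (adj c v) (?e b) - \<Theta> v (?e b)"
      using v e0 axis_std_simplex ab by (intro face) auto
    moreover have "B (adj c v) = B v" using Binv v True ab by auto
    ultimately show ?thesis using AB[of v] AB[of "adj c v"] v by (simp add: u_def)
  qed
  have ueq: "u v x = u w x'" if "v \<in> V" "w \<in> V" "x \<in> std_simplex" "x' \<in> std_simplex" "f v x = f w x'" for v w x x'
  proof -
    have xx: "x' = x" "(v, w) \<in> sub_rel V adj (zeros x)"
      using that glue[OF that(1-4)] glue_rel_iff[OF that(1,3)] by auto
    have "u v x = u w x"
      by (rule sub_rel_invariant[OF xx(2), of "\<lambda>v. u v x"]) (use uadj that in \<open>auto simp: zeros_def\<close>)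
    then show ?thesis using xx by simp
  qed
  define U where "U p = (SOME r. \<exists>v\<in>V. \<exists>x\<in>std_simplex. f v x = p \<and> r = u v x)" for p
  have U: "U (f v x) = u v x" if "v \<in> V" "x \<in> std_simplex" for v x
    unfolding U_def by (rule some_equality) (use that ueq in blast)+
  have Uc: "continuous_on P U"
    by (rule continuous_on_P[of u]) (auto simp: u_def intro!: continuous_intros \<Theta>c U[unfolded u_def])
  \<comment> \<open>Along the loop, \<open>U\<close> minus the combination of the lifted angles is
    continuous with values in a countable set, so it has the same value at both ends.\<close>
  have period: "U (\<gamma> 1) - U (\<gamma> 0) = m * (Im (p 1) - Im (p 0)) + n * (Im (q 1) - Im (q 0))"
    if \<gamma>: "continuous_on {0..1} \<gamma>" "\<gamma> ` {0..1} \<subseteq> P" and p: "continuous_on {0..1} p" "\<And>t. t \<in> {0..1} \<Longrightarrow> z\<^sub>1 (\<gamma> t) = exp (p t)"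
      and q: "continuous_on {0..1} q" "\<And>t. t \<in> {0..1} \<Longrightarrow> z\<^sub>2 (\<gamma> t) = exp (q t)" 
    for \<gamma> :: "real \<Rightarrow> 'a" and p q :: "real \<Rightarrow> complex"
  proof -
    define h where "h t = U (\<gamma> t) - m * Im (p t) - n * Im (q t)" for t :: real
    define C where "C = (\<lambda>(v, r). A v - \<Theta> v (?e a) + r) ` (V \<times> \<Lambda>)"
    have "h 1 = h 0"
    proof (rule continuous_countable_range_constant[of "{0..1}" h C])
      show "connected {0..1::real}" by simp
      show "continuous_on {0..1} h" unfolding h_def
        using \<gamma> p(1) q(1) by (intro continuous_intros continuous_on_compose2[OF Uc]) auto
      show "countable C" unfolding C_def by (intro countable_image countable_SIGMA countable_finite finite_V cnt)
      show "h ` {0..1} \<subseteq> C"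
      proof safe
        fix t :: real assume t: "t \<in> {0..1}"
        then have "\<gamma> t \<in> P" using \<gamma>(2) by blast
        then obtain v x where vx: "v \<in> V" "x \<in> std_simplex" "\<gamma> t = f v x" using cover by auto
        obtain i where i: "Im (l\<^sub>1 v x) = Im (p t) + 2 * of_int i * pi"
          using im[of "l\<^sub>1 v x" "p t"] l\<^sub>1(2)[OF vx(1,2)] p(2)[OF t] vx(3) by auto
        obtain j where j: "Im (l\<^sub>2 v x) = Im (q t) + 2 * of_int j * pi"
          using im[of "l\<^sub>2 v x" "q t"] l\<^sub>2(2)[OF vx(1,2)] q(2)[OF t] vx(3) by auto
        have "h t = A v - \<Theta> v (?e a) + (m * (2 * of_int i * pi) + n * (2 * of_int j * pi))"
          using U[OF vx(1,2)] by (simp add: h_def vx(3) u_def \<Theta>_def[of v x] i j algebra_simps)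
        moreover have "m * (2 * of_int i * pi) + n * (2 * of_int j * pi) \<in> \<Lambda>"
          unfolding \<Lambda>_def by (auto intro!: image_eqI[of _ _ "(i, j)"])
        ultimately show "h t \<in> C" using vx(1) unfolding C_def by force
      qed
    qed auto
    then show ?thesis by (simp add: h_def algebra_simps)
  qed
  \<comment> \<open>The second angle is constant along the first loop, so only the first coefficient
    contributes to the period.\<close>
  have m0: "m = 0" using period[OF \<gamma>\<^sub>1(1,2) L\<^sub>1(1,2), of "\<lambda>_. k\<^sub>2"] c(1) \<gamma>\<^sub>1(3) L\<^sub>1(3) by auto
  have n0: "n = 0" using period[OF \<gamma>\<^sub>2(1,2) _ _ L\<^sub>2(1,2), of "\<lambda>_. k\<^sub>1"] c(2) \<gamma>\<^sub>2(3) L\<^sub>2(3) by auto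
  have uA: "u v x = A v" for v x by (simp add: u_def \<Theta>_def m0 n0)
  \<comment> \<open>With both coefficients zero, \<open>U\<close> takes only the finitely many
    values of the potential, so it is constant on the connected set \<open>P\<close>.\<close>
  have A0: "A v = 0" if v: "v \<in> V" for v
  proof -
    have inP: "f w (?e a) \<in> P" if "w \<in> V" for w using that cover axis_std_simplex by blast
    have "U (f v (?e a)) = U (f v0 (?e a))"
    proof (rule continuous_countable_range_constant[OF conn Uc, of "A ` V"])
      show "U ` P \<subseteq> A ` V" using cover U uA by auto
    qed (use finite_V inP v v0 in \<open>auto intro: countable_finite\<close>)
    then have "A v = A v0" using U v v0 axis_std_simplex uA by metis
    moreover have "A v0 = 0" using y(2)[of "(1, {})"] by (simp add: L_def E_def A_def)
    ultimately show ?thesis by simp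
  qed
  have B0: "B v = 0" if v: "v \<in> V" for v using AB[OF v] A0[OF v] by (simp add: \<Theta>_def m0 n0)
  have "\<forall>x\<in>X. y x = 0" using A0 B0 m0 n0 by (auto simp: X_def A_def B_def m_def n_def)
  then show False using y(1) by blast
qed

end

section \<open>The lower bound\<close>

lemma exists_2: "(\<exists>i::2. P i) \<longleftrightarrow> P 1 \<or> P 2"
  by (metis exhaust_2)

lemma mem_frontier_cube:
  "p \<in> frontier (cbox (- 1) (1 :: real^'n)) \<longleftrightarrow> (\<forall>i. \<bar>p $ i\<bar> \<le> 1) \<and> (\<exists>i. \<bar>p $ i\<bar> = 1)"
proof -
  have "frontier (cbox (- 1) (1 :: real^'n)) = cbox (- 1) 1 - box (- 1) 1"
    by (simp add: frontier_def interior_cbox closure_closed)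
  moreover have "p \<in> cbox (- 1) 1 \<longleftrightarrow> (\<forall>i. \<bar>p $ i\<bar> \<le> 1)"
    by (auto simp: mem_box_cart abs_le_iff)
  moreover have "p \<in> box (- 1) 1 \<longleftrightarrow> (\<forall>i. \<bar>p $ i\<bar> < 1)"
    by (auto simp: mem_box_cart abs_less_iff)
  ultimately show ?thesis by (auto simp: less_le)
qed

lemma connected_frontier_cube:
  assumes "CARD('n::finite) \<noteq> 1" shows "connected (frontier (cbox (- 1) (1 :: real^'n)))"
proof -
  have "(0 :: real^'n) \<in> box (- 1) 1" by (simp add: mem_box_cart)
  then have i: "interior (cbox (- 1) (1 :: real^'n)) \<noteq> {}" by (auto simp: interior_cbox)
  have "connected (rel_frontier (cbox (- 1) (1 :: real^'n)))"
    using assms i by (intro connected_sphere_gen) (auto simp: aff_dim_nonempty_interior)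
  then show ?thesis using rel_frontier_nonempty_interior[OF i] by simp
qed

lemma connected_S2S1S1: "connected S2S1S1"
  unfolding S2S1S1_def by (intro connected_Times connected_frontier_cube) auto

section \<open>A loop around the square and its logarithm\<close>

definition square_radius :: "real \<Rightarrow> real" where
  "square_radius t = max \<bar>cos (2 * pi * t)\<bar> \<bar>sin (2 * pi * t)\<bar>"

text \<open>Central projection of the unit circle to the boundary of the square keeps the argument
  \<open>2 * pi * t\<close>, so that \<open>square_log\<close> is an explicit logarithm.\<close>

definition square_loop :: "real \<Rightarrow> real^2" where
  "square_loop t = (1 / square_radius t) *\<^sub>R vector [cos (2 * pi * t), sin (2 * pi * t)]"

definition square_log :: "real \<Rightarrow> complex" where
  "square_log t = Complex (- ln (square_radius t)) (2 * pi * t)"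

lemma square_radius_pos: "square_radius t > 0"
proof -
  have "\<not> (sin (2 * pi * t) = 0 \<and> cos (2 * pi * t) = 0)"
    using sin_cos_squared_add[of "2 * pi * t"] by (metis add_0 power_zero_numeral zero_neq_one)
  then show ?thesis by (auto simp: square_radius_def less_max_iff_disj)
qed

lemma continuous_square_radius: "continuous_on UNIV square_radius"
  unfolding square_radius_def by (intro continuous_intros)

lemma continuous_square_loop: "continuous_on UNIV square_loop"
proof -
  have "continuous_on UNIV (\<lambda>t. cos (2 * pi * t) / square_radius t)"
    "continuous_on UNIV (\<lambda>t. sin (2 * pi * t) / square_radius t)"
    using square_radius_pos
    by (auto intro!: continuous_intros continuous_square_radius less_imp_neq[THEN not_sym])
  then have "continuous_on UNIV (\<lambda>t. square_loop t $ i)" for i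
    using exhaust_2[of i] by (auto simp: square_loop_def)
  then have "continuous_on UNIV (\<lambda>t. \<chi> i. square_loop t $ i)" by (rule continuous_on_vec_lambda)
  then show ?thesis by simp
qed

lemma square_loop_mem: "square_loop t \<in> frontier (cbox (- 1) 1)"
proof -
  have "\<bar>square_loop t $ 1\<bar> = \<bar>cos (2 * pi * t)\<bar> / square_radius t"
    "\<bar>square_loop t $ 2\<bar> = \<bar>sin (2 * pi * t)\<bar> / square_radius t"
    using square_radius_pos[of t] by (auto simp: square_loop_def)
  moreover have "\<bar>cos (2 * pi * t)\<bar> \<le> square_radius t" "\<bar>sin (2 * pi * t)\<bar> \<le> square_radius t"
     "square_radius t = \<bar>cos (2 * pi * t)\<bar> \<or> square_radius t = \<bar>sin (2 * pi * t)\<bar>"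
    by (auto simp: square_radius_def max_def)
  ultimately show ?thesis using square_radius_pos[of t]
    unfolding mem_frontier_cube forall_2 exists_2 by (auto simp: divide_le_eq simp del: abs_divide)
qed

lemma square_loop_log: "Complex (square_loop t $ 1) (square_loop t $ 2) = exp (square_log t)"
  using square_radius_pos[of t]
  by (simp add: complex_eq_iff square_loop_def square_log_def Re_exp Im_exp exp_minus field_simps)

lemma continuous_square_log: "continuous_on UNIV square_log"
proof -
  have "continuous_on UNIV (\<lambda>t. - ln (square_radius t))"
    using square_radius_pos by (intro continuous_intros continuous_square_radius) (metis less_irrefl)
  moreover have "continuous_on UNIV (\<lambda>t. 2 * pi * t)" by (intro continuous_intros)
  ultimately show ?thesis unfolding square_log_def by (rule continuous_on_Complex)
qed

lemma frontier_square_neq_0: "p \<in> frontier (cbox (- 1) (1::real^2)) \<Longrightarrow> Complex (p $ 1) (p $ 2) \<noteq> 0"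
  by (auto simp: mem_frontier_cube exists_2 complex_eq_iff)

text \<open>The two functions are the circle coordinates read as complex numbers. Each loop runs
  once around one circle factor while the other coordinates rest at the corner
  \<open>1\<close>.\<close>

lemma S2S1S1_g_comp_pair_ge:
  assumes "gem_of V adj S2S1S1" "a \<noteq> b"
  shows "g_comp V adj (- {a}) + g_comp V adj (- {b}) + 1 \<le> g_comp V adj (- {a, b})"
proof -
  obtain f where "gem_map V adj f S2S1S1" using assms(1) unfolding gem_of_iff by blast
  then interpret gem_map V adj f S2S1S1 .
  define c where "c q = Complex (q $ 1) (q $ 2)" for q :: "real^2"
  have cc: "continuous_on UNIV c" unfolding c_def by (intro continuous_on_Complex continuous_intros)
  have one: "(1 :: real^2) \<in> frontier (cbox (- 1) 1)" "(1 :: real^3) \<in> frontier (cbox (- 1) 1)"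
    by (simp_all add: mem_frontier_cube)
  have c1: "exp (Ln (c 1)) = c 1" using frontier_square_neq_0[OF one(1)] by (intro exp_Ln) (simp add: c_def)
  have end_eq: "square_loop 0 = square_loop 1" by (simp add: square_loop_def square_radius_def)
  show ?thesis
  proof (rule g_comp_pair_ge[OF connected_S2S1S1 assms(2), where z\<^sub>1 = "\<lambda>p. c (fst (snd p))" and z\<^sub>2 = "\<lambda>p. c (snd (snd p))"
        and \<gamma>\<^sub>1 = "\<lambda>t. (1, square_loop t, 1)" and \<gamma>\<^sub>2 = "\<lambda>t. (1, 1, square_loop t)"
        and L\<^sub>1 = square_log and L\<^sub>2 = square_log and k\<^sub>1 = "Ln (c 1)" and k\<^sub>2 = "Ln (c 1)"])
  qed (use one square_loop_mem frontier_square_neq_0 square_loop_log c1 end_eq in \<open>auto simp: S2S1S1_def c_def[symmetric]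
       square_log_def[of 0] square_log_def[of 1] 
       intro!: continuous_intros continuous_on_compose2[OF cc] continuous_on_subset[OF continuous_square_loop] continuous_on_subset[OF continuous_square_log]\<close>)
qed

section \<open>The Euler number for five colors\<close>

lemma sum_Pow_insert:
  assumes "finite A" "a \<notin> A"
  shows "(\<Sum>S\<in>Pow (insert a A). h S) = (\<Sum>S\<in>Pow A. h S) + (\<Sum>S\<in>Pow A. h (insert a S))"
proof -
  have "inj_on (insert a) (Pow A)" using assms by (auto simp: inj_on_def)
  then show ?thesis unfolding Pow_insert using assms
    by (subst sum.union_disjoint) (auto simp: sum.reindex)
qed

lemma euler_number_eq:
  "euler_number V (adj :: 'c::finite \<Rightarrow> 'v \<Rightarrow> 'v) =
     (- 1) ^ (CARD('c) + 1) * (\<Sum>S\<in>Pow UNIV - {UNIV}. (- 1) ^ card S * real (g_comp V adj S))"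
proof -
  have "euler_number V adj = (\<Sum>S\<in>Pow UNIV - {UNIV}. (- 1) ^ (card (- S) + 1) * real (g_comp V adj S))"
    unfolding euler_number_def by (rule sum.reindex_bij_witness[of _ uminus uminus]) auto
  also have "\<dots> = (\<Sum>S\<in>Pow UNIV - {UNIV}. (- 1) ^ (CARD('c) + 1) * ((- 1) ^ card S * real (g_comp V adj S)))"
  proof (rule sum.cong)
    fix S :: "'c set"
    have "card S + card (- S) = CARD('c)"
      by (metis Compl_disjoint Compl_partition card_Un_disjoint finite)
    then have "(- 1 :: real) ^ (CARD('c) + 1) * (- 1) ^ card S = (- 1) ^ (card S + card S + (card (- S) + 1))"
      by (simp add: power_add[symmetric] add.commute add.left_commute)
    then show "(- 1) ^ (card (- S) + 1) * real (g_comp V adj S)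
       = (- 1) ^ (CARD('c) + 1) * ((- 1) ^ card S * real (g_comp V adj S))"
      by (simp add: power_add mult.assoc[symmetric] power_mult_distrib[symmetric])
  qed simp
  finally show ?thesis by (simp add: sum_distrib_left)
qed

lemma (in cgraph) euler_number_5:
  assumes U: "UNIV = {a, b, c, d, e}" and dist: "distinct [a, b, c, d, e]"
  shows "euler_number V adj = card V
     - (real (g_comp V adj {a}) + g_comp V adj {b} + g_comp V adj {c} + g_comp V adj {d} + g_comp V adj {e})
     + (real (g_comp V adj {a,b}) + g_comp V adj {a,c} + g_comp V adj {a,d} + g_comp V adj {a,e} + g_comp V adj {b,c}
        + g_comp V adj {b,d} + g_comp V adj {b,e} + g_comp V adj {c,d} + g_comp V adj {c,e} + g_comp V adj {d,e})
     - (real (g_comp V adj {a,b,c}) + g_comp V adj {a,b,d} + g_comp V adj {a,b,e} + g_comp V adj {a,c,d} + g_comp V adj {a,c,e}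
        + g_comp V adj {a,d,e} + g_comp V adj {b,c,d} + g_comp V adj {b,c,e} + g_comp V adj {b,d,e} + g_comp V adj {c,d,e})
     + (real (g_comp V adj {a,b,c,d}) + g_comp V adj {a,b,c,e} + g_comp V adj {a,b,d,e} + g_comp V adj {a,c,d,e}
        + g_comp V adj {b,c,d,e})"
proof -
  have card: "CARD('c) = 5" using dist by (simp add: U)
  \<comment> \<open>The full color set, which corresponds to no cell, is added in order to sum over
    a whole power set, which \<open>sum_Pow_insert\<close> expands, and is compensated
    afterwards.\<close>
  have "(\<Sum>S\<in>Pow UNIV. (- 1) ^ card S * real (g_comp V adj S))
     = (- 1) ^ 5 * g_comp V adj UNIV + (\<Sum>S\<in>Pow UNIV - {UNIV}. (- 1) ^ card S * real (g_comp V adj S))"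
    by (subst sum.remove[of _ UNIV]) (auto simp: card)
  then have "euler_number V adj = (\<Sum>S\<in>Pow {a, b, c, d, e}. (- 1) ^ card S * real (g_comp V adj S)) + g_comp V adj {a, b, c, d, e}"
    unfolding euler_number_eq card U[symmetric] by simp
  also have "(\<Sum>S\<in>Pow {a, b, c, d, e}. (- 1) ^ card S * real (g_comp V adj S)) = X" if
    "X = card V
     - (real (g_comp V adj {a}) + g_comp V adj {b} + g_comp V adj {c} + g_comp V adj {d} + g_comp V adj {e})
     + (real (g_comp V adj {a,b}) + g_comp V adj {a,c} + g_comp V adj {a,d} + g_comp V adj {a,e} + g_comp V adj {b,c}
        + g_comp V adj {b,d} + g_comp V adj {b,e} + g_comp V adj {c,d} + g_comp V adj {c,e} + g_comp V adj {d,e})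
     - (real (g_comp V adj {a,b,c}) + g_comp V adj {a,b,d} + g_comp V adj {a,b,e} + g_comp V adj {a,c,d} + g_comp V adj {a,c,e}
        + g_comp V adj {a,d,e} + g_comp V adj {b,c,d} + g_comp V adj {b,c,e} + g_comp V adj {b,d,e} + g_comp V adj {c,d,e})
     + (real (g_comp V adj {a,b,c,d}) + g_comp V adj {a,b,c,e} + g_comp V adj {a,b,d,e} + g_comp V adj {a,c,d,e}
        + g_comp V adj {b,c,d,e}) - g_comp V adj {a, b, c, d, e}" for X
    unfolding that using dist by (simp add: sum_Pow_insert g_comp_empty)
  finally show ?thesis by simp
qed

lemma S2S1S1_rho_eps_ge:
  fixes adj :: "5 \<Rightarrow> 'v \<Rightarrow> 'v"
  assumes gem: "gem_of V adj S2S1S1" and eu: "euler_number V adj = 0" and eps: "eps \<in> cyc_perms"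
  shows "rho_eps V adj eps \<ge> 6"
proof -
  interpret cgraph V adj using gem by unfold_locales (simp add: gem_of_def)
  have "length eps = 5" using eps distinct_card[of eps] by (simp add: cyc_perms_def)
  then obtain a b c d e where l: "eps = [a, b, c, d, e]"
    by (auto simp: eval_nat_numeral length_Suc_conv)
  have U: "UNIV = {a, b, c, d, e}" and dist: "distinct [a, b, c, d, e]"
    using eps l by (auto simp: cyc_perms_def)
  let ?g = "g_comp V adj"
  have chi: "chi_eps V adj eps = real (?g {a, b}) + ?g {b, c} + ?g {c, d} + ?g {d, e} + ?g {e, a} - 3 * card V / 2"
  proof -
    have "(\<Sum>i<5. h i) = h 0 + h 1 + h 2 + h 3 + h 4" for h :: "nat \<Rightarrow> real"
      by (simp add: eval_nat_numeral)
    moreover have "CARD(5) = 5" by simp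
    ultimately show ?thesis unfolding chi_eps_def l by simp
  qed
  have co: "- {a} = {b, c, d, e}" "- {b} = {a, c, d, e}" "- {c} = {a, b, d, e}" "- {d} = {a, b, c, e}" "- {e} = {a, b, c, d}"
    "- {a, c} = {b, d, e}" "- {b, d} = {a, c, e}" "- {c, e} = {a, b, d}" "- {d, a} = {b, c, e}" "- {e, b} = {a, c, d}"
    using U dist by auto
  have pairs: "?g {b, c, d, e} + ?g {a, b, d, e} + 1 \<le> ?g {b, d, e}"
    "?g {a, c, d, e} + ?g {a, b, c, e} + 1 \<le> ?g {a, c, e}"
    "?g {a, b, d, e} + ?g {a, b, c, d} + 1 \<le> ?g {a, b, d}"
    "?g {a, b, c, e} + ?g {b, c, d, e} + 1 \<le> ?g {b, c, e}"
    "?g {a, b, c, d} + ?g {a, c, d, e} + 1 \<le> ?g {a, c, d}"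
    using S2S1S1_g_comp_pair_ge[OF gem] co dist
    by (metis distinct_length_2_or_more)+
  have T: "real (?g {x, y}) + ?g {y, z} + ?g {x, z} \<le> card V / 2 + 2 * ?g {x, y, z}" for x y z
    using g_comp_triple_le[of x y z] g_comp_singleton[of x] g_comp_singleton[of y] g_comp_singleton[of z]
    unfolding insert_commute[of z x] by linarith
  note eul = eu[unfolded euler_number_5[OF U dist]]
  define A where "A = real (?g {a, b}) + ?g {b, c} + ?g {c, d} + ?g {d, e} + ?g {a, e}"
  define B where "B = real (?g {a, c}) + ?g {b, d} + ?g {c, e} + ?g {a, d} + ?g {b, e}"
  define S where "S = real (?g {a, b, d}) + ?g {b, c, e} + ?g {a, c, d} + ?g {b, d, e} + ?g {a, c, e}"
  define S' where "S' = real (?g {a, b, c}) + ?g {b, c, d} + ?g {c, d, e} + ?g {a, d, e} + ?g {a, b, e}"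
  define F where "F = real (?g {a,b,c,d}) + ?g {a,b,c,e} + ?g {a,b,d,e} + ?g {a,c,d,e} + ?g {b,c,d,e}"
  \<comment> \<open>Links of edges: a triple in \<open>S\<close> contains one pair consecutive in
    \<open>eps\<close> and two others, a triple in \<open>S'\<close> two consecutive pairs and one
    other.\<close>
  have "A + 2 * B \<le> 5 * card V / 2 + 2 * S"
    using T[of a b d] T[of b c e] T[of a c d] T[of b d e] T[of a c e] by (simp add: A_def B_def S_def)
  moreover have "2 * A + B \<le> 5 * card V / 2 + 2 * S'"
    using T[of a b c] T[of b c d] T[of c d e] T[of a d e] T[of a b e] by (simp add: A_def B_def S'_def)
  \<comment> \<open>Each label occurs in exactly two of the five nonconsecutive pairs.\<close>
  moreover have "2 * F + 5 \<le> S"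
  proof -
    have *: "2 * (p + q + r + s + t) + 5 \<le> i + j + k + l + m"
      if "t + r + 1 \<le> l" "s + q + 1 \<le> m" "r + p + 1 \<le> i" "q + t + 1 \<le> j" "p + s + 1 \<le> k"
      for p q r s t i j k l m :: real using that by argo
    show ?thesis unfolding F_def S_def
      by (rule *; use pairs[THEN of_nat_mono[where 'a = real]] in \<open>simp only: of_nat_add of_nat_1\<close>)
  qed
  moreover have "A + B - (S + S') + F = 3 * card V / 2"
  proof -
    have "real (?g {a}) + ?g {b} + ?g {c} + ?g {d} + ?g {e} = 5 * card V / 2"
      using g_comp_singleton[of a] g_comp_singleton[of b] g_comp_singleton[of c]
        g_comp_singleton[of d] g_comp_singleton[of e] by linarith
    then show ?thesis using eul unfolding A_def B_def S_def S'_def F_def of_nat_add by linarith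
  qed
  \<comment> \<open>Eliminating \<open>S'\<close> between the Euler relation and the second link
    inequality gives \<open>B \<ge> 2 * S - 2 * F + card V / 2\<close>; the first then gives
    \<open>A \<le> 3 * card V / 2 - 2 * S + 4 * F\<close>.\<close>
  ultimately have "A \<le> 3 * card V / 2 - 10" by linarith
  then have "real (?g {a, b}) + ?g {b, c} + ?g {c, d} + ?g {d, e} + ?g {e, a} \<le> 3 * card V / 2 - 10"
    unfolding A_def insert_commute[of e a] .
  then show ?thesis unfolding rho_eps_def chi by (simp add: field_simps)
qed

section \<open>The crystallization with 40 vertices\<close>

text \<open>The universal cover of \<open>S\<^sup>2 \<times> S\<^sup>1 \<times> S\<^sup>1\<close> is tiled by staircase simplices: \<open>S\<^sup>2\<close> is the double of a
  triangle, the tetrahedra of (triangle \<open>\<times> \<real>\<close>) have the vertices (corner \<open>i mod 3\<close>, height \<open>i\<close>),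
  \<open>i = j, \<dots>, j + 3\<close>, and the 4-simplices of (tetrahedron \<open>\<times> \<real>\<close>) have the vertices (corner of label \<open>l mod 4\<close>,
  height \<open>l\<close>), \<open>l = k, \<dots>, k + 4\<close>, of color \<open>l mod 5\<close>. Dividing by the translations \<open>(j, k) \<mapsto> (j + 1, k + 5)\<close>
  and \<open>(j, k) \<mapsto> (j + 4, k)\<close> leaves 40 simplices: \<open>j = 0\<close>, \<open>k mod 20\<close> and a side
  \<open>\<delta>\<close> of the double triangle, encoded as \<open>2 k + \<delta>\<close>.\<close>

definition color_nat :: "5 \<Rightarrow> nat" where "color_nat c = nat (Rep_bit1 c)"

text \<open>\<open>r\<close> is the position of the color in the staircase \<open>k\<close>, ...,
  \<open>k + 4\<close>. The end positions 0 and 4 lead to the next or previous 4-simplex over the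
  same tetrahedron. An interior position lies over the corner \<open>m\<close> of the tetrahedron
  \<open>j = 0\<close>: its end corners 0 and 3 lead to \<open>j = 1\<close> and
  \<open>j = -1\<close>, which the lattice moves back to \<open>k - 5\<close> and
  \<open>k + 5\<close>, and its inner corners lead to the other side of the double triangle.\<close>

definition adj_nat :: "nat \<Rightarrow> nat \<Rightarrow> nat" where
  "adj_nat c n = (let k = n div 2; d = n mod 2; r = (c + 4 * k) mod 5; m = (k + r) mod 4 in
     if r = 0 then 2 * ((k + 1) mod 20) + d
     else if r = 4 then 2 * ((k + 19) mod 20) + d
     else if m = 0 then 2 * ((k + 15) mod 20) + d
     else if m = 3 then 2 * ((k + 5) mod 20) + d
     else 2 * k + (1 - d))"

definition adj40 :: "5 \<Rightarrow> nat \<Rightarrow> nat" where "adj40 c = adj_nat (color_nat c)"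

lemma five_eq_0 [simp]: "(5 :: 5) = 0" by simp

lemma color_nat_of_nat [simp]: "color_nat (of_nat n) = n mod 5"
proof -
  have "Rep_bit1 (of_nat n :: 5) = int n mod 5"
    unfolding bit1.of_nat_eq bit1.Rep_Abs_mod by simp
  then show ?thesis by (simp add: color_nat_def nat_mod_as_int)
qed

lemma color_cases: obtains l where "l < 5" "(c :: 5) = of_nat l"
proof (cases c)
  case (of_int z)
  then show ?thesis using that[of "nat z"] by auto
qed

lemma UNIV_5: "(UNIV :: 5 set) = {0, 1, 2, 3, 4}"
proof -
  have "c \<in> {0, 1, 2, 3, 4}" for c :: 5
  proof -
    obtain l where l: "l < 5" "c = of_nat l" by (rule color_cases)
    then have "l = 0 \<or> l = 1 \<or> l = 2 \<or> l = 3 \<or> l = 4" by auto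
    then show ?thesis using l(2) by auto
  qed
  then show ?thesis by blast
qed

section \<open>Adjacency tables and certificates for components\<close>

lemma all_less_iff_list_all: "(\<forall>n<N. P n) \<longleftrightarrow> list_all P [0..<N]"
  by (auto simp: list_all_iff)

definition adj_table :: "nat \<Rightarrow> nat list" where
  "adj_table c = map (adj_nat c) [0..<40]"

lemma upt_40: "[0..<40] = [0, 1, 2, 3, 4, 5, 6, 7, 8, 9, 10, 11, 12, 13, 14, 15, 16, 17, 18, 19, 20, 21, 22, 23, 24, 25, 26, 27, 28, 29, 30, 31, 32, 33, 34, 35, 36, 37, 38, 39]"
  by (simp add: upt_conv_Cons)

lemma adj_table_0: "adj_table 0 = [2, 3, 0, 1, 5, 4, 7, 6, 9, 8, 12, 13, 10, 11, 15, 14, 17, 16, 19, 18, 22, 23, 20, 21, 34, 35, 36, 37, 38, 39, 32, 33, 30, 31, 24, 25, 26, 27, 28, 29]"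
  unfolding adj_table_def upt_40 by (simp add: adj_nat_def Let_def)

lemma adj_table_1: "adj_table 1 = [1, 0, 4, 5, 2, 3, 7, 6, 9, 8, 11, 10, 14, 15, 12, 13, 26, 27, 28, 29, 30, 31, 24, 25, 22, 23, 16, 17, 18, 19, 20, 21, 34, 35, 32, 33, 37, 36, 39, 38]"
  unfolding adj_table_def upt_40 by (simp add: adj_nat_def Let_def)

lemma adj_table_2: "adj_table 2 = [1, 0, 3, 2, 6, 7, 4, 5, 18, 19, 20, 21, 22, 23, 16, 17, 14, 15, 8, 9, 10, 11, 12, 13, 26, 27, 24, 25, 29, 28, 31, 30, 33, 32, 36, 37, 34, 35, 39, 38]"
  unfolding adj_table_def upt_40 by (simp add: adj_nat_def Let_def)

lemma adj_table_3: "adj_table 3 = [10, 11, 12, 13, 14, 15, 8, 9, 6, 7, 0, 1, 2, 3, 4, 5, 18, 19, 16, 17, 21, 20, 23, 22, 25, 24, 28, 29, 26, 27, 31, 30, 33, 32, 35, 34, 38, 39, 36, 37]"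
  unfolding adj_table_def upt_40 by (simp add: adj_nat_def Let_def)

lemma adj_table_4: "adj_table 4 = [38, 39, 32, 33, 34, 35, 36, 37, 10, 11, 8, 9, 13, 12, 15, 14, 17, 16, 20, 21, 18, 19, 23, 22, 25, 24, 27, 26, 30, 31, 28, 29, 2, 3, 4, 5, 6, 7, 0, 1]"
  unfolding adj_table_def upt_40 by (simp add: adj_nat_def Let_def)

lemmas adj_tables = adj_table_0 adj_table_1 adj_table_1[unfolded One_nat_def] adj_table_2 adj_table_3 adj_table_4

lemma nth_adj_table: "n < 40 \<Longrightarrow> adj_table c ! n = adj_nat c n"
  by (simp add: adj_table_def)

lemma all_less_5: "(\<forall>c<5. P c) \<longleftrightarrow> P 0 \<and> P (1::nat) \<and> P 2 \<and> P 3 \<and> P 4"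
  unfolding all_less_iff_list_all by (simp add: upt_conv_Cons numeral_eq_Suc)

lemma adj_nat_graph: "\<forall>c<5. \<forall>n<40. adj_nat c n < 40 \<and> adj_nat c n \<noteq> n \<and> adj_nat c (adj_nat c n) = n"
proof -
  have "\<forall>c<5. list_all (\<lambda>n. adj_table c ! n < 40 \<and> adj_table c ! n \<noteq> n \<and> adj_table c ! (adj_table c ! n) = n) [0..<40]"
    unfolding all_less_5 upt_40 adj_tables by simp
  then have *: "adj_table c ! n < 40 \<and> adj_table c ! n \<noteq> n \<and> adj_table c ! (adj_table c ! n) = n"
    if "c < 5" "n < 40" for c n using that by (simp add: list_all_iff)
  show ?thesis
  proof (intro allI impI)
    fix c n :: nat assume cn: "c < 5" "n < 40"
    show "adj_nat c n < 40 \<and> adj_nat c n \<noteq> n \<and> adj_nat c (adj_nat c n) = n"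
      using *[OF cn] cn by (auto simp: nth_adj_table)
  qed
qed

lemma color_nat_less: "color_nat c < 5"
  by (rule color_cases[of c]) simp

interpretation G40: cgraph "{..<40}" adj40
  by unfold_locales (use adj_nat_graph color_nat_less in \<open>auto simp: colored_graph_def adj40_def\<close>)

text \<open>\<open>s\<close> is the parent table of a spanning forest of depth at most 8 and \<open>r\<close> the table of roots.\<close>

definition components_cert :: "nat list \<Rightarrow> nat list \<Rightarrow> nat list \<Rightarrow> bool" where
  "components_cert C r s \<longleftrightarrow> length s = 40 \<and>
     list_all (\<lambda>c. map ((!) r) (adj_table c) = r) C \<and>
     list_all (\<lambda>v. s ! v = v \<or> list_ex (\<lambda>c. s ! v = adj_table c ! v) C) [0..<40] \<and>
     (let s2 = map ((!) s) s; s4 = map ((!) s2) s2 in map ((!) s4) s4 = r)"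

text \<open>Following parents stays inside a component, and three squarings of the parent table
  perform eight steps. Conversely \<open>r\<close> is constant along edges, so distinct roots lie in
  distinct components.\<close>

lemma g_comp_cert:
  assumes cert: "components_cert C r s" and C: "\<forall>c\<in>set C. c < 5"
  shows "g_comp {..<40} adj40 (of_nat ` set C) = card (set r)"
proof -
  let ?C = "of_nat ` set C :: 5 set"
  let ?K = "comp_of {..<40} adj40 ?C"
  have adj: "adj40 (of_nat c) v = adj_nat c v" if "c \<in> set C" for c v
    using that C by (simp add: adj40_def)
  have K_adj: "?K (adj_nat c v) = ?K v \<and> adj_nat c v < 40" if "c \<in> set C" "v < 40" for c v
    using that G40.comp_of_adj[of v "of_nat c" ?C] G40.adj_V[of v "of_nat c"] by (simp add: adj)
  define good where "good t \<longleftrightarrow> length t = 40 \<and> (\<forall>v<40. ?K (t ! v) = ?K v \<and> t ! v < 40)" for t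
  have good_s: "good s"
    unfolding good_def
  proof (intro conjI allI impI)
    show "length s = 40" using cert by (simp add: components_cert_def)
    fix v :: nat assume v: "v < 40"
    moreover have "\<forall>v\<in>{0..<40}. s ! v = v \<or> (\<exists>c\<in>set C. s ! v = adj_nat c v)"
      using cert by (simp add: components_cert_def list_all_iff list_ex_iff nth_adj_table)
    ultimately have "s ! v = v \<or> (\<exists>c\<in>set C. s ! v = adj_nat c v)" by simp
    then show "?K (s ! v) = ?K v" "s ! v < 40" using K_adj v by auto
  qed
  have good_map: "good (map ((!) t) t)" if "good t" for t using that by (auto simp: good_def)
  have len: "length r = 40" and rK: "?K (r ! v) = ?K v" "r ! v < 40" if "v < 40" for v
    using good_map[OF good_map[OF good_map[OF good_s]]] cert that
    by (auto simp: components_cert_def good_def Let_def)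
  have Kr: "r ! v = r ! w" if "v < 40" "w < 40" "?K v = ?K w" for v w
  proof -
    have "(v, w) \<in> sub_rel {..<40} adj40 ?C" using G40.comp_of_eq_iff that by auto
    then show ?thesis
    proof (rule G40.sub_rel_invariant[where h = "(!) r"])
      fix v :: nat and c :: 5 assume v: "v \<in> {..<40}" and "c \<in> ?C"
      then obtain d where d: "d \<in> set C" "c = of_nat d" by auto
      then have "map ((!) r) (adj_table d) ! v = r ! v" using cert by (simp add: components_cert_def list_all_iff)
      then show "r ! adj40 c v = r ! v" using v d adj by (simp add: nth_adj_table adj_table_def)
    qed
  qed
  have "bij_betw (\<lambda>i. ?K i) ((!) r ` {..<40}) (?K ` {..<40})"
  proof (rule bij_betw_imageI)
    show "inj_on (\<lambda>i. ?K i) ((!) r ` {..<40})"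
    proof (rule inj_onI)
      fix i j assume "i \<in> (!) r ` {..<40}" "j \<in> (!) r ` {..<40}" and eq: "?K i = ?K j"
      then obtain v w where vw: "v < 40" "i = r ! v" "w < 40" "j = r ! w" by auto
      then show "i = j" using Kr[of v w] rK eq by simp
    qed
    show "?K ` (!) r ` {..<40} = ?K ` {..<40}"
      using rK by (auto simp: image_image)
  qed
  moreover have "(!) r ` {..<40} = set r" using len[of 0] by (auto simp: set_conv_nth)
  ultimately show ?thesis using bij_betw_same_card by (metis G40.g_comp_eq)
qed

section \<open>Component counts of the 40-vertex graph\<close>

lemma g40_01: "g_comp {..<40} adj40 {0, 1} = 8"
proof -
  let ?r = "[0, 0, 0, 0, 0, 0, 6, 6, 8, 8, 10, 10, 10, 10, 10, 10, 16, 16, 18, 18, 20, 21, 20, 21, 20, 21, 16, 16, 18, 18, 20, 21, 20, 21, 20, 21, 16, 16, 18, 18] :: nat list"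
  have "components_cert [0, 1] ?r
     [0, 0, 0, 1, 2, 4, 6, 6, 8, 8, 10, 10, 10, 11, 12, 14, 16, 16, 18, 18, 20, 21, 20, 21, 22, 23, 16, 17, 18, 19, 20, 21, 30, 31, 24, 25, 26, 27, 28, 29]"
    unfolding components_cert_def by (simp add: adj_tables upt_40)
  from g_comp_cert[OF this] have "g_comp {..<40} adj40 (of_nat ` set [0, 1]) = card (set ?r)"
    by simp
  also have "card (set ?r) = 8" unfolding List.card_set by simp
  finally show ?thesis by simp
qed

lemma g40_02: "g_comp {..<40} adj40 {0, 2} = 10"
proof -
  let ?r = "[0, 0, 0, 0, 4, 4, 4, 4, 8, 8, 10, 11, 10, 11, 14, 14, 14, 14, 8, 8, 10, 11, 10, 11, 24, 25, 24, 25, 28, 28, 30, 30, 30, 30, 24, 25, 24, 25, 28, 28] :: nat list"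
  have "components_cert [0, 2] ?r
     [0, 0, 0, 2, 4, 4, 4, 5, 8, 8, 10, 11, 10, 11, 14, 14, 14, 15, 8, 9, 10, 11, 12, 13, 24, 25, 24, 25, 28, 28, 30, 30, 30, 32, 24, 25, 34, 35, 28, 38]"
    unfolding components_cert_def by (simp add: adj_tables upt_40)
  from g_comp_cert[OF this] have "g_comp {..<40} adj40 (of_nat ` set [0, 2]) = card (set ?r)"
    by simp
  also have "card (set ?r) = 10" unfolding List.card_set by simp
  finally show ?thesis by simp
qed

lemma g40_012: "g_comp {..<40} adj40 {0, 1, 2} = 3"
proof -
  let ?r = "[0, 0, 0, 0, 0, 0, 0, 0, 8, 8, 10, 10, 10, 10, 10, 10, 10, 10, 8, 8, 10, 10, 10, 10, 10, 10, 10, 10, 8, 8, 10, 10, 10, 10, 10, 10, 10, 10, 8, 8] :: nat list"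
  have "components_cert [0, 1, 2] ?r
     [0, 0, 0, 2, 2, 4, 4, 5, 8, 8, 10, 10, 10, 11, 12, 14, 14, 15, 8, 9, 10, 11, 12, 13, 22, 23, 16, 17, 18, 19, 20, 21, 30, 31, 24, 25, 26, 27, 28, 29]"
    unfolding components_cert_def by (simp add: adj_tables upt_40)
  from g_comp_cert[OF this] have "g_comp {..<40} adj40 (of_nat ` set [0, 1, 2]) = card (set ?r)"
    by simp
  also have "card (set ?r) = 3" unfolding List.card_set by simp
  finally show ?thesis by simp
qed

lemma g40_013: "g_comp {..<40} adj40 {0, 1, 3} = 4"
proof -
  let ?r = "[0, 0, 0, 0, 0, 0, 6, 6, 6, 6, 0, 0, 0, 0, 0, 0, 16, 16, 16, 16, 20, 20, 20, 20, 20, 20, 16, 16, 16, 16, 20, 20, 20, 20, 20, 20, 16, 16, 16, 16] :: nat list"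
  have "components_cert [0, 1, 3] ?r
     [0, 0, 0, 1, 2, 4, 6, 6, 6, 7, 0, 1, 2, 3, 4, 5, 16, 16, 16, 17, 20, 20, 20, 22, 22, 24, 16, 17, 26, 27, 20, 30, 30, 32, 24, 34, 26, 27, 36, 37]"
    unfolding components_cert_def by (simp add: adj_tables upt_40)
  from g_comp_cert[OF this] have "g_comp {..<40} adj40 (of_nat ` set [0, 1, 3]) = card (set ?r)"
    by simp
  also have "card (set ?r) = 4" unfolding List.card_set by simp
  finally show ?thesis by simp
qed

lemma g40_0123: "g_comp {..<40} adj40 {0, 1, 2, 3} = 1"
proof -
  let ?r = "[0, 0, 0, 0, 0, 0, 0, 0, 0, 0, 0, 0, 0, 0, 0, 0, 0, 0, 0, 0, 0, 0, 0, 0, 0, 0, 0, 0, 0, 0, 0, 0, 0, 0, 0, 0, 0, 0, 0, 0] :: nat list"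
  have "components_cert [0, 1, 2, 3] ?r
     [0, 0, 0, 2, 2, 4, 4, 5, 6, 7, 0, 1, 2, 3, 4, 5, 14, 15, 8, 9, 10, 11, 12, 13, 22, 23, 16, 17, 18, 19, 20, 21, 30, 31, 24, 25, 26, 27, 28, 29]"
    unfolding components_cert_def by (simp add: adj_tables upt_40)
  from g_comp_cert[OF this] have "g_comp {..<40} adj40 (of_nat ` set [0, 1, 2, 3]) = card (set ?r)"
    by simp
  also have "card (set ?r) = 1" unfolding List.card_set by simp
  finally show ?thesis by simp
qed

text \<open>The shift of \<open>k\<close> by 16 is a symmetry: 16 is 1 modulo 5, so the colors
  advance by one, and 0 modulo 4, so the corners stay. On \<open>2 * k + \<delta>\<close> it is the
  shift by 32.\<close>

lemma adj_nat_rotate: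
  "\<forall>c<5. \<forall>n<40. adj_nat ((c + 1) mod 5) ((n + 32) mod 40) = (adj_nat c n + 32) mod 40"
proof -
  have "\<forall>c<5. list_all (\<lambda>n. adj_table ((c + 1) mod 5) ! ((n + 32) mod 40) = (adj_table c ! n + 32) mod 40) [0..<40]"
    unfolding all_less_5 upt_40 by (simp add: adj_tables numeral_2_eq_2[symmetric])
  then show ?thesis by (simp add: list_all_iff nth_adj_table)
qed

text \<open>Five certificates therefore suffice: under rotation of the colors the pairs and the
  triples form two orbits each, the quadruples one.\<close>

lemma g40_shift: "g_comp {..<40} adj40 ((\<lambda>c. c + 1) ` C) = g_comp {..<40} adj40 C"
proof -
  \<comment> \<open>\<open>?t\<close> is the inverse of \<open>?s\<close> because 32 + 8 =
    40.\<close>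
  let ?s = "\<lambda>n::nat. (n + 32) mod 40" and ?t = "\<lambda>n::nat. (n + 8) mod 40"
  let ?V = "{..<40::nat}"
  have st: "?s (?t n) = n" "?t (?s n) = n" if "n < 40" for n
    using that by (auto simp: mod_simps)
  have sh: "adj40 (c + 1) (?s n) = ?s (adj40 c n)" if n: "n < 40" for c n
  proof -
    obtain l where l: "l < 5" "c = of_nat l" by (rule color_cases)
    have "c + 1 = of_nat (l + 1)" using l by simp
    then have "color_nat (c + 1) = (l + 1) mod 5" "color_nat c = l" using l color_nat_of_nat by (metis, simp)
    then show ?thesis using adj_nat_rotate n l by (simp add: adj40_def)
  qed
  let ?D = "(\<lambda>c. c + 1) ` C"
  have *: "(?s v, ?s w) \<in> sub_rel ?V adj40 ?D \<longleftrightarrow> (v, w) \<in> sub_rel ?V adj40 C" if vw: "v < 40" "w < 40" for v w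
  proof
    assume a: "(v, w) \<in> sub_rel ?V adj40 C"
    have "comp_of ?V adj40 ?D (?s v) = comp_of ?V adj40 ?D (?s w)"
    proof (rule G40.sub_rel_invariant[OF a])
      fix v c assume v: "v \<in> ?V" "c \<in> C"
      then show "comp_of ?V adj40 ?D (?s (adj40 c v)) = comp_of ?V adj40 ?D (?s v)"
        using G40.comp_of_adj[of "?s v" "c + 1" ?D] sh[of v c] by simp
    qed
    then show "(?s v, ?s w) \<in> sub_rel ?V adj40 ?D" using G40.comp_of_eq_iff by simp
  next
    assume a: "(?s v, ?s w) \<in> sub_rel ?V adj40 ?D"
    have "comp_of ?V adj40 C (?t (?s v)) = comp_of ?V adj40 C (?t (?s w))"
    proof (rule G40.sub_rel_invariant[OF a, of "\<lambda>v. comp_of ?V adj40 C (?t v)"])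
      fix v d assume v: "v \<in> ?V" "d \<in> ?D"
      then obtain c where c: "c \<in> C" "d = c + 1" by auto
      have tv: "?t v < 40" by simp
      have "adj40 d v = ?s (adj40 c (?t v))" using sh[OF tv, of c] st(1)[of v] v c by simp
      moreover have "adj40 c (?t v) < 40" using G40.adj_V[of "?t v" c] by simp
      ultimately have "?t (adj40 d v) = adj40 c (?t v)" using st(2) by simp
      then show "comp_of ?V adj40 C (?t (adj40 d v)) = comp_of ?V adj40 C (?t v)"
        using G40.comp_of_adj[of "?t v" c C] c by simp
    qed
    then show "(v, w) \<in> sub_rel ?V adj40 C" using G40.comp_of_eq_iff st(2) vw by simp
  qed
  have "bij_betw (\<lambda>K. comp_of ?V adj40 ?D (?s (G40.rep K))) (comp_of ?V adj40 C ` ?V) (comp_of ?V adj40 ?D ` ?V)"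
  proof (rule bij_betw_imageI)
    have rep: "comp_of ?V adj40 ?D (?s (G40.rep (comp_of ?V adj40 C v))) = comp_of ?V adj40 ?D (?s v)" if "v < 40" for v
      using *[of "G40.rep (comp_of ?V adj40 C v)" v] G40.rep_comp(1,3)[of v C] that G40.comp_of_eq_iff by auto
    show "inj_on (\<lambda>K. comp_of ?V adj40 ?D (?s (G40.rep K))) (comp_of ?V adj40 C ` ?V)"
    proof (rule inj_onI)
      fix K K' assume "K \<in> comp_of ?V adj40 C ` ?V" "K' \<in> comp_of ?V adj40 C ` ?V"
        and eq: "comp_of ?V adj40 ?D (?s (G40.rep K)) = comp_of ?V adj40 ?D (?s (G40.rep K'))"
      then obtain v w where vw: "v < 40" "K = comp_of ?V adj40 C v" "w < 40" "K' = comp_of ?V adj40 C w" by auto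
      then have "(?s v, ?s w) \<in> sub_rel ?V adj40 ?D"
        using eq rep G40.comp_of_eq_iff[of "?s v" "?s w" ?D] by simp
      then show "K = K'" using *[of v w] vw G40.comp_of_eq_iff by simp
    qed
    have "?s ` ?V = ?V" using st by (auto simp: image_iff) (metis lessThan_iff mod_less_divisor zero_less_numeral)
    then have "comp_of ?V adj40 ?D ` ?V = (\<lambda>v. comp_of ?V adj40 ?D (?s v)) ` ?V" by (metis image_image)
    then show "(\<lambda>K. comp_of ?V adj40 ?D (?s (G40.rep K))) ` comp_of ?V adj40 C ` ?V = comp_of ?V adj40 ?D ` ?V"
      using rep by (auto simp: image_image)
  qed
  then show ?thesis using bij_betw_same_card by (metis G40.g_comp_eq)
qed

lemma g40_12: "g_comp {..<40} adj40 {1, 2} = 8"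
  using g40_shift[of "{0, 1}"] g40_01 by (simp add: insert_commute)

lemma g40_23: "g_comp {..<40} adj40 {2, 3} = 8"
  using g40_shift[of "{1, 2}"] g40_12 by (simp add: insert_commute)

lemma g40_34: "g_comp {..<40} adj40 {3, 4} = 8"
  using g40_shift[of "{2, 3}"] g40_23 by (simp add: insert_commute)

lemma g40_04: "g_comp {..<40} adj40 {0, 4} = 8"
  using g40_shift[of "{3, 4}"] g40_34 by (simp add: insert_commute)

lemma g40_13: "g_comp {..<40} adj40 {1, 3} = 10"
  using g40_shift[of "{0, 2}"] g40_02 by (simp add: insert_commute)

lemma g40_24: "g_comp {..<40} adj40 {2, 4} = 10"
  using g40_shift[of "{1, 3}"] g40_13 by (simp add: insert_commute)

lemma g40_03: "g_comp {..<40} adj40 {0, 3} = 10"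
  using g40_shift[of "{2, 4}"] g40_24 by (simp add: insert_commute)

lemma g40_14: "g_comp {..<40} adj40 {1, 4} = 10"
  using g40_shift[of "{0, 3}"] g40_03 by (simp add: insert_commute)

lemma g40_123: "g_comp {..<40} adj40 {1, 2, 3} = 3"
  using g40_shift[of "{0, 1, 2}"] g40_012 by (simp add: insert_commute)

lemma g40_234: "g_comp {..<40} adj40 {2, 3, 4} = 3"
  using g40_shift[of "{1, 2, 3}"] g40_123 by (simp add: insert_commute)

lemma g40_034: "g_comp {..<40} adj40 {0, 3, 4} = 3"
  using g40_shift[of "{2, 3, 4}"] g40_234 by (simp add: insert_commute)

lemma g40_014: "g_comp {..<40} adj40 {0, 1, 4} = 3"
  using g40_shift[of "{0, 3, 4}"] g40_034 by (simp add: insert_commute)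

lemma g40_124: "g_comp {..<40} adj40 {1, 2, 4} = 4"
  using g40_shift[of "{0, 1, 3}"] g40_013 by (simp add: insert_commute)

lemma g40_023: "g_comp {..<40} adj40 {0, 2, 3} = 4"
  using g40_shift[of "{1, 2, 4}"] g40_124 by (simp add: insert_commute)

lemma g40_134: "g_comp {..<40} adj40 {1, 3, 4} = 4"
  using g40_shift[of "{0, 2, 3}"] g40_023 by (simp add: insert_commute)

lemma g40_024: "g_comp {..<40} adj40 {0, 2, 4} = 4"
  using g40_shift[of "{1, 3, 4}"] g40_134 by (simp add: insert_commute)

lemma g40_1234: "g_comp {..<40} adj40 {1, 2, 3, 4} = 1"
  using g40_shift[of "{0, 1, 2, 3}"] g40_0123 by (simp add: insert_commute)

lemma g40_0234: "g_comp {..<40} adj40 {0, 2, 3, 4} = 1"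
  using g40_shift[of "{1, 2, 3, 4}"] g40_1234 by (simp add: insert_commute)

lemma g40_0134: "g_comp {..<40} adj40 {0, 1, 3, 4} = 1"
  using g40_shift[of "{0, 2, 3, 4}"] g40_0234 by (simp add: insert_commute)

lemma g40_0124: "g_comp {..<40} adj40 {0, 1, 2, 4} = 1"
  using g40_shift[of "{0, 1, 3, 4}"] g40_0134 by (simp add: insert_commute)

lemmas g40 = g40_01 g40_012 g40_0123 g40_0124 g40_013 g40_0134 g40_014 g40_02 g40_023 g40_0234 g40_024 g40_03 g40_034 g40_04 g40_12 g40_123 g40_1234 g40_124 g40_13 g40_134 g40_14 g40_23 g40_234 g40_24 g40_34

lemma g40_singleton: "g_comp {..<40} adj40 {c} = 20"
  using G40.g_comp_singleton[of c] by simp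

lemma euler_number_40: "euler_number {..<40} adj40 = 0"
  by (subst G40.euler_number_5[OF UNIV_5]) (simp_all add: g40 g40_singleton)

lemma g40_minus: "g_comp {..<40} adj40 (UNIV - {j}) = 1"
proof -
  have "j \<in> {0, 1, 2, 3, 4}" using UNIV_5 by blast
  moreover have "UNIV - {0::5} = {1,2,3,4}" "UNIV - {1::5} = {0,2,3,4}" "UNIV - {2::5} = {0,1,3,4}"
    "UNIV - {3::5} = {0,1,2,4}" "UNIV - {4::5} = {0,1,2,3}" unfolding UNIV_5 by auto
  ultimately show ?thesis using g40_0123 g40_0124 g40_0134 g40_0234 g40_1234
    by (elim insertE emptyE) (simp_all only:)
qed

text \<open>The labels that are nonconsecutive in this permutation are the neighbors modulo 5.
  Neighbors are joined by 3 edges each, other labels by 4; so the nonconsecutive pairs have 15 = 2 *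
  5 + 5 edges in all, which is equality in the lower bound for 5 vertices.\<close>

lemma rho_eps_40: "[4, 2, 0, 3, 1 :: 5] \<in> cyc_perms" "rho_eps {..<40} adj40 [4, 2, 0, 3, 1] = 6"
proof -
  show "[4, 2, 0, 3, 1 :: 5] \<in> cyc_perms"
  proof -
    have "distinct [4, 2, 0, 3, 1 :: 5]" by simp
    moreover have "set [4, 2, 0, 3, 1 :: 5] = UNIV" unfolding UNIV_5 by auto
    ultimately show "[4, 2, 0, 3, 1 :: 5] \<in> cyc_perms" by (simp only: cyc_perms_def mem_Collect_eq)
  qed
  have "(\<Sum>i<5. h i) = h 0 + h 1 + h 2 + h 3 + h 4" for h :: "nat \<Rightarrow> real"
    by (simp add: eval_nat_numeral)
  moreover have "CARD(5) = 5" by simp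
  moreover have "{4, 2 :: 5} = {2, 4}" "{2, 0 :: 5} = {0, 2}" "{3, 1 :: 5} = {1, 3}" by auto
  ultimately show "rho_eps {..<40} adj40 [4, 2, 0, 3, 1] = 6"
    unfolding rho_eps_def chi_eps_def by (simp add: g40_24 g40_02 g40_03 g40_13 g40_14)
qed

section \<open>Piecewise affine functions\<close>

definition affine_fun_on :: "'a::euclidean_space set \<Rightarrow> ('a \<Rightarrow> 'b::real_vector) \<Rightarrow> bool" where
  "affine_fun_on t f \<longleftrightarrow> (\<exists>g c. linear g \<and> (\<forall>x\<in>t. f x = g x + c))"

lemma affine_fun_on_subset: "affine_fun_on t f \<Longrightarrow> s \<subseteq> t \<Longrightarrow> affine_fun_on s f"
  unfolding affine_fun_on_def by blast

lemma affine_fun_on_cong: "affine_fun_on t f \<Longrightarrow> (\<And>x. x \<in> t \<Longrightarrow> f x = g x) \<Longrightarrow> affine_fun_on t g"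
  unfolding affine_fun_on_def by (metis (no_types))

lemma affine_fun_on_linear: "linear f \<Longrightarrow> affine_fun_on t f"
  unfolding affine_fun_on_def by (intro exI[of _ f] exI[of _ 0]) auto

lemma affine_fun_on_const: "affine_fun_on t (\<lambda>x. c)"
  unfolding affine_fun_on_def by (intro exI[of _ "\<lambda>x. 0"] exI[of _ c]) (auto simp: linear_zero)

lemma affine_fun_on_linear_compose:
  assumes "affine_fun_on t f" "linear h" shows "affine_fun_on t (\<lambda>x. h (f x))"
proof -
  obtain g c where g: "linear g" "\<forall>x\<in>t. f x = g x + c" using assms(1) unfolding affine_fun_on_def by blast
  have "linear (\<lambda>x. h (g x))" using linear_compose[OF g(1) assms(2)] by (simp add: o_def)
  then show ?thesis unfolding affine_fun_on_def using g(2) assms(2)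
    by (intro exI[of _ "\<lambda>x. h (g x)"] exI[of _ "h c"]) (auto simp: linear_add)
qed

lemma affine_fun_on_add:
  assumes "affine_fun_on t f" "affine_fun_on t g" shows "affine_fun_on t (\<lambda>x. f x + g x)"
proof -
  obtain f' c where f: "linear f'" "\<forall>x\<in>t. f x = f' x + c" using assms(1) unfolding affine_fun_on_def by blast
  obtain g' d where g: "linear g'" "\<forall>x\<in>t. g x = g' x + d" using assms(2) unfolding affine_fun_on_def by blast
  show ?thesis unfolding affine_fun_on_def using f g
    by (intro exI[of _ "\<lambda>x. f' x + g' x"] exI[of _ "c + d"]) (auto simp: linear_compose_add)
qed

text \<open>Polytopes replace the simplices of \<open>pl_on\<close> because they are closed under
  the intersections and halfspace cuts that sums, \<open>min\<close> and \<open>max\<close>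
  require.\<close>

definition pw_affine_on :: "'a::euclidean_space set \<Rightarrow> ('a \<Rightarrow> 'b::real_vector) \<Rightarrow> bool" where
  "pw_affine_on S f \<longleftrightarrow> (\<exists>T. finite T \<and> \<Union>T = S \<and> (\<forall>t\<in>T. polytope t \<and> affine_fun_on t f))"

text \<open>Each polytope is triangulated on its own; the triangulations need not match, as
  \<open>pl_on\<close> asks for a cover by simplices, not for a complex.\<close>

lemma pw_affine_on_imp_pl_on:
  assumes "pw_affine_on S f" shows "pl_on S f"
proof -
  obtain T where T: "finite T" "\<Union>T = S" "\<And>t. t \<in> T \<Longrightarrow> polytope t" "\<And>t. t \<in> T \<Longrightarrow> affine_fun_on t f"
    using assms unfolding pw_affine_on_def by auto
  have "\<exists>U. finite U \<and> \<Union>U = t \<and> (\<forall>u\<in>U. \<exists>k. k simplex u)" if t: "t \<in> T" for t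
  proof -
    obtain U where "simplicial_complex U" "\<Union>U = \<Union>{t}"
    proof (rule simplicial_subdivision_of_cell_complex[of "{t}"])
      show "\<And>C. C \<in> {t} \<Longrightarrow> polytope C" using T(3)[OF t] by auto
      show "\<And>C1 C2. C1 \<in> {t} \<Longrightarrow> C2 \<in> {t} \<Longrightarrow> C1 \<inter> C2 face_of C1"
        using T(3)[OF t] by (auto simp: face_of_refl polytope_imp_convex)
    qed auto
    then show ?thesis unfolding simplicial_complex_def by auto
  qed
  then obtain U where U: "\<And>t. t \<in> T \<Longrightarrow> finite (U t) \<and> \<Union>(U t) = t \<and> (\<forall>u\<in>U t. \<exists>k. k simplex u)"
    by metis
  show ?thesis unfolding pl_on_def
  proof (intro exI[of _ "\<Union>(U ` T)"] conjI ballI)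
    show "finite (\<Union>(U ` T))" using T(1) U by auto
    have "\<Union>(\<Union>(U ` T)) = (\<Union>t\<in>T. \<Union>(U t))" by blast
    also have "\<dots> = (\<Union>t\<in>T. t)" using U by (intro SUP_cong) auto
    finally show "\<Union>(\<Union>(U ` T)) = S" using T(2) by simp
    fix u assume "u \<in> \<Union>(U ` T)"
    then obtain t where t: "t \<in> T" "u \<in> U t" by auto
    show "\<exists>k. k simplex u" using U t by blast
    have "u \<subseteq> t" using U t by blast
    then show "\<exists>g c. linear g \<and> (\<forall>x\<in>u. f x = g x + c)"
      using affine_fun_on_subset[OF T(4)[OF t(1)]] unfolding affine_fun_on_def by blast
  qed
qed

lemma pw_affine_on_common:
  assumes "pw_affine_on S f" "pw_affine_on S g"
  shows "\<exists>T. finite T \<and> \<Union>T = S \<and> (\<forall>t\<in>T. polytope t \<and> affine_fun_on t f \<and> affine_fun_on t g)"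
proof -
  obtain T where T: "finite T" "\<Union>T = S" "\<And>t. t \<in> T \<Longrightarrow> polytope t" "\<And>t. t \<in> T \<Longrightarrow> affine_fun_on t f"
    using assms(1) unfolding pw_affine_on_def by auto
  obtain U where U: "finite U" "\<Union>U = S" "\<And>t. t \<in> U \<Longrightarrow> polytope t" "\<And>t. t \<in> U \<Longrightarrow> affine_fun_on t g"
    using assms(2) unfolding pw_affine_on_def by auto
  let ?W = "(\<lambda>(t, u). t \<inter> u) ` (T \<times> U)"
  show ?thesis
  proof (intro exI[of _ ?W] conjI ballI)
    show "finite ?W" using T(1) U(1) by auto
    have "\<Union>?W = \<Union>T \<inter> \<Union>U" by auto
    then show "\<Union>?W = S" using T(2) U(2) by simp
    fix w assume "w \<in> ?W"
    then obtain t u where w: "t \<in> T" "u \<in> U" "w = t \<inter> u" by auto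
    show "polytope w" using w T(3) U(3) by (simp add: polytope_Int)
    show "affine_fun_on w f" using affine_fun_on_subset[OF T(4)[OF w(1)]] w(3) by simp
    show "affine_fun_on w g" using affine_fun_on_subset[OF U(4)[OF w(2)]] w(3) by simp
  qed
qed

lemma pw_affine_on_binop:
  assumes "pw_affine_on S f" "pw_affine_on S g"
    and "\<And>t. affine_fun_on t f \<Longrightarrow> affine_fun_on t g \<Longrightarrow> affine_fun_on t h"
  shows "pw_affine_on S h"
proof -
  obtain T where "finite T" "\<Union>T = S" "\<forall>t\<in>T. polytope t \<and> affine_fun_on t f \<and> affine_fun_on t g"
    using pw_affine_on_common[OF assms(1,2)] by blast
  then show ?thesis unfolding pw_affine_on_def using assms(3) by (intro exI[of _ T]) auto
qed

lemma pw_affine_on_cong: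
  "pw_affine_on S f \<Longrightarrow> (\<And>x. x \<in> S \<Longrightarrow> f x = g x) \<Longrightarrow> pw_affine_on S g"
  unfolding pw_affine_on_def
  by (elim exE, rule exI, intro conjI ballI; elim conjE)
     (auto intro: affine_fun_on_cong)

lemma pw_affine_on_affine: "polytope S \<Longrightarrow> affine_fun_on S f \<Longrightarrow> pw_affine_on S f"
  unfolding pw_affine_on_def by (intro exI[of _ "{S}"]) auto

lemma pw_affine_on_linear_compose:
  "pw_affine_on S f \<Longrightarrow> linear h \<Longrightarrow> pw_affine_on S (\<lambda>x. h (f x))"
  by (rule pw_affine_on_binop[of S f f]) (auto intro: affine_fun_on_linear_compose)

lemma pw_affine_on_add:
  "pw_affine_on S f \<Longrightarrow> pw_affine_on S g \<Longrightarrow> pw_affine_on S (\<lambda>x. f x + g x)"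
  by (rule pw_affine_on_binop[of S f g]) (auto intro: affine_fun_on_add)

lemma pw_affine_on_cmult: "pw_affine_on S f \<Longrightarrow> pw_affine_on S (\<lambda>x. (c::real) * f x)"
  by (rule pw_affine_on_linear_compose) (auto simp: linear_iff algebra_simps)

lemma pw_affine_on_diff:
  "pw_affine_on S f \<Longrightarrow> pw_affine_on S g \<Longrightarrow> pw_affine_on S (\<lambda>x. f x - (g x :: real))"
  using pw_affine_on_add[of S f "\<lambda>x. (- 1) * g x"] pw_affine_on_cmult[of S g "- 1"] by simp

lemma pw_affine_on_const: "polytope S \<Longrightarrow> pw_affine_on S (\<lambda>x. c)"
  by (intro pw_affine_on_affine affine_fun_on_const)

lemma pw_affine_on_sum:
  "polytope S \<Longrightarrow> (\<And>i. i \<in> I \<Longrightarrow> pw_affine_on S (f i)) \<Longrightarrow> pw_affine_on S (\<lambda>x. \<Sum>i\<in>I. f i x)"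
  by (induction I rule: infinite_finite_induct) (auto intro: pw_affine_on_const pw_affine_on_add)

text \<open>Every piece is cut by the hyperplane where the affine function \<open>h\<close>
  vanishes. Agreement of \<open>f\<close> and \<open>g\<close> there allows both halves to be
  closed.\<close>

lemma pw_affine_on_if:
  fixes h :: "'a::euclidean_space \<Rightarrow> real"
  assumes "pw_affine_on S h" "pw_affine_on S f" "pw_affine_on S g"
    and "\<And>x. x \<in> S \<Longrightarrow> h x = 0 \<Longrightarrow> f x = g x"
  shows "pw_affine_on S (\<lambda>x. if h x \<le> 0 then f x else g x)"
proof -
  let ?F = "\<lambda>x. if h x \<le> 0 then f x else g x"
  \<comment> \<open>Pairing \<open>f\<close> with \<open>g\<close> reduces a common refinement for
    three functions to the one for two.\<close>
  have "pw_affine_on S (\<lambda>x. (f x, g x))"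
  proof -
    have "linear (\<lambda>y. (y, 0))" "linear (\<lambda>y. (0, y))" by (auto simp: linear_iff)
    from pw_affine_on_add[OF pw_affine_on_linear_compose[OF assms(2) this(1)] pw_affine_on_linear_compose[OF assms(3) this(2)]]
    show ?thesis by simp
  qed
  from pw_affine_on_common[OF assms(1) this]
  obtain T where fin: "finite T" and US: "\<Union>T = S"
    and all: "\<forall>t\<in>T. polytope t \<and> affine_fun_on t h \<and> affine_fun_on t (\<lambda>x. (f x, g x))"
    by (elim exE conjE)
  note T = fin US all[rule_format, THEN conjunct1] all[rule_format, THEN conjunct2, THEN conjunct1]
    all[rule_format, THEN conjunct2, THEN conjunct2]
  let ?U = "(\<lambda>t. t \<inter> {x. h x \<le> 0}) ` T \<union> (\<lambda>t. t \<inter> {x. h x \<ge> 0}) ` T"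
  have fg: "affine_fun_on t f" "affine_fun_on t g" if "t \<in> T" for t
    using affine_fun_on_linear_compose[OF T(5)[OF that] linear_fst]
      affine_fun_on_linear_compose[OF T(5)[OF that] linear_snd] by simp_all
  have poly: "polytope (t \<inter> {x. h x \<le> 0}) \<and> polytope (t \<inter> {x. h x \<ge> 0})" if t: "t \<in> T" for t
  proof -
    obtain l c where l: "linear l" "\<forall>x\<in>t. h x = l x + c" using T(4)[OF t] unfolding affine_fun_on_def by blast
    have ad: "l x = adjoint l 1 \<bullet> x" for x
      using adjoint_works[OF l(1), of x 1] by (simp add: inner_commute)
    have "t \<inter> {x. h x \<le> 0} = t \<inter> {x. adjoint l 1 \<bullet> x \<le> - c}" "t \<inter> {x. h x \<ge> 0} = t \<inter> {x. adjoint l 1 \<bullet> x \<ge> - c}"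
      using l(2) ad by auto
    then show ?thesis using T(3)[OF t]
      by (auto intro!: polytope_Int_polyhedron polyhedron_halfspace_le polyhedron_halfspace_ge)
  qed
  show ?thesis unfolding pw_affine_on_def
  proof (intro exI[of _ ?U] conjI ballI)
    show "finite ?U" using T(1) by auto
    show "\<Union>?U = S" using T(2) by fastforce
    fix u assume u: "u \<in> ?U"
    show "polytope u" using u poly by auto
    show "affine_fun_on u ?F"
    proof -
      consider t where "t \<in> T" "u = t \<inter> {x. h x \<le> 0}" | t where "t \<in> T" "u = t \<inter> {x. h x \<ge> 0}" using u by blast
      then show ?thesis
      proof cases
        case 1
        then show ?thesis by (intro affine_fun_on_cong[OF affine_fun_on_subset[OF fg(1)]]) auto
      next
        case 2
        have "g x = ?F x" if "x \<in> u" for x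
        proof -
          have "x \<in> S" "h x \<ge> 0" using 2 that T(2) by auto
          then show ?thesis using assms(4)[of x] by auto
        qed
        then show ?thesis using 2 by (intro affine_fun_on_cong[OF affine_fun_on_subset[OF fg(2)]]) auto
      qed
    qed
  qed
qed

lemma pw_affine_on_max:
  fixes f g :: "'a::euclidean_space \<Rightarrow> real"
  assumes "pw_affine_on S f" "pw_affine_on S g" shows "pw_affine_on S (\<lambda>x. max (f x) (g x))"
  by (rule pw_affine_on_cong[OF pw_affine_on_if[OF pw_affine_on_diff[OF assms] assms(2,1)]]) auto

lemma pw_affine_on_min:
  fixes f g :: "'a::euclidean_space \<Rightarrow> real"
  assumes "pw_affine_on S f" "pw_affine_on S g" shows "pw_affine_on S (\<lambda>x. min (f x) (g x))"
  by (rule pw_affine_on_cong[OF pw_affine_on_if[OF pw_affine_on_diff[OF assms] assms]]) auto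

text \<open>Made for functions of \<open>frac\<close> and floor, given by another formula on each
  closed strip of \<open>h\<close>. The induction adds one strip at a time; that the formulas agree
  where strips meet is part of the hypothesis on \<open>f\<close>.\<close>

lemma pw_affine_on_unit_steps:
  fixes h :: "'a::euclidean_space \<Rightarrow> real"
  assumes h: "pw_affine_on S h" "\<And>x. x \<in> S \<Longrightarrow> 0 \<le> h x" "\<And>x. x \<in> S \<Longrightarrow> h x \<le> real N + 1"
    and g: "\<And>n. pw_affine_on S (g n)" and S: "polytope S"
    and f: "\<And>n x. x \<in> S \<Longrightarrow> real n \<le> h x \<Longrightarrow> h x \<le> real n + 1 \<Longrightarrow> f x = g n x"
  shows "pw_affine_on S f"
proof -
  have "\<exists>F. pw_affine_on S F \<and> (\<forall>x\<in>S. h x \<le> real n + 1 \<longrightarrow> F x = f x)" for n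
  proof (induction n)
    case 0
    then show ?case using g[of 0] f[of _ 0] h(2) by auto
  next
    case (Suc n)
    then obtain F where F: "pw_affine_on S F" "\<And>x. x \<in> S \<Longrightarrow> h x \<le> real n + 1 \<Longrightarrow> F x = f x" by auto
    let ?G = "\<lambda>x. if h x - (real n + 1) \<le> 0 then F x else g (Suc n) x"
    have "pw_affine_on S ?G"
    proof (rule pw_affine_on_if[OF _ F(1) g])
      show "pw_affine_on S (\<lambda>x. h x - (real n + 1))"
        by (intro pw_affine_on_diff h pw_affine_on_const S)
      show "F x = g (Suc n) x" if "x \<in> S" "h x - (real n + 1) = 0" for x
        using that F(2)[of x] f[of x "Suc n"] by simp
    qed
    moreover have "\<forall>x\<in>S. h x \<le> real (Suc n) + 1 \<longrightarrow> ?G x = f x"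
      using F(2) f[of _ "Suc n"] by auto
    ultimately show ?case by blast
  qed
  then obtain F where "pw_affine_on S F" "\<forall>x\<in>S. h x \<le> real N + 1 \<longrightarrow> F x = f x" by blast
  then show ?thesis using h(3) pw_affine_on_cong by metis
qed

lemma pw_affine_on_vec:
  fixes f :: "'a::euclidean_space \<Rightarrow> real^'n"
  assumes "polytope S" "\<And>i. pw_affine_on S (\<lambda>x. f x $ i)" shows "pw_affine_on S f"
proof -
  have "pw_affine_on S (\<lambda>x. \<Sum>i\<in>UNIV. (f x $ i) *\<^sub>R axis i (1::real))"
  proof (intro pw_affine_on_sum assms(1))
    fix i
    have "linear (\<lambda>y. y *\<^sub>R axis i (1::real) :: real^'n)" by (simp add: linear_iff algebra_simps)
    from pw_affine_on_linear_compose[OF assms(2)[of i] this]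
    show "pw_affine_on S (\<lambda>x. (f x $ i) *\<^sub>R axis i (1::real) :: real^'n)" .
  qed
  then show ?thesis
    by (rule pw_affine_on_cong) (simp add: vec_eq_iff axis_def if_distrib sum.delta cong: if_cong)
qed

lemma pw_affine_on_Pair:
  assumes "pw_affine_on S f" "pw_affine_on S g" shows "pw_affine_on S (\<lambda>x. (f x, g x))"
proof -
  have "linear (\<lambda>y. (y, 0))" "linear (\<lambda>y. (0, y))" by (auto simp: linear_iff)
  from pw_affine_on_add[OF pw_affine_on_linear_compose[OF assms(1) this(1)] pw_affine_on_linear_compose[OF assms(2) this(2)]]
  show ?thesis by simp
qed

lemma polytope_std_simplex: "polytope (std_simplex :: (real^'c::finite) set)"
proof -
  have 1: "{x :: real^'c. (\<Sum>i\<in>UNIV. x $ i) = 1} = {x. (\<chi> i. 1) \<bullet> x = 1}"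
    by (simp add: inner_vec_def)
  have 2: "{x :: real^'c. 0 \<le> x $ i} = {x. axis i 1 \<bullet> x \<ge> 0}" for i
    by (simp add: inner_axis')
  have "(std_simplex :: (real^'c) set) = {x. (\<Sum>i\<in>UNIV. x $ i) = 1} \<inter> \<Inter>((\<lambda>i. {x. 0 \<le> x $ i}) ` UNIV)"
    by (auto simp: std_simplex_def)
  moreover have "polyhedron \<dots>"
    unfolding 1 2 by (intro polyhedron_Int polyhedron_Inter)
      (auto intro: polyhedron_hyperplane polyhedron_halfspace_ge)
  ultimately show ?thesis using bounded_std_simplex by (simp add: polytope_eq_bounded_polyhedron)
qed

lemma pw_affine_on_coord: "pw_affine_on (std_simplex :: (real^'c::finite) set) (\<lambda>x. x $ i)"
  by (intro pw_affine_on_affine polytope_std_simplex affine_fun_on_linear) (simp add: linear_iff)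

section \<open>Piecewise affine parametrizations of the sphere and the circle\<close>

text \<open>The circle of nonnegative triples with a zero entry and sum \<open>r\<close> is rotated by the amount \<open>\<sigma> \<le> r\<close>
  by transferring mass from each entry to the cyclically preceding one; \<open>\<sigma> = r\<close> is a third of a full turn.\<close>

definition transfer :: "real \<Rightarrow> real \<Rightarrow> real \<Rightarrow> real" where
  "transfer \<sigma> p q = min p (max 0 (\<sigma> - q))"

definition rot :: "real \<Rightarrow> real \<Rightarrow> real \<Rightarrow> real \<Rightarrow> real" where
  "rot \<sigma> p q s = p - transfer \<sigma> p q + transfer \<sigma> q s"

definition on_circle :: "real \<Rightarrow> real \<Rightarrow> real \<Rightarrow> real \<Rightarrow> bool" where
  "on_circle r p q s \<longleftrightarrow> 0 \<le> p \<and> 0 \<le> q \<and> 0 \<le> s \<and> (p = 0 \<or> q = 0 \<or> s = 0) \<and> p + q + s = r"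

lemma rot_on_circle:
  assumes "on_circle r p q s" "0 \<le> \<sigma>" "\<sigma> \<le> r"
  shows "on_circle r (rot \<sigma> p q s) (rot \<sigma> q s p) (rot \<sigma> s p q)"
  using assms unfolding on_circle_def rot_def transfer_def min_def max_def
  by (elim conjE disjE) (simp_all split: if_splits)

text \<open>Reversing the cyclic order reverses the sense of the rotation, so \<open>rot\<close>
  with its last two arguments exchanged serves as its own inverse.\<close>

lemma rot_rot:
  assumes "on_circle r p q s" "0 \<le> \<sigma>" "\<sigma> \<le> r"
  shows "rot \<sigma> (rot \<sigma> p q s) (rot \<sigma> s p q) (rot \<sigma> q s p) = p"
  using assms unfolding on_circle_def rot_def transfer_def min_def max_def
  by (elim conjE disjE) (auto split: if_splits)

lemma on_circle_cycle: "on_circle r p q s \<Longrightarrow> on_circle r q s p"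
  by (auto simp: on_circle_def)

lemma on_circle_swap: "on_circle r p q s \<Longrightarrow> on_circle r p s q"
  by (auto simp: on_circle_def)

lemma rot_inj:
  assumes "on_circle r p q s" "on_circle r p' q' s'" "0 \<le> \<sigma>" "\<sigma> \<le> r"
    and "rot \<sigma> p q s = rot \<sigma> p' q' s'" "rot \<sigma> q s p = rot \<sigma> q' s' p'" "rot \<sigma> s p q = rot \<sigma> s' p' q'"
  shows "p = p' \<and> q = q' \<and> s = s'"
  using rot_rot[OF assms(1,3,4)] rot_rot[OF assms(2-4)]
    rot_rot[OF on_circle_cycle[OF assms(1)] assms(3,4)] rot_rot[OF on_circle_cycle[OF assms(2)] assms(3,4)]
    rot_rot[OF on_circle_cycle[OF on_circle_cycle[OF assms(1)]] assms(3,4)]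
    rot_rot[OF on_circle_cycle[OF on_circle_cycle[OF assms(2)]] assms(3,4)] assms(5-7)
  by metis

lemma rot_0: "0 \<le> p \<Longrightarrow> 0 \<le> q \<Longrightarrow> 0 \<le> s \<Longrightarrow> rot 0 p q s = p"
  by (simp add: rot_def transfer_def)

lemma rot_full: "on_circle r p q s \<Longrightarrow> rot r p q s = q"
  by (auto simp: on_circle_def rot_def transfer_def)

text \<open>With \<open>r = p + q + s\<close> the triples \<open>(min r (2 p), min r (2 q), min r (2 s))\<close> make up the three coordinate
  squares of side 1 instead of the triangles \<open>p + q + s \<le> 1\<close>.\<close>

lemma max_doubled:
  "on_circle r p q s \<Longrightarrow> max (min r (2 * p)) (max (min r (2 * q)) (min r (2 * s))) = r"
  unfolding on_circle_def by (auto simp: min_def max_def)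

text \<open>At most two entries are nonzero, and the halved expression is the smaller of them.
  Subtracting it undoes the doubling, and \<open>max 0\<close> restores the zero entry.\<close>

lemma doubled_recover:
  "on_circle r p q s \<Longrightarrow> p = max 0 (min r (2 * p) - (min r (2 * p) + min r (2 * q) + min r (2 * s) - r) / 2)"
  unfolding on_circle_def by (elim conjE disjE) (auto simp: min_def max_def field_simps)

lemma doubled_surj:
  assumes "0 \<le> a" "0 \<le> b" "0 \<le> c" "a = 0 \<or> b = 0 \<or> c = 0"
  shows "\<exists>p q s. on_circle (max a (max b c)) p q s \<and> min (max a (max b c)) (2 * p) = a
     \<and> min (max a (max b c)) (2 * q) = b \<and> min (max a (max b c)) (2 * s) = c"
proof -
  define r where "r = max a (max b c)"
  \<comment> \<open>The inverse found in \<open>doubled_recover\<close>.\<close>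
  define h where "h x = max 0 (x - (a + b + c - r) / 2)" for x
  have "on_circle r (h a) (h b) (h c) \<and> min r (2 * h a) = a \<and> min r (2 * h b) = b \<and> min r (2 * h c) = c"
    using assms unfolding on_circle_def h_def r_def
    by (elim disjE) (auto simp: min_def max_def field_simps)
  then show ?thesis unfolding r_def by blast
qed

text \<open>The two sides of the double triangle become the three faces of the cube at the corner
  (1, 1, 1) and the three at (-1, -1, -1). The center \<open>r = 0\<close> goes to that corner, and
  the rim \<open>r = 1\<close>, where both formulas agree, to the hexagon of edges between the two
  halves.\<close>

definition corner_coord :: "nat \<Rightarrow> real \<Rightarrow> real \<Rightarrow> real" where
  "corner_coord \<delta> r p = (if \<delta> = 0 then 1 - 2 * min r (2 * p) else 2 * (r - min r (2 * p)) - 1)"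

text \<open>On equal sides an entry equal to the radius, or a zero entry, recovers the radius. On
  different sides a zero entry of one triple and a maximal entry of the other force both radii to be
  1, which is the rim.\<close>

lemma corner_eq_aux:
  fixes a b c r :: real
  assumes "0 \<le> a" "0 \<le> b" "0 \<le> c" "a \<le> r" "b \<le> r" "c \<le> r"
    and z: "a = 0 \<or> b = 0 \<or> c = 0" and at: "r = a \<or> r = b \<or> r = c"
    and "0 \<le> a'" "0 \<le> b'" "0 \<le> c'" "a' \<le> r'" "b' \<le> r'" "c' \<le> r'"
    and z': "a' = 0 \<or> b' = 0 \<or> c' = 0" and at': "r' = a' \<or> r' = b' \<or> r' = c'"
    and "r \<le> 1" "r' \<le> 1"
    and eq: "(if D then 1 - 2 * a else 2 * (r - a) - 1) = (if D' then 1 - 2 * a' else 2 * (r' - a') - 1)"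
      "(if D then 1 - 2 * b else 2 * (r - b) - 1) = (if D' then 1 - 2 * b' else 2 * (r' - b') - 1)"
      "(if D then 1 - 2 * c else 2 * (r - c) - 1) = (if D' then 1 - 2 * c' else 2 * (r' - c') - 1)"
  shows "a = a' \<and> b = b' \<and> c = c' \<and> r = r' \<and> (D = D' \<or> r = 1)"
proof -
  consider "D" "D'" | "\<not> D" "\<not> D'" | "D" "\<not> D'" | "\<not> D" "D'" by blast
  then show ?thesis
  proof cases
    case 1
    then have "a = a'" "b = b'" "c = c'" using eq by simp_all
    moreover from at have "r \<le> r'" by (elim disjE) (use assms calculation in linarith)+
    moreover from at' have "r' \<le> r" by (elim disjE) (use assms calculation in linarith)+
    ultimately show ?thesis using 1 by simp
  next
    case 2
    then have e: "r - a = r' - a'" "r - b = r' - b'" "r - c = r' - c'" using eq by simp_all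
    from z have "r \<le> r'" by (elim disjE) (use e assms in linarith)+
    moreover from z' have "r' \<le> r" by (elim disjE) (use e assms in linarith)+
    ultimately show ?thesis using 2 e by auto
  next
    case 3
    then have e: "1 - a = r' - a'" "1 - b = r' - b'" "1 - c = r' - c'" using eq by simp_all
    from z have "1 \<le> r'" by (elim disjE) (use e assms in linarith)+
    moreover from at' have "1 \<le> r" by (elim disjE) (use e assms in linarith)+
    ultimately show ?thesis using assms e by auto
  next
    case 4
    then have e: "1 - a' = r - a" "1 - b' = r - b" "1 - c' = r - c" using eq by simp_all
    from z' have "1 \<le> r" by (elim disjE) (use e assms in linarith)+
    moreover from at have "1 \<le> r'" by (elim disjE) (use e assms in linarith)+
    ultimately show ?thesis using assms e by auto
  qed
qed

lemma doubled_range: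
  assumes "on_circle r p q s"
  shows "0 \<le> min r (2 * p)" "min r (2 * p) \<le> r"
    "min r (2 * p) = 0 \<or> min r (2 * q) = 0 \<or> min r (2 * s) = 0"
    "r = min r (2 * p) \<or> r = min r (2 * q) \<or> r = min r (2 * s)"
proof -
  show "r = min r (2 * p) \<or> r = min r (2 * q) \<or> r = min r (2 * s)"
    using max_doubled[OF assms] by (metis max_def)
qed (use assms in \<open>auto simp: on_circle_def\<close>)

lemma corner_coord_inj_aux:
  assumes c: "on_circle r p q s" "on_circle r' p' q' s'" and r: "r \<le> 1" "r' \<le> 1"
    and eq: "corner_coord \<delta> r p = corner_coord \<delta>' r' p'" "corner_coord \<delta> r q = corner_coord \<delta>' r' q'"
      "corner_coord \<delta> r s = corner_coord \<delta>' r' s'"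
  shows "min r (2 * p) = min r' (2 * p') \<and> min r (2 * q) = min r' (2 * q') \<and> min r (2 * s) = min r' (2 * s')
    \<and> r = r' \<and> ((\<delta> = 0) = (\<delta>' = 0) \<or> r = 1)"
  by (rule corner_eq_aux)
    (rule doubled_range[OF c(1)] doubled_range[OF on_circle_cycle[OF c(1)]]
      doubled_range[OF on_circle_cycle[OF on_circle_cycle[OF c(1)]]]
      doubled_range[OF c(2)] doubled_range[OF on_circle_cycle[OF c(2)]]
      doubled_range[OF on_circle_cycle[OF on_circle_cycle[OF c(2)]]] r eq[unfolded corner_coord_def])+

lemma corner_coord_inj:
  assumes c: "on_circle r p q s" "on_circle r' p' q' s'" and r: "r \<le> 1" "r' \<le> 1"
    and eq: "corner_coord \<delta> r p = corner_coord \<delta>' r' p'" "corner_coord \<delta> r q = corner_coord \<delta>' r' q'"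
      "corner_coord \<delta> r s = corner_coord \<delta>' r' s'"
  shows "r = r' \<and> p = p' \<and> q = q' \<and> s = s' \<and> ((\<delta> = 0) = (\<delta>' = 0) \<or> r = 1)"
proof -
  note aux = corner_coord_inj_aux[OF assms]
  have "p = p'" using doubled_recover[OF c(1)] doubled_recover[OF c(2)] aux by (metis (no_types, lifting))
  moreover have "q = q'"
    using doubled_recover[OF on_circle_cycle[OF c(1)]] doubled_recover[OF on_circle_cycle[OF c(2)]] aux by (metis (no_types, lifting))
  moreover have "s = s'"
    using doubled_recover[OF on_circle_cycle[OF on_circle_cycle[OF c(1)]]]
      doubled_recover[OF on_circle_cycle[OF on_circle_cycle[OF c(2)]]] aux by (metis (no_types, lifting))
  ultimately show ?thesis using aux by blast
qed

section \<open>The sphere as a double triangle with a rotation parameter\<close>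

lemma exhaust_all_3: "(\<forall>i::3. P i) \<longleftrightarrow> P 1 \<and> P 2 \<and> P 3" "(\<exists>i::3. P i) \<longleftrightarrow> P 1 \<or> P 2 \<or> P 3"
  by (metis exhaust_3)+

lemma vector_3_eq_iff: "(vector [a, b, c] :: real^3) = vector [a', b', c'] \<longleftrightarrow> a = a' \<and> b = b' \<and> c = c'"
  unfolding vec_eq_iff exhaust_all_3(1) by simp

text \<open>The triangle is divided into concentric triangles of size \<open>r\<close>, each rotated
  by \<open>\<sigma>\<close>. The clamped value of \<open>\<sigma>\<close> runs from 0 at
  \<open>\<tau> = 0\<close> to \<open>r\<close>, a third of a turn, at \<open>\<tau> = 1\<close>;
  the simpler choice \<open>\<tau> * r\<close> would not be piecewise affine in both
  variables.\<close>

definition sphere_pt :: "nat \<Rightarrow> real \<Rightarrow> real \<Rightarrow> real \<Rightarrow> real \<Rightarrow> real^3" where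
  "sphere_pt \<delta> \<tau> x y z = (let m = min x (min y z); r = 1 - 3 * m; \<sigma> = max 0 (min r ((2 * \<tau> - 1 + r) / 2)) in
     vector [corner_coord \<delta> r (rot \<sigma> (x - m) (y - m) (z - m)),
             corner_coord \<delta> r (rot \<sigma> (y - m) (z - m) (x - m)),
             corner_coord \<delta> r (rot \<sigma> (z - m) (x - m) (y - m))])"

definition bary :: "real \<Rightarrow> real \<Rightarrow> real \<Rightarrow> bool" where
  "bary x y z \<longleftrightarrow> 0 \<le> x \<and> 0 \<le> y \<and> 0 \<le> z \<and> x + y + z = 1"

lemma bary_on_circle:
  assumes "bary x y z" "m = min x (min y z)"
  shows "on_circle (1 - 3 * m) (x - m) (y - m) (z - m)" "1 - 3 * m \<le> 1" "0 \<le> 1 - 3 * m" "0 \<le> m"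
  using assms by (auto simp: bary_def on_circle_def min_def)

lemma sphere_pt_inj:
  assumes b: "bary x y z" "bary x' y' z'" and eq: "sphere_pt \<delta> \<tau> x y z = sphere_pt \<delta>' \<tau> x' y' z'"
  shows "x = x' \<and> y = y' \<and> z = z' \<and> ((\<delta> = 0) = (\<delta>' = 0) \<or> x = 0 \<or> y = 0 \<or> z = 0)"
proof -
  define m where "m = min x (min y z)"
  define m' where "m' = min x' (min y' z')"
  define s where "s r = max 0 (min r ((2 * \<tau> - 1 + r) / 2))" for r
  note c = bary_on_circle[OF b(1) m_def] and c' = bary_on_circle[OF b(2) m'_def]
  have s: "0 \<le> s r" "s r \<le> r" if "0 \<le> r" for r using that by (auto simp: s_def)
  have e: "corner_coord \<delta> (1 - 3 * m) (rot (s (1 - 3 * m)) (x - m) (y - m) (z - m)) =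
      corner_coord \<delta>' (1 - 3 * m') (rot (s (1 - 3 * m')) (x' - m') (y' - m') (z' - m'))"
    "corner_coord \<delta> (1 - 3 * m) (rot (s (1 - 3 * m)) (y - m) (z - m) (x - m)) =
      corner_coord \<delta>' (1 - 3 * m') (rot (s (1 - 3 * m')) (y' - m') (z' - m') (x' - m'))"
    "corner_coord \<delta> (1 - 3 * m) (rot (s (1 - 3 * m)) (z - m) (x - m) (y - m)) =
      corner_coord \<delta>' (1 - 3 * m') (rot (s (1 - 3 * m')) (z' - m') (x' - m') (y' - m'))"
    using eq unfolding sphere_pt_def Let_def m_def[symmetric] m'_def[symmetric] s_def[symmetric] vector_3_eq_iff
    by - (elim conjE, assumption)+
  note i = corner_coord_inj[OF rot_on_circle[OF c(1) s[OF c(3)]] rot_on_circle[OF c'(1) s[OF c'(3)]] c(2) c'(2) e]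
  then have mm: "m = m'" by simp
  have "x - m = x' - m' \<and> y - m = y' - m' \<and> z - m = z' - m'"
    by (rule rot_inj[OF c(1) _ s[OF c(3)]]) (use c'(1) i mm in simp_all)
  then show ?thesis using mm i by (auto simp: m_def min_def split: if_splits)
qed

lemma sphere_pt_flip:
  assumes "bary x y z" "x = 0 \<or> y = 0 \<or> z = 0"
  shows "sphere_pt \<delta> \<tau> x y z = sphere_pt \<delta>' \<tau> x y z"
proof -
  have "min x (min y z) = 0" using assms by (auto simp: bary_def)
  then show ?thesis by (simp add: sphere_pt_def Let_def corner_coord_def)
qed

text \<open>At \<open>\<tau> = 1\<close> every concentric triangle has made exactly a third of a
  turn. This is what makes \<open>cover_pt\<close> continuous where its parameter
  \<open>frac a\<close> jumps from 1 to 0.\<close>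

lemma sphere_pt_step:
  assumes "bary x y z" shows "sphere_pt \<delta> 1 x y z = sphere_pt \<delta> 0 y z x"
proof -
  define m where "m = min x (min y z)"
  have m': "min y (min z x) = m" by (simp add: m_def min.commute min.left_commute)
  note c = bary_on_circle[OF assms m_def]
  have 1: "max 0 (min (1 - 3 * m) ((2 * 1 - 1 + (1 - 3 * m)) / 2)) = 1 - 3 * m"
    "max 0 (min (1 - 3 * m) ((2 * 0 - 1 + (1 - 3 * m)) / 2)) = 0" using c(2-4) by auto
  show ?thesis
    unfolding sphere_pt_def Let_def m' m_def[symmetric] 1
    using c(1) rot_full[OF c(1)] rot_full[OF on_circle_cycle[OF c(1)]] rot_full[OF on_circle_cycle[OF on_circle_cycle[OF c(1)]]]
    by (simp add: on_circle_def rot_0)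
qed

lemma corner_coord_range:
  assumes "on_circle r p q s" "r \<le> 1"
  shows "\<bar>corner_coord \<delta> r p\<bar> \<le> 1" "\<bar>corner_coord \<delta> r p\<bar> = 1 \<or> \<bar>corner_coord \<delta> r q\<bar> = 1 \<or> \<bar>corner_coord \<delta> r s\<bar> = 1"
proof -
  show "\<bar>corner_coord \<delta> r p\<bar> \<le> 1"
    using assms unfolding corner_coord_def on_circle_def abs_le_iff min_def by auto
  show "\<bar>corner_coord \<delta> r p\<bar> = 1 \<or> \<bar>corner_coord \<delta> r q\<bar> = 1 \<or> \<bar>corner_coord \<delta> r s\<bar> = 1"
  proof (cases "\<delta> = 0")
    case True
    then show ?thesis using assms by (auto simp: corner_coord_def on_circle_def)
  next
    case False
    have "min r (2 * p) = r \<or> min r (2 * q) = r \<or> min r (2 * s) = r"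
      using max_doubled[OF assms(1)] by (metis max_def)
    then show ?thesis using False by (auto simp: corner_coord_def)
  qed
qed

lemma sphere_pt_range:
  assumes "bary x y z" shows "sphere_pt \<delta> \<tau> x y z \<in> frontier (cbox (- 1) 1)"
proof -
  define m where "m = min x (min y z)"
  define \<sigma> where "\<sigma> = max 0 (min (1 - 3 * m) ((2 * \<tau> - 1 + (1 - 3 * m)) / 2))"
  note c = bary_on_circle[OF assms m_def]
  have "0 \<le> \<sigma>" "\<sigma> \<le> 1 - 3 * m" using c(3) by (auto simp: \<sigma>_def)
  note d = rot_on_circle[OF c(1) this]
  show ?thesis
    unfolding mem_frontier_cube exhaust_all_3 sphere_pt_def Let_def m_def[symmetric] \<sigma>_def[symmetric] vector_3
    using corner_coord_range[OF d c(2)] corner_coord_range(1)[OF on_circle_cycle[OF d] c(2)]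
      corner_coord_range(1)[OF on_circle_cycle[OF on_circle_cycle[OF d]] c(2)]
    by blast
qed

lemma sphere_pt_surj:
  assumes "Y \<in> frontier (cbox (- 1) (1 :: real^3))"
  shows "\<exists>\<delta> x y z. \<delta> < 2 \<and> bary x y z \<and> sphere_pt \<delta> \<tau> x y z = Y"
proof -
  have bd: "\<bar>Y $ 1\<bar> \<le> 1" "\<bar>Y $ 2\<bar> \<le> 1" "\<bar>Y $ 3\<bar> \<le> 1" "\<bar>Y $ 1\<bar> = 1 \<or> \<bar>Y $ 2\<bar> = 1 \<or> \<bar>Y $ 3\<bar> = 1"
    using assms unfolding mem_frontier_cube exhaust_all_3 by auto
  have "\<exists>\<delta><2. \<exists>r p q s. on_circle r p q s \<and> r \<le> 1 \<and> corner_coord \<delta> r p = Y $ 1 \<and> corner_coord \<delta> r q = Y $ 2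
     \<and> corner_coord \<delta> r s = Y $ 3"
  proof (cases "Y $ 1 = 1 \<or> Y $ 2 = 1 \<or> Y $ 3 = 1")
    \<comment> \<open>\<open>Y\<close> lies on a face at the corner (1, 1, 1), where the doubled
      entries are read off directly.\<close>
    case True
    let ?a = "(1 - Y $ 1) / 2" and ?b = "(1 - Y $ 2) / 2" and ?c = "(1 - Y $ 3) / 2"
    define r where "r = max ?a (max ?b ?c)"
    have "0 \<le> ?a" "0 \<le> ?b" "0 \<le> ?c" "?a = 0 \<or> ?b = 0 \<or> ?c = 0" using True bd by auto
    from doubled_surj[OF this, folded r_def]
    obtain p q s where c: "on_circle r p q s" "min r (2 * p) = ?a" "min r (2 * q) = ?b" "min r (2 * s) = ?c" by blast
    have "corner_coord 0 r p = Y $ 1" "corner_coord 0 r q = Y $ 2" "corner_coord 0 r s = Y $ 3"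
      unfolding corner_coord_def c(2-4) by (simp_all add: field_simps)
    moreover have "r \<le> 1" using bd by (auto simp: r_def)
    ultimately show ?thesis using c(1) by (meson zero_less_numeral)
  next
    case False
    \<comment> \<open>On the other half a zero entry belongs to the largest coordinate, which is
      \<open>2 * r - 1\<close>; this determines \<open>r\<close>.\<close>
    define r where "r = (max (Y $ 1) (max (Y $ 2) (Y $ 3)) + 1) / 2"
    let ?a = "r - (Y $ 1 + 1) / 2" and ?b = "r - (Y $ 2 + 1) / 2" and ?c = "r - (Y $ 3 + 1) / 2"
    have "Y $ 1 = -1 \<or> Y $ 2 = -1 \<or> Y $ 3 = -1" using bd False by auto
    then have mr: "max ?a (max ?b ?c) = r" using bd unfolding r_def by (auto simp: max_def field_simps)
    have "0 \<le> ?a" "0 \<le> ?b" "0 \<le> ?c" "?a = 0 \<or> ?b = 0 \<or> ?c = 0" by (auto simp: r_def max_def field_simps)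
    from doubled_surj[OF this, unfolded mr]
    obtain p q s where c: "on_circle r p q s" "min r (2 * p) = ?a" "min r (2 * q) = ?b" "min r (2 * s) = ?c" by blast
    have "corner_coord 1 r p = Y $ 1" "corner_coord 1 r q = Y $ 2" "corner_coord 1 r s = Y $ 3"
      unfolding corner_coord_def c(2-4) by (simp_all add: field_simps)
    moreover have "r \<le> 1" using bd by (auto simp: r_def)
    ultimately show ?thesis using c(1) by (meson one_less_numeral_iff semiring_norm(76))
  qed
  then obtain \<delta> r p q s where d: "\<delta> < 2" "on_circle r p q s" "r \<le> 1" "corner_coord \<delta> r p = Y $ 1" "corner_coord \<delta> r q = Y $ 2"
     "corner_coord \<delta> r s = Y $ 3" by blast
  define \<sigma> where "\<sigma> = max 0 (min r ((2 * \<tau> - 1 + r) / 2))"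
  have r0: "0 \<le> r" using d(2) by (auto simp: on_circle_def)
  then have \<sigma>: "0 \<le> \<sigma>" "\<sigma> \<le> r" by (auto simp: \<sigma>_def)
  \<comment> \<open>The preimage under the rotation, in the reversed order of
    \<open>rot_rot\<close>.\<close>
  define p' where "p' = rot \<sigma> p s q"
  define q' where "q' = rot \<sigma> q p s"
  define s' where "s' = rot \<sigma> s q p"
  have c': "on_circle r p' q' s'"
    using rot_on_circle[OF on_circle_swap[OF d(2)] \<sigma>] on_circle_swap unfolding p'_def q'_def s'_def by blast
  have rb: "rot \<sigma> p' q' s' = p" "rot \<sigma> q' s' p' = q" "rot \<sigma> s' p' q' = s"
    unfolding p'_def q'_def s'_def
    using rot_rot[OF on_circle_swap[OF d(2)] \<sigma>] rot_rot[OF on_circle_swap[OF on_circle_cycle[OF d(2)]] \<sigma>]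
      rot_rot[OF on_circle_swap[OF on_circle_cycle[OF on_circle_cycle[OF d(2)]]] \<sigma>] by blast+
  define m where "m = (1 - r) / 3"
  have b: "bary (p' + m) (q' + m) (s' + m)" using c' d(3) by (auto simp: bary_def on_circle_def m_def field_simps)
  have mm: "min (p' + m) (min (q' + m) (s' + m)) = m" using c' by (auto simp: on_circle_def)
  have rm: "1 - 3 * m = r" by (simp add: m_def field_simps)
  have "sphere_pt \<delta> \<tau> (p' + m) (q' + m) (s' + m) = Y"
    unfolding sphere_pt_def mm Let_def rm \<sigma>_def[symmetric]
    by (simp add: rb d vec_eq_iff exhaust_all_3(1))
  then show ?thesis using b d(1) by blast
qed

text \<open>The square is traversed at constant speed from the point (1, 0), with corners at the odd
  multiples of 1/8. Clamped affine functions express this through \<open>min\<close> and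
  \<open>max\<close>.\<close>

definition circle_pt :: "real \<Rightarrow> real^2" where
  "circle_pt u = vector [max (- 1) (min 1 (2 - 8 * min u (1 - u))), max (- 1) (min 1 (max (min (8 * u) (4 - 8 * u)) (8 * u - 8)))]"

lemma circle_pt_0_1: "circle_pt 1 = circle_pt 0"
  by (simp add: circle_pt_def)

lemma circle_pt_inj:
  assumes "0 \<le> u" "u < 1" "0 \<le> v" "v < 1" "circle_pt u = circle_pt v" shows "u = v"
proof -
  \<comment> \<open>The parameter read off edge by edge. The edge with first coordinate 1 is split,
    because the loop starts and ends in its middle.\<close>
  define h :: "real^2 \<Rightarrow> real" where "h p = (if p $ 1 = 1 \<and> p $ 2 \<ge> 0 then p $ 2 / 8 else if p $ 2 = 1 then (2 - p $ 1) / 8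
     else if p $ 1 = - 1 then (4 - p $ 2) / 8 else if p $ 2 = - 1 then (p $ 1 + 6) / 8 else (p $ 2 + 8) / 8)" for p
  have "h (circle_pt u) = u" if "0 \<le> u" "u < 1" for u
  proof -
    consider "u \<le> 1/8" | "1/8 < u" "u \<le> 3/8" | "3/8 < u" "u < 5/8" | "5/8 \<le> u" "u \<le> 7/8" | "7/8 < u" by linarith
    then show ?thesis
      by cases (use that in \<open>auto simp: h_def circle_pt_def min_def max_def\<close>)
  qed
  then show ?thesis using assms by metis
qed

lemma circle_pt_range: "0 \<le> u \<Longrightarrow> u \<le> 1 \<Longrightarrow> circle_pt u \<in> frontier (cbox (- 1) 1)"
  unfolding mem_frontier_cube forall_2 exists_2 by (auto simp: circle_pt_def min_def max_def abs_le_iff)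

lemma circle_pt_surj:
  assumes "p \<in> frontier (cbox (- 1) (1 :: real^2))" shows "\<exists>u. 0 \<le> u \<and> u < 1 \<and> circle_pt u = p"
proof -
  have bd: "\<bar>p $ 1\<bar> \<le> 1" "\<bar>p $ 2\<bar> \<le> 1" "\<bar>p $ 1\<bar> = 1 \<or> \<bar>p $ 2\<bar> = 1"
    using assms unfolding mem_frontier_cube forall_2 exists_2 by auto
  have eq: "circle_pt u = p \<longleftrightarrow> max (- 1) (min 1 (2 - 8 * min u (1 - u))) = p $ 1
     \<and> max (- 1) (min 1 (max (min (8 * u) (4 - 8 * u)) (8 * u - 8))) = p $ 2" for u
    by (simp add: circle_pt_def vec_eq_iff forall_2)
  consider "p $ 1 = 1" "p $ 2 \<ge> 0" | "p $ 2 = 1" | "p $ 1 = - 1" | "p $ 2 = - 1" | "p $ 1 = 1" "p $ 2 < 0" using bd by linarith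
  then show ?thesis
  proof cases
    case 1 then show ?thesis using bd by (intro exI[of _ "p $ 2 / 8"]) (auto simp: eq min_def max_def field_simps)
  next
    case 2 then show ?thesis using bd by (intro exI[of _ "(2 - p $ 1) / 8"]) (auto simp: eq min_def max_def field_simps)
  next
    case 3 then show ?thesis using bd by (intro exI[of _ "(4 - p $ 2) / 8"]) (auto simp: eq min_def max_def field_simps)
  next
    case 4 then show ?thesis using bd by (intro exI[of _ "(p $ 1 + 6) / 8"]) (auto simp: eq min_def max_def field_simps)
  next
    case 5 then show ?thesis using bd by (intro exI[of _ "(p $ 2 + 8) / 8"]) (auto simp: eq min_def max_def field_simps)
  qed
qed

section \<open>Staircase simplices\<close>

text \<open>\<open>stair n k w \<pi> h\<close>: the point of the staircase simplex with the vertices \<open>(l mod n, l)\<close>, \<open>k \<le> l \<le> k + n\<close>,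
  and the weights \<open>w l\<close> has the barycentric coordinates \<open>\<pi>\<close> and the height \<open>h\<close>.\<close>

definition stair :: "int \<Rightarrow> int \<Rightarrow> (int \<Rightarrow> real) \<Rightarrow> (int \<Rightarrow> real) \<Rightarrow> real \<Rightarrow> bool" where
  "stair n k w \<pi> h \<longleftrightarrow> (\<forall>l. w (l + n + 1) = w l) \<and> (\<forall>l. 0 \<le> w l) \<and> (\<forall>m. \<pi> (m + n) = \<pi> m) \<and> (\<forall>m. 0 \<le> \<pi> m)
     \<and> \<pi> k = w k + w (k + n) \<and> (\<forall>m. k < m \<and> m < k + n \<longrightarrow> \<pi> m = w m) \<and> h = (\<Sum>l\<in>{k..k+n}. of_int l * w l)"

text \<open>The projection of the staircase simplex to its base simplex: it adds the weights of the
  vertices over the same corner, which are just those of \<open>k\<close> and \<open>k + n\<close>.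
  The weights have period \<open>n + 1\<close>, so that passing to the next simplex changes the
  window only.\<close>

definition wrap :: "int \<Rightarrow> int \<Rightarrow> (int \<Rightarrow> real) \<Rightarrow> int \<Rightarrow> real" where
  "wrap n k w m = (\<Sum>l\<in>{k..k+n}. if n dvd (l - m) then w l else 0)"

definition height :: "int \<Rightarrow> int \<Rightarrow> (int \<Rightarrow> real) \<Rightarrow> real" where
  "height n k w = (\<Sum>l\<in>{k..k+n}. of_int l * w l)"

lemma periodic_mult:
  fixes p :: "int \<Rightarrow> 'a" assumes "\<And>m. p (m + n) = p m" shows "p (m + n * i) = p m"
proof -
  have nat: "p (m + n * int i) = p m" for m i
    by (induction i) (use assms[of "m + n * int i" for i] in \<open>auto simp: algebra_simps\<close>)
  show ?thesis
  proof (cases "0 \<le> i")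
    case True
    then show ?thesis using nat[of m "nat i"] by simp
  next
    case False
    then show ?thesis using nat[of "m + n * i" "nat (- i)"] by (simp add: algebra_simps)
  qed
qed

lemma periodic_dvd:
  fixes p :: "int \<Rightarrow> 'a" assumes "\<And>m. p (m + n) = p m" "n dvd (l - m)" shows "p l = p m"
proof -
  obtain i where "l - m = n * i" using assms(2) by (elim dvdE)
  then have "l = m + n * i" by simp
  then show ?thesis using periodic_mult[of p n m i] assms(1) by simp
qed

lemma periodic_eqI:
  fixes p q :: "int \<Rightarrow> 'a"
  assumes "n > 0" "\<And>m. p (m + n) = p m" "\<And>m. q (m + n) = q m" "\<And>m. k \<le> m \<Longrightarrow> m < k + n \<Longrightarrow> p m = q m"
  shows "p = q"
proof
  fix m
  let ?m = "k + (m - k) mod n"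
  have "n dvd (m - ?m)" by (metis add_diff_cancel_left' diff_diff_add dvd_minus_mod)
  then have "p m = p ?m" "q m = q ?m" using periodic_dvd[of p n] periodic_dvd[of q n] assms(2,3) by blast+
  moreover have "p ?m = q ?m" using assms(1) by (intro assms(4)) auto
  ultimately show "p m = q m" by simp
qed

lemma stair_wrap:
  assumes n: "n \<ge> 2" and w: "\<And>l. w (l + n + 1) = w l" "\<And>l. 0 \<le> w l"
  shows "stair n k w (wrap n k w) (height n k w)"
  unfolding stair_def
proof (intro conjI allI impI)
  show "wrap n k w (m + n) = wrap n k w m" for m
  proof -
    have "n dvd (l - (m + n)) \<longleftrightarrow> n dvd (l - m)" for l
      by (metis diff_diff_add dvd_diff_right_iff dvd_refl dvd_diff_commute diff_add_eq)
    then show ?thesis by (simp add: wrap_def)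
  qed
  show "0 \<le> wrap n k w m" for m unfolding wrap_def using w(2) by (auto intro!: sum_nonneg)
  have restr: "wrap n k w m = sum w {l \<in> {k..k+n}. n dvd (l - m)}" for m
    unfolding wrap_def by (rule sum.inter_filter[symmetric]) simp
  have "{l \<in> {k..k+n}. n dvd (l - k)} = {k, k + n}"
  proof -
    have "l = k \<or> l = k + n" if l: "k \<le> l" "l \<le> k + n" "n dvd (l - k)" for l
    proof (cases "l = k")
      case False
      then have "n \<le> l - k" using zdvd_imp_le[OF l(3)] l(1) by simp
      then show ?thesis using l(2) by simp
    qed simp
    then show ?thesis using n by auto
  qed
  then show "wrap n k w k = w k + w (k + n)" using n by (simp add: restr)
  fix m assume m: "k < m \<and> m < k + n"
  have "{l \<in> {k..k+n}. n dvd (l - m)} = {m}"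
  proof -
    have "l = m" if "k \<le> l" "l \<le> k + n" "n dvd (l - m)" for l
    proof -
      have "\<bar>l - m\<bar> < n" using that m by auto
      then have "l - m = 0" using that(3) dvd_imp_le_int[of "l - m" n] n by force
      then show ?thesis by simp
    qed
    then show ?thesis using m by auto
  qed
  then show "wrap n k w m = w m" by (simp add: restr)
qed (use w in \<open>auto simp: height_def\<close>)

lemma stair_determines:
  assumes "n \<ge> 2" "stair n k w \<pi> h" shows "\<pi> = wrap n k w" "h = height n k w"
proof -
  have w: "stair n k w (wrap n k w) (height n k w)"
    using assms by (intro stair_wrap) (auto simp: stair_def)
  show "\<pi> = wrap n k w"
  proof (rule periodic_eqI[of n _ _ k])
    show "\<pi> m = wrap n k w m" if "k \<le> m" "m < k + n" for m
      using assms(2) w that unfolding stair_def by (cases "m = k") auto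
  qed (use assms w in \<open>auto simp: stair_def\<close>)
  show "h = height n k w" using assms(2) by (simp add: stair_def height_def)
qed

lemma sum_atLeastAtMost_shift_int:
  fixes f :: "int \<Rightarrow> real" assumes "n \<ge> 0"
  shows "sum f {k+1..k+1+n} = sum f {k..k+n} - f k + f (k + n + 1)"
proof -
  have e: "{k..k+n+1} = insert k {k+1..k+1+n}" "{k..k+n+1} = insert (k+n+1) {k..k+n}" using assms by auto
  have "sum f {k..k+n+1} = f k + sum f {k+1..k+1+n}" unfolding e(1) by simp
  moreover have "sum f {k..k+n+1} = f (k + n + 1) + sum f {k..k+n}" unfolding e(2) by simp
  ultimately show ?thesis by simp
qed

text \<open>By periodicity \<open>w (k + n + 1)\<close> is the same weight as \<open>w k\<close>. If
  it is zero, the vertex that leaves the window and the one that enters carry no mass.\<close>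

lemma stair_step:
  assumes n: "n \<ge> 2" and s: "stair n k w \<pi> h" and w0: "w k = 0" shows "stair n (k + 1) w \<pi> h"
proof -
  have w: "w (k + n + 1) = 0" using s w0 by (simp add: stair_def)
  have "\<pi> (k + 1) = w (k + 1) + w (k + 1 + n)" using s n w by (simp add: stair_def algebra_simps)
  moreover have "\<pi> m = w m" if "k + 1 < m" "m < k + 1 + n" for m
  proof (cases "m = k + n")
    case True
    then show ?thesis using s w0 by (simp add: stair_def)
  next
    case False
    then show ?thesis using s that by (simp add: stair_def)
  qed
  moreover have "h = (\<Sum>l\<in>{k+1..k+1+n}. of_int l * w l)"
    using s n w w0 sum_atLeastAtMost_shift_int[of n "\<lambda>l. of_int l * w l" k] by (simp add: stair_def)
  ultimately show ?thesis using s unfolding stair_def by blast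
qed

text \<open>The height of the staircase at its lower end; on the \<open>k\<close>-th simplex the height runs from
  \<open>stair_base n \<pi> k\<close> to \<open>stair_base n \<pi> (k + 1)\<close>.\<close>

definition stair_base :: "int \<Rightarrow> (int \<Rightarrow> real) \<Rightarrow> int \<Rightarrow> real" where
  "stair_base n \<pi> k = (\<Sum>l\<in>{k..k+(n-1)}. of_int l * \<pi> l)"

lemma stair_base_Suc:
  assumes "n \<ge> 1" "\<And>m. \<pi> (m + n) = \<pi> m"
  shows "stair_base n \<pi> (k + 1) = stair_base n \<pi> k + of_int n * \<pi> k"
  unfolding stair_base_def using assms
  by (subst sum_atLeastAtMost_shift_int) (auto simp: algebra_simps)

text \<open>Moving mass from \<open>k\<close> to \<open>k + n\<close> keeps the point of the base
  and raises the height by \<open>n\<close> per unit of mass.\<close>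

lemma stair_height:
  assumes n: "n \<ge> 2" and s: "stair n k w \<pi> h" shows "h = stair_base n \<pi> k + of_int n * w (k + n)"
proof -
  have "{k..k+n} = insert k (insert (k + n) {k+1..k+(n-1)})" "{k..k+(n-1)} = insert k {k+1..k+(n-1)}" using n by auto
  then have "(\<Sum>l\<in>{k..k+n}. of_int l * w l) = of_int k * w k + (of_int (k + n) * w (k + n) + (\<Sum>l\<in>{k+1..k+(n-1)}. of_int l * w l))"
    "stair_base n \<pi> k = of_int k * \<pi> k + (\<Sum>l\<in>{k+1..k+(n-1)}. of_int l * \<pi> l)"
    using n by (simp_all add: stair_base_def)
  moreover have "(\<Sum>l\<in>{k+1..k+(n-1)}. of_int l * \<pi> l) = (\<Sum>l\<in>{k+1..k+(n-1)}. of_int l * w l)"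
    using s by (intro sum.cong) (auto simp: stair_def)
  moreover have "\<pi> k = w k + w (k + n)" "h = (\<Sum>l\<in>{k..k+n}. of_int l * w l)" using s by (simp_all add: stair_def)
  ultimately show ?thesis by (simp add: algebra_simps)
qed

lemma stair_base_mono:
  assumes "n \<ge> 1" "\<And>m. \<pi> (m + n) = \<pi> m" "\<And>m. 0 \<le> \<pi> m" "k \<le> k'"
  shows "stair_base n \<pi> k \<le> stair_base n \<pi> k'"
  using assms(4)
proof (induction k' rule: int_ge_induct)
  case (step i)
  then show ?case using stair_base_Suc[of n \<pi> i] assms by (smt (verit) mult_nonneg_nonneg of_int_nonneg)
qed simp

text \<open>If \<open>k < k'\<close>, then \<open>h\<close> is at most the top of the
  \<open>k\<close>-th simplex over the base point, which is at most the bottom of the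
  \<open>k'\<close>-th, which is at most \<open>h\<close>. Equality means \<open>w k = 0\<close>, so
  the point also belongs to the simplex \<open>k + 1\<close>.\<close>

lemma stair_unique:
  assumes n: "n \<ge> 2" and "k \<le> k'" and s: "stair n k w \<pi> h" and s': "stair n k' w' \<pi> h"
  shows "w = w' \<and> (\<forall>i. k \<le> i \<and> i < k' \<longrightarrow> w i = 0)"
  using assms(2) s
proof (induction "nat (k' - k)" arbitrary: k)
  case 0
  then have k: "k' = k" by simp
  have "w (k + n) = w' (k + n)"
    using stair_height[OF n 0(3)] stair_height[OF n s'] n k by simp
  then have "w m = w' m" if "k \<le> m" "m < k + (n + 1)" for m
    using 0(3) s' k that unfolding stair_def by (cases "m = k"; cases "m = k + n"; force)
  then have "w = w'"
    using n 0(3) s' by (intro periodic_eqI[of "n + 1" _ _ k]) (auto simp: stair_def add.assoc)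
  then show ?case using k by auto
next
  case (Suc d)
  then have k: "k + 1 \<le> k'" "d = nat (k' - (k + 1))" by auto
  note st = Suc.prems(2)
  have per: "\<And>m. \<pi> (m + n) = \<pi> m" "\<And>m. 0 \<le> \<pi> m" using st by (auto simp: stair_def)
  have "h = stair_base n \<pi> (k + 1) - of_int n * w k"
    using stair_height[OF n st] stair_base_Suc[of n \<pi> k] per n st by (simp add: stair_def algebra_simps)
  moreover have "stair_base n \<pi> (k + 1) \<le> stair_base n \<pi> k'"
    using n per k(1) by (intro stair_base_mono) auto
  moreover have "stair_base n \<pi> k' \<le> h"
  proof -
    have "0 \<le> of_int n * w' (k' + n)" using n s' by (simp add: stair_def)
    then show ?thesis using stair_height[OF n s'] by linarith
  qed
  ultimately have "of_int n * w k \<le> 0" by simp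
  moreover have "0 \<le> w k" using st by (simp add: stair_def)
  ultimately have w0: "w k = 0" using n by (simp add: mult_le_0_iff)
  have "w = w' \<and> (\<forall>i. k + 1 \<le> i \<and> i < k' \<longrightarrow> w i = 0)"
    by (rule Suc.hyps(1)[OF k(2,1) stair_step[OF n st w0]])
  moreover have "i = k \<or> k + 1 \<le> i" if "k \<le> i" for i using that by auto
  ultimately show ?case using w0 by blast
qed

text \<open>\<open>stair_base\<close> increases by \<open>n\<close> over every period, so it passes
  from below \<open>h\<close> to above \<open>h\<close>, and one of its steps contains
  \<open>h\<close>.\<close>

lemma stair_exists:
  assumes n: "n \<ge> 2" and per: "\<And>m. \<pi> (m + n) = \<pi> m" and nn: "\<And>m. 0 \<le> \<pi> m"
    and one: "\<And>k. (\<Sum>l\<in>{k..k+(n-1)}. \<pi> l) = 1"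
  shows "\<exists>k w. stair n k w \<pi> h"
proof -
  have shift: "stair_base n \<pi> (k + n) = stair_base n \<pi> k + of_int n" for k
  proof -
    have "stair_base n \<pi> (k + n) = (\<Sum>l\<in>{k..k+(n-1)}. of_int (l + n) * \<pi> (l + n))"
      unfolding stair_base_def
      by (rule sum.reindex_bij_witness[of _ "\<lambda>l. l + n" "\<lambda>l. l - n"]) auto
    also have "\<dots> = (\<Sum>l\<in>{k..k+(n-1)}. of_int l * \<pi> l) + of_int n * (\<Sum>l\<in>{k..k+(n-1)}. \<pi> l)"
      by (simp add: per sum.distrib[symmetric] sum_distrib_left algebra_simps)
    finally show ?thesis using one by (simp add: stair_base_def)
  qed
  have shift_nat: "stair_base n \<pi> (k + n * int i) = stair_base n \<pi> k + of_int n * real i" for k i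
  proof (induction i)
    case (Suc i)
    then show ?case using shift[of "k + n * int i"] by (simp add: algebra_simps)
  qed simp
  define i where "i = nat \<lceil>\<bar>h - stair_base n \<pi> 0\<bar>\<rceil>"
  have i: "\<bar>h - stair_base n \<pi> 0\<bar> \<le> real i" unfolding i_def by linarith
  have ni: "real i \<le> of_int n * real i" using n by (simp add: mult_le_cancel_right1)
  define lo where "lo = - n * int i"
  have lo: "stair_base n \<pi> lo \<le> h"
    using shift_nat[of lo i] i ni by (simp add: lo_def)
  have hi: "h < stair_base n \<pi> (n * int (Suc i))"
    using shift_nat[of 0 "Suc i"] i ni n by (simp add: algebra_simps)
  have "\<exists>k. stair_base n \<pi> k \<le> h \<and> h \<le> stair_base n \<pi> (k + 1)"
  proof (rule ccontr)
    assume neg: "\<not> ?thesis"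
    have "stair_base n \<pi> (lo + int j) \<le> h" for j
    proof (induction j)
      case (Suc j)
      then have "\<not> h \<le> stair_base n \<pi> (lo + int j + 1)" using neg by blast
      then show ?case by (simp add: algebra_simps)
    qed (simp add: lo)
    from this[of "nat (n * int (Suc i) - lo)"] hi show False
      using n by (simp add: lo_def algebra_simps)
  qed
  then obtain k where k: "stair_base n \<pi> k \<le> h" "h \<le> stair_base n \<pi> k + of_int n * \<pi> k"
    using stair_base_Suc[of n \<pi>] per n by auto
  \<comment> \<open>The weight of the top vertex \<open>k + n\<close>, as dictated by
    \<open>stair_height\<close>.\<close>
  define a where "a = (h - stair_base n \<pi> k) / of_int n"
  have a: "0 \<le> a" "a \<le> \<pi> k" using k n by (auto simp: a_def field_simps)
  define w where "w l = (let r = (l - k) mod (n + 1) in if r = n then a else if r = 0 then \<pi> k - a else \<pi> (k + r))" for l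
  have wk: "w k = \<pi> k - a" using n by (simp add: w_def)
  have wkn: "w (k + n) = a" using n by (simp add: w_def mod_pos_pos_trivial)
  have wm: "w m = \<pi> m" if "k < m" "m < k + n" for m using n that by (simp add: w_def mod_pos_pos_trivial)
  have wper: "w (l + n + 1) = w l" for l
  proof -
    have "(l + n + 1 - k) mod (n + 1) = (l - k) mod (n + 1)"
      by (metis add.assoc add.commute add_diff_eq mod_add_self2 diff_add_eq)
    then show ?thesis by (simp add: w_def)
  qed
  have wnn: "0 \<le> w l" for l using a nn by (simp add: w_def Let_def)
  have pieq: "wrap n k w = \<pi>"
  proof (rule periodic_eqI[of n _ _ k])
    have "stair n k w (wrap n k w) (height n k w)" using n wper wnn by (rule stair_wrap)
    then show "wrap n k w m = \<pi> m" if "k \<le> m" "m < k + n" for m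
      using that wk wkn wm unfolding stair_def by (cases "m = k") auto
    show "wrap n k w (m + n) = wrap n k w m" for m
      using \<open>stair n k w (wrap n k w) (height n k w)\<close> by (simp add: stair_def)
  qed (use n per in auto)
  have st: "stair n k w \<pi> (height n k w)" using stair_wrap[of n w k] n wper wnn by (simp add: pieq)
  moreover have "height n k w = h" using stair_height[OF n st] n wkn by (simp add: a_def)
  ultimately show ?thesis by blast
qed

lemma wrap_shift:
  assumes "\<And>l. w' (l + d) = w l" "n dvd (d - e)"
  shows "wrap n (k + d) w' (m + e) = wrap n k w m"
proof -
  have "n dvd (l + d - (m + e)) \<longleftrightarrow> n dvd (l - m)" for l
  proof -
    have "l + d - (m + e) = (l - m) + (d - e)" by simp
    then show ?thesis using assms(2) by (metis dvd_add_left_iff)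
  qed
  then have "wrap n k w m = (\<Sum>l\<in>{k..k+n}. if n dvd (l + d - (m + e)) then w' (l + d) else 0)"
    unfolding wrap_def assms(1) by simp
  also have "\<dots> = wrap n (k + d) w' (m + e)"
    unfolding wrap_def by (rule sum.reindex_bij_witness[of _ "\<lambda>l. l - d" "\<lambda>l. l + d"]) auto
  finally show ?thesis by simp
qed

lemma height_shift:
  assumes "\<And>l. w' (l + d) = w l"
  shows "height n (k + d) w' = height n k w + of_int d * sum w {k..k+n}"
proof -
  have "height n (k + d) w' = (\<Sum>l\<in>{k..k+n}. of_int (l + d) * w' (l + d))"
    unfolding height_def by (rule sum.reindex_bij_witness[of _ "\<lambda>l. l + d" "\<lambda>l. l - d"]) auto
  then show ?thesis unfolding height_def assms
    by (simp add: sum.distrib[symmetric] sum_distrib_left algebra_simps)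
qed

section \<open>The map from the universal cover\<close>

lemma periodic_sum_const:
  fixes p :: "int \<Rightarrow> real"
  assumes "n \<ge> 1" "\<And>m. p (m + n) = p m"
  shows "sum p {k..k+(n-1)} = sum p {k'..k'+(n-1)}"
proof -
  have step: "sum p {m+1..m+1+(n-1)} = sum p {m..m+(n-1)}" for m
    using sum_atLeastAtMost_shift_int[of "n - 1" p m] assms by simp
  have "sum p {m..m+(n-1)} = sum p {0..0+(n-1)}" for m
  proof (induction m rule: int_induct[of _ 0])
    case (step1 i)
    then show ?case using step[of i] by simp
  next
    case (step2 i)
    then show ?case using step[of "i - 1"] by simp
  qed simp
  then show ?thesis by metis
qed

lemma stair_total:
  assumes n: "n \<ge> 2" and s: "stair n k w \<pi> h" shows "sum w {k..k+n} = sum \<pi> {k..k+(n-1)}"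
proof -
  have e: "{k..k+n} = insert k (insert (k + n) {k+1..k+(n-1)})" "{k..k+(n-1)} = insert k {k+1..k+(n-1)}" using n by auto
  have "sum w {k..k+n} = w k + (w (k + n) + sum w {k+1..k+(n-1)})" unfolding e(1) using n by simp
  moreover have "sum \<pi> {k..k+(n-1)} = \<pi> k + sum \<pi> {k+1..k+(n-1)}" unfolding e(2) by simp
  moreover have "sum \<pi> {k+1..k+(n-1)} = sum w {k+1..k+(n-1)}"
    using s by (intro sum.cong) (auto simp: stair_def)
  moreover have "\<pi> k = w k + w (k + n)" using s by (simp add: stair_def)
  ultimately show ?thesis by simp
qed

lemma height_bounds:
  assumes "\<And>l. 0 \<le> w l" "sum w {k..k+n} = 1"
  shows "of_int k \<le> height n k w" "height n k w \<le> of_int (k + n)"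
proof -
  have "(\<Sum>l\<in>{k..k+n}. of_int k * w l) \<le> height n k w" unfolding height_def
    using assms(1) by (intro sum_mono mult_right_mono) auto
  then show "of_int k \<le> height n k w" by (simp add: sum_distrib_left[symmetric] assms(2))
  have "height n k w \<le> (\<Sum>l\<in>{k..k+n}. of_int (k + n) * w l)" unfolding height_def
    using assms(1) by (intro sum_mono mult_right_mono) auto
  then show "height n k w \<le> of_int (k + n)" by (simp only: sum_distrib_left[symmetric] assms(2) mult_1_right)
qed

section \<open>Periodic barycentric coordinates\<close>

definition weights :: "int \<Rightarrow> (int \<Rightarrow> real) \<Rightarrow> bool" where
  "weights n w \<longleftrightarrow> (\<forall>l. w (l + n) = w l) \<and> (\<forall>l. 0 \<le> w l) \<and> (\<forall>k. sum w {k..k+(n-1)} = 1)"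

lemma weights_5: assumes "weights 5 w"
  shows "stair 4 k w (wrap 4 k w) (height 4 k w)" "weights 4 (wrap 4 k w)" "sum w {k..k+4} = 1"
proof -
  have e: "l + 4 + 1 = l + 5" for l :: int by simp
  have "w (l + 4 + 1) = w l" for l unfolding e using assms by (simp add: weights_def)
  then show s: "stair 4 k w (wrap 4 k w) (height 4 k w)"
    using assms by (intro stair_wrap) (auto simp: weights_def)
  show 1: "sum w {k..k+4} = 1" using assms by (simp add: weights_def)
  have per: "wrap 4 k w (m + 4) = wrap 4 k w m" for m using s by (simp add: stair_def)
  have "sum (wrap 4 k w) {k..k+(4-1)} = 1" using stair_total[OF _ s] 1 by simp
  then have "sum (wrap 4 k w) {k'..k'+(4-1)} = 1" for k'
    using periodic_sum_const[of 4 "wrap 4 k w" k k'] per by simp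
  then show "weights 4 (wrap 4 k w)" using s by (auto simp: weights_def stair_def)
qed

lemma weights_4: assumes "weights 4 \<mu>"
  shows "stair 3 j \<mu> (wrap 3 j \<mu>) (height 3 j \<mu>)" "weights 3 (wrap 3 j \<mu>)" "sum \<mu> {j..j+3} = 1"
proof -
  have e: "l + 3 + 1 = l + 4" for l :: int by simp
  have "\<mu> (l + 3 + 1) = \<mu> l" for l unfolding e using assms by (simp add: weights_def)
  then show s: "stair 3 j \<mu> (wrap 3 j \<mu>) (height 3 j \<mu>)"
    using assms by (intro stair_wrap) (auto simp: weights_def)
  show 1: "sum \<mu> {j..j+3} = 1" using assms by (simp add: weights_def)
  have per: "wrap 3 j \<mu> (m + 3) = wrap 3 j \<mu> m" for m using s by (simp add: stair_def)
  have "sum (wrap 3 j \<mu>) {j..j+(3-1)} = 1" using stair_total[OF _ s] 1 by simp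
  then have "sum (wrap 3 j \<mu>) {k'..k'+(3-1)} = 1" for k'
    using periodic_sum_const[of 3 "wrap 3 j \<mu>" j k'] per by simp
  then show "weights 3 (wrap 3 j \<mu>)" using s by (auto simp: weights_def stair_def)
qed

lemma weights_3_bary: assumes "weights 3 \<xi>" shows "bary (\<xi> i) (\<xi> (i + 1)) (\<xi> (i + 2))"
proof -
  have "{i..i+2} = {i, i + 1, i + 2}" by auto
  moreover have "sum \<xi> {i..i+2} = 1" using assms by (simp add: weights_def)
  ultimately show ?thesis using assms by (simp add: weights_def bary_def)
qed

text \<open>The lattice generated by \<open>(s, t) \<mapsto> (s + 4, t)\<close> and \<open>(s, t) \<mapsto> (s + 1, t + 5)\<close>, both rotating the triangle by
  a third of a turn, also has the basis \<open>(4, 0)\<close>, \<open>(-3, 5)\<close>, of which only the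
  first vector rotates; \<open>a\<close> and \<open>b\<close> are the coordinates with respect to this basis.\<close>

definition cover_pt :: "nat \<Rightarrow> (int \<Rightarrow> real) \<Rightarrow> real \<Rightarrow> real \<Rightarrow> (real^3) \<times> (real^2) \<times> (real^2)" where
  "cover_pt \<delta> \<xi> s t = (let a = (5 * s + 3 * t) / 20; b = t / 5 in
     (sphere_pt \<delta> (frac a) (\<xi> \<lfloor>a\<rfloor>) (\<xi> (\<lfloor>a\<rfloor> + 1)) (\<xi> (\<lfloor>a\<rfloor> + 2)), circle_pt (frac a), circle_pt (frac b)))"

lemma frac_add_int: "frac (x + of_int k) = frac (x :: real)"
  by (simp add: frac_def)

text \<open>\<open>A\<close> and \<open>N\<close> are the coordinates of a lattice vector in the
  basis (4, 0), (-3, 5). They are added to \<open>a\<close> and \<open>b\<close>, and only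
  \<open>A\<close> rotates the triangle.\<close>

lemma cover_pt_shift:
  assumes "\<And>i. \<xi>' (i + A) = \<xi> i"
  shows "cover_pt \<delta> \<xi>' (s + of_int (4 * A - 3 * N)) (t + of_int (5 * N)) = cover_pt \<delta> \<xi> s t"
proof -
  let ?a = "(5 * s + 3 * t) / 20"
  have a: "(5 * (s + of_int (4 * A - 3 * N)) + 3 * (t + of_int (5 * N))) / 20 = ?a + of_int A"
    and b: "(t + of_int (5 * N)) / 5 = t / 5 + of_int N" by (simp_all add: field_simps)
  have "\<xi>' (\<lfloor>?a\<rfloor> + A + r) = \<xi> (\<lfloor>?a\<rfloor> + r)" for r
    using assms[of "\<lfloor>?a\<rfloor> + r"] by (simp add: algebra_simps)
  from this[of 0] this[of 1] this[of 2] show ?thesis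
    unfolding cover_pt_def Let_def a b by (simp add: frac_add_int)
qed

lemma cover_pt_flip:
  assumes "weights 3 \<xi>" "\<xi> i = 0" shows "cover_pt \<delta> \<xi> s t = cover_pt \<delta>' \<xi> s t"
proof -
  have "\<xi> m = 0 \<or> \<xi> (m + 1) = 0 \<or> \<xi> (m + 2) = 0" for m
  proof -
    have per: "\<And>m. \<xi> (m + 3) = \<xi> m" using assms(1) by (simp add: weights_def)
    have "3 dvd (m + (i - m) mod 3 - i)" by presburger
    then have "\<xi> (m + (i - m) mod 3) = 0" using periodic_dvd[of \<xi> 3 "m + (i - m) mod 3" i] per assms(2) by simp
    moreover have "(i - m) mod 3 = 0 \<or> (i - m) mod 3 = 1 \<or> (i - m) mod 3 = 2" by presburger
    ultimately show ?thesis by auto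
  qed
  then show ?thesis unfolding cover_pt_def Let_def
    using sphere_pt_flip[OF weights_3_bary[OF assms(1)]] by simp
qed

text \<open>The circle coordinates determine \<open>a\<close> and \<open>b\<close> up to integers,
  which gives the lattice vector. Both sphere points are then taken at the same
  \<open>frac a\<close>, so \<open>sphere_pt_inj\<close> compares the barycentric
  coordinates.\<close>

lemma cover_pt_inj:
  assumes \<xi>: "weights 3 \<xi>" "weights 3 \<xi>'" and eq: "cover_pt \<delta> \<xi> s t = cover_pt \<delta>' \<xi>' s' t'"
  obtains A N where "\<And>i. \<xi>' (i + A) = \<xi> i" "s' = s + of_int (4 * A - 3 * N)" "t' = t + of_int (5 * N)"
    "(\<delta> = 0) = (\<delta>' = 0) \<or> (\<exists>i. \<xi>' i = 0)"
proof -
  define a where "a = (5 * s + 3 * t) / 20"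
  define a' where "a' = (5 * s' + 3 * t') / 20"
  define b where "b = t / 5"
  define b' where "b' = t' / 5"
  have e: "sphere_pt \<delta> (frac a) (\<xi> \<lfloor>a\<rfloor>) (\<xi> (\<lfloor>a\<rfloor> + 1)) (\<xi> (\<lfloor>a\<rfloor> + 2))
      = sphere_pt \<delta>' (frac a') (\<xi>' \<lfloor>a'\<rfloor>) (\<xi>' (\<lfloor>a'\<rfloor> + 1)) (\<xi>' (\<lfloor>a'\<rfloor> + 2))"
    "circle_pt (frac a) = circle_pt (frac a')" "circle_pt (frac b) = circle_pt (frac b')"
    using eq by (simp_all add: cover_pt_def Let_def a_def a'_def b_def b'_def)
  have fa: "frac a = frac a'" "frac b = frac b'"
    using e(2,3) by (auto intro!: circle_pt_inj simp: frac_lt_1)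
  define A where "A = \<lfloor>a'\<rfloor> - \<lfloor>a\<rfloor>"
  define N where "N = \<lfloor>b'\<rfloor> - \<lfloor>b\<rfloor>"
  have ab: "a' = a + of_int A" "b' = b + of_int N" using fa by (simp_all add: frac_def A_def N_def)
  note i = sphere_pt_inj[OF weights_3_bary[OF \<xi>(1)] weights_3_bary[OF \<xi>(2)] e(1)[unfolded fa(1)]]
  have "\<lfloor>a'\<rfloor> = \<lfloor>a\<rfloor> + A" by (simp add: A_def)
  then have x: "\<xi>' (\<lfloor>a\<rfloor> + A + r) = \<xi> (\<lfloor>a\<rfloor> + r)" if "r = 0 \<or> r = 1 \<or> r = 2" for r
    using i that by auto
  have "(\<lambda>m. \<xi>' (m + A)) = \<xi>"
  proof (rule periodic_eqI[of 3 _ _ "\<lfloor>a\<rfloor>"])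
    show "\<xi>' (m + 3 + A) = \<xi>' (m + A)" for m using \<xi>(2) by (metis add.assoc add.commute weights_def)
    show "\<xi> (m + 3) = \<xi> m" for m using \<xi>(1) by (simp add: weights_def)
    show "\<xi>' (m + A) = \<xi> m" if "\<lfloor>a\<rfloor> \<le> m" "m < \<lfloor>a\<rfloor> + 3" for m
    proof -
      have "m - \<lfloor>a\<rfloor> = 0 \<or> m - \<lfloor>a\<rfloor> = 1 \<or> m - \<lfloor>a\<rfloor> = 2" using that by linarith
      from x[OF this] show ?thesis by (simp add: add.commute)
    qed
  qed simp
  then have x': "\<xi>' (m + A) = \<xi> m" for m by metis
  have t: "t' = t + of_int (5 * N)" using ab(2) by (simp add: b_def b'_def)
  have s: "s' = s + of_int (4 * A - 3 * N)" using ab(1) t by (simp add: a_def a'_def field_simps)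
  have "(\<delta> = 0) = (\<delta>' = 0) \<or> (\<exists>i. \<xi>' i = 0)" using i by metis
  from that[OF x' s t this] show thesis .
qed

section \<open>Tiles of the universal cover, their translations and facets\<close>

definition tile_pt :: "nat \<Rightarrow> int \<Rightarrow> int \<Rightarrow> (int \<Rightarrow> real) \<Rightarrow> (real^3) \<times> (real^2) \<times> (real^2)" where
  "tile_pt \<delta> j k w = cover_pt \<delta> (wrap 3 j (wrap 4 k w)) (height 3 j (wrap 4 k w)) (height 4 k w)"

text \<open>All congruences needed: \<open>5 * N\<close> is \<open>N\<close> modulo 4, which is also
  \<open>4 * A - 3 * N\<close> modulo 4, and the latter is \<open>A\<close> modulo 3. The labels of
  all three levels are thus shifted compatibly.\<close>

lemma tile_translate:
  assumes w: "weights 5 w"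
  shows "wrap 4 (k + 5 * N) w (m + N) = wrap 4 k w m"
    "height 4 (k + 5 * N) w = height 4 k w + of_int (5 * N)"
    "wrap 3 (j + (4 * A - 3 * N)) (wrap 4 (k + 5 * N) w) (i + A) = wrap 3 j (wrap 4 k w) i"
    "height 3 (j + (4 * A - 3 * N)) (wrap 4 (k + 5 * N) w) = height 3 j (wrap 4 k w) + of_int (4 * A - 3 * N)"
proof -
  have w5: "w (l + 5 * N) = w l" for l using w by (intro periodic_mult) (simp add: weights_def)
  show 1: "wrap 4 (k + 5 * N) w (m + N) = wrap 4 k w m" for m
    using wrap_shift[of w "5 * N" w 4 N k m] w5 by simp
  show "height 4 (k + 5 * N) w = height 4 k w + of_int (5 * N)"
    using height_shift[of w "5 * N" w 4 k] w5 weights_5(3)[OF w] by simp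
  have 2: "wrap 4 (k + 5 * N) w (m + (4 * A - 3 * N)) = wrap 4 k w m" for m
  proof -
    have "wrap 4 (k + 5 * N) w (m + N + 4 * (A - N)) = wrap 4 (k + 5 * N) w (m + N)"
      using weights_5(2)[OF w, of "k + 5 * N"] by (intro periodic_mult) (simp add: weights_def)
    then show ?thesis using 1[of m] by (simp add: algebra_simps)
  qed
  show "wrap 3 (j + (4 * A - 3 * N)) (wrap 4 (k + 5 * N) w) (i + A) = wrap 3 j (wrap 4 k w) i"
  proof (rule wrap_shift[of "wrap 4 (k + 5 * N) w" "4 * A - 3 * N" "wrap 4 k w"])
    show "wrap 4 (k + 5 * N) w (l + (4 * A - 3 * N)) = wrap 4 k w l" for l by (rule 2)
    have "4 * A - 3 * N - A = 3 * (A - N)" by simp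
    then show "3 dvd (4 * A - 3 * N - A)" by simp
  qed
  show "height 3 (j + (4 * A - 3 * N)) (wrap 4 (k + 5 * N) w) = height 3 j (wrap 4 k w) + of_int (4 * A - 3 * N)"
    using height_shift[of "wrap 4 (k + 5 * N) w" "4 * A - 3 * N" "wrap 4 k w" 3 j] 2 weights_4(3)[OF weights_5(2)[OF w]] by simp
qed

lemma tile_pt_translate:
  assumes "weights 5 w" shows "tile_pt \<delta> (j + (4 * A - 3 * N)) (k + 5 * N) w = tile_pt \<delta> j k w"
  unfolding tile_pt_def tile_translate(2,4)[OF assms] using tile_translate(3)[OF assms]
  by (intro cover_pt_shift) auto

text \<open>The choice \<open>A = N = - j\<close> is the lattice vector that brings the tile to the
  tetrahedron \<open>j = 0\<close>.\<close>

lemma tile_pt_fold: "weights 5 w \<Longrightarrow> tile_pt \<delta> 0 (k - 5 * j) w = tile_pt \<delta> j k w"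
  using tile_pt_translate[of w \<delta> j "- j" "- j" k] by simp

text \<open>The choice \<open>A = 3 * q\<close>, \<open>N = 4 * q\<close> keeps \<open>j\<close>,
  moves \<open>k\<close> by \<open>20 * q\<close> and makes full turns of the triangle; hence the 20
  values of \<open>k\<close>.\<close>

lemma tile_pt_mod: "weights 5 w \<Longrightarrow> tile_pt \<delta> 0 (k mod 20) w = tile_pt \<delta> 0 k w"
  using tile_pt_translate[of w \<delta> 0 "3 * (k div 20)" "4 * (k div 20)" "k mod 20"] by simp

lemma tile_pt_step:
  assumes w: "weights 5 w" and "w k = 0" shows "tile_pt \<delta> j (k + 1) w = tile_pt \<delta> j k w"
proof -
  have "stair 4 (k + 1) w (wrap 4 k w) (height 4 k w)"
    by (rule stair_step[OF _ weights_5(1)[OF w] assms(2)]) simp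
  from stair_determines[OF _ this] show ?thesis by (simp add: tile_pt_def)
qed

lemma tile_pt_step_lower:
  assumes w: "weights 5 w" and "wrap 4 k w j = 0" shows "tile_pt \<delta> (j + 1) k w = tile_pt \<delta> j k w"
proof -
  let ?\<mu> = "wrap 4 k w"
  have "stair 3 (j + 1) ?\<mu> (wrap 3 j ?\<mu>) (height 3 j ?\<mu>)"
    by (rule stair_step[OF _ weights_4(1)[OF weights_5(2)[OF w]] assms(2)]) simp
  from stair_determines[OF _ this] show ?thesis by (simp add: tile_pt_def)
qed

lemma tile_pt_flip:
  assumes w: "weights 5 w" and "wrap 3 j (wrap 4 k w) i = 0" shows "tile_pt \<delta> j k w = tile_pt \<delta>' j k w"
  unfolding tile_pt_def by (rule cover_pt_flip[OF weights_4(2)[OF weights_5(2)[OF w]] assms(2)])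

definition enc :: "nat \<Rightarrow> int \<Rightarrow> nat" where "enc \<delta> k = 2 * nat (k mod 20) + \<delta>"

lemma enc_less: "\<delta> < 2 \<Longrightarrow> enc \<delta> k < 40"
proof -
  assume "\<delta> < 2"
  moreover have "nat (k mod 20) < 20" by (simp add: nat_less_iff)
  ultimately show ?thesis by (simp add: enc_def)
qed

lemma color_nat_of_int: "color_nat (of_int z) = nat (z mod 5)"
proof -
  have "Rep_bit1 (of_int z :: 5) = z mod 5"
    unfolding bit1.of_int_eq bit1.Rep_Abs_mod by simp
  then show ?thesis by (simp add: color_nat_def)
qed

text \<open>\<open>k\<close> may be replaced by its residue modulo 20, because 20 is a multiple of
  both moduli 4 and 5; the negative steps then become the 15 and 19 of
  \<open>adj_nat\<close>.\<close>

lemma adj40_enc: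
  assumes "\<delta> < 2" "r \<in> {0, 1, 2, 3, 4}"
  shows "adj40 (of_int (k + r)) (enc \<delta> k) = (if r = 0 then enc \<delta> (k + 1) else if r = 4 then enc \<delta> (k - 1)
     else if (k + r) mod 4 = 0 then enc \<delta> (k - 5) else if (k + r) mod 4 = 3 then enc \<delta> (k + 5) else enc (1 - \<delta>) k)"
proof -
  define K where "K = nat (k mod 20)"
  define q where "q = k div 20"
  have k: "k = 20 * q + int K" by (simp add: K_def q_def)
  have K: "K < 20" by (simp add: K_def nat_less_iff)
  define R where "R = nat r"
  have r: "r = int R" "R < 5" using assms(2) by (auto simp: R_def)
  have m5: "(k + r) mod 5 = int ((K + R) mod 5)"
  proof -
    have "k + r = int (K + R) + 5 * (4 * q)" by (simp add: k r)
    then show ?thesis by (simp only: mod_mult_self2 zmod_int of_nat_numeral)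
  qed
  have m4: "(k + r) mod 4 = int ((K + R) mod 4)"
  proof -
    have "k + r = int (K + R) + 4 * (5 * q)" by (simp add: k r)
    then show ?thesis by (simp only: mod_mult_self2 zmod_int of_nat_numeral)
  qed
  have m20': "x mod 20 = int (y mod 20)" if "x = int y + 20 * i" for x i y
    using that by (simp only: mod_mult_self2 zmod_int of_nat_numeral)
  have m20: "k mod 20 = int K" "(k + 1) mod 20 = int ((K + 1) mod 20)" "(k - 1) mod 20 = int ((K + 19) mod 20)"
    "(k - 5) mod 20 = int ((K + 15) mod 20)" "(k + 5) mod 20 = int ((K + 5) mod 20)"
    using m20'[of k K q] m20'[of "k + 1" "K + 1" q] m20'[of "k - 1" "K + 19" "q - 1"]
      m20'[of "k - 5" "K + 15" "q - 1"] m20'[of "k + 5" "K + 5" q] K by (simp_all add: k)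
  have d: "(2 * K + \<delta>) div 2 = K" "(2 * K + \<delta>) mod 2 = \<delta>" using assms(1) by auto
  have c: "((K + R) mod 5 + 4 * K) mod 5 = R"
  proof -
    have "((K + R) mod 5 + 4 * K) mod 5 = (K + R + 4 * K) mod 5" by (rule mod_add_left_eq)
    also have "K + R + 4 * K = R + 5 * K" by simp
    finally show ?thesis using r(2) by simp
  qed
  have m4_eq: "int ((K + R) mod 4) = 0 \<longleftrightarrow> (K + R) mod 4 = 0" "int ((K + R) mod 4) = 3 \<longleftrightarrow> (K + R) mod 4 = 3" by linarith+
  show ?thesis
    unfolding adj40_def color_nat_of_int enc_def m5 m4 m20 adj_nat_def nat_int d Let_def c m4_eq
    using r by auto
qed

section \<open>The gem of the product\<close>

text \<open>Coordinates continued periodically to all integer labels; \<open>of_int\<close> into the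
  type of colors is reduction modulo 5.\<close>

definition label_weight :: "real^5 \<Rightarrow> int \<Rightarrow> real" where "label_weight x l = x $ of_int l"

lemma label_weight_periodic: "label_weight x (l + 5) = label_weight x l"
  by (simp add: label_weight_def)

lemma sum_label_weight: "sum (label_weight x) {0..4} = (\<Sum>i\<in>UNIV. x $ i)"
proof -
  have "{0..4} = {0, 1, 2, 3, 4 :: int}" by auto
  then show ?thesis unfolding UNIV_5 by (simp add: label_weight_def)
qed

lemma std_simplex_iff_weights: "x \<in> std_simplex \<longleftrightarrow> weights 5 (label_weight x)"
proof
  assume x: "x \<in> std_simplex"
  have "sum (label_weight x) {k..k+(5-1)} = sum (label_weight x) {0..0+(5-1)}" for k
    by (rule periodic_sum_const) (simp_all add: label_weight_periodic)
  also have "sum (label_weight x) {0..0+(5-1)} = 1" using sum_label_weight[of x] x by (simp add: std_simplex_def)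
  finally show "weights 5 (label_weight x)"
    using x by (simp add: weights_def label_weight_periodic) (simp add: label_weight_def std_simplex_def)
next
  assume w: "weights 5 (label_weight x)"
  have "0 \<le> x $ c" for c
  proof (cases c)
    case (of_int z)
    then show ?thesis using w by (simp add: weights_def label_weight_def)
  qed
  moreover have "sum (label_weight x) {0..0+(5-1)} = 1" using w unfolding weights_def by blast
  ultimately show "x \<in> std_simplex" using sum_label_weight[of x] by (simp add: std_simplex_def)
qed

lemma label_weight_inj: assumes "label_weight x = label_weight y" shows "x = y"
proof -
  have "x $ c = y $ c" for c
  proof (cases c)
    case (of_int z)
    then show ?thesis using fun_cong[OF assms, of z] by (simp add: label_weight_def)
  qed
  then show ?thesis by (simp add: vec_eq_iff)
qed

lemma label_weight_surj: assumes "weights 5 w" obtains x where "label_weight x = w"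
proof -
  define x :: "real^5" where "x = (\<chi> c. w (int (color_nat c)))"
  have "label_weight x l = w l" for l
  proof -
    have "5 dvd (l mod 5 - l)" by presburger
    then have "w (l mod 5) = w l" using periodic_dvd[of w 5 "l mod 5" l] assms by (simp add: weights_def)
    then show ?thesis by (simp add: label_weight_def x_def color_nat_of_int)
  qed
  then show thesis using that by blast
qed

definition gem_fun :: "nat \<Rightarrow> real^5 \<Rightarrow> (real^3) \<times> (real^2) \<times> (real^2)" where
  "gem_fun v x = tile_pt (v mod 2) 0 (int (v div 2)) (label_weight x)"

lemma gem_fun_enc:
  assumes "x \<in> std_simplex" "\<delta> < 2" shows "gem_fun (enc \<delta> k) x = tile_pt \<delta> 0 k (label_weight x)"
proof -
  have "enc \<delta> k mod 2 = \<delta>" "int (enc \<delta> k div 2) = k mod 20" using assms(2) by (simp_all add: enc_def)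
  then show ?thesis using assms(1) by (simp add: gem_fun_def tile_pt_mod std_simplex_iff_weights)
qed

lemma enc_surj: assumes "v < 40" obtains \<delta> k where "\<delta> < 2" "0 \<le> k" "k < 20" "v = enc \<delta> k"
  using assms by (intro that[of "v mod 2" "int (v div 2)"]) (auto simp: enc_def)

section \<open>The tiles that contain a given point\<close>

context
  fixes x :: "real^5"
begin

text \<open>The combinatorial counterpart of \<open>tile_pt\<close>: each move between tiles that
  fixes the point \<open>x\<close> is shown to stay in one component of the colors
  \<open>zeros x\<close>, that is, to be a gluing. The subtraction \<open>k - 5 * j\<close> folds
  the tile back to \<open>j = 0\<close>.\<close>

definition tile_class :: "nat \<Rightarrow> int \<Rightarrow> int \<Rightarrow> nat set" where
  "tile_class \<delta> j k = comp_of {..<40} adj40 (zeros x) (enc \<delta> (k - 5 * j))"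

lemma tile_class_adj:
  assumes "\<delta> < 2" "r \<in> {0, 1, 2, 3, 4}" "label_weight x (k + r) = 0" "adj40 (of_int (k - 5 * j + r)) (enc \<delta> (k - 5 * j)) = enc \<delta>' (k' - 5 * j')"
  shows "tile_class \<delta>' j' k' = tile_class \<delta> j k"
proof -
  have "of_int (k - 5 * j + r) = (of_int (k + r) :: 5)" by simp
  then have "of_int (k - 5 * j + r) \<in> zeros x" using assms(3) unfolding zeros_def label_weight_def by simp
  moreover have "enc \<delta> (k - 5 * j) \<in> {..<40}" using enc_less[OF assms(1)] by simp
  ultimately show ?thesis
    unfolding tile_class_def assms(4)[symmetric] by (intro G40.comp_of_adj)
qed

lemma tile_class_step:
  assumes "\<delta> < 2" "label_weight x k = 0" shows "tile_class \<delta> j (k + 1) = tile_class \<delta> j k"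
  by (rule tile_class_adj[of \<delta> 0]) (use assms adj40_enc[of \<delta> 0 "k - 5 * j"] in \<open>simp_all add: algebra_simps\<close>)

lemma tile_class_step_lower':
  assumes "\<delta> < 2" "k < l" "l < k + 4" "label_weight x l = 0" "4 dvd (l - j)"
  shows "tile_class \<delta> (j + 1) k = tile_class \<delta> j k"
proof -
  define r where "r = l - k"
  have r: "r = 1 \<or> r = 2 \<or> r = 3" using assms by (auto simp: r_def)
  have "(k - 5 * j + r) mod 4 = 0" using assms(5) unfolding r_def by presburger
  then have "adj40 (of_int (k - 5 * j + r)) (enc \<delta> (k - 5 * j)) = enc \<delta> (k - 5 * j - 5)"
    using adj40_enc[OF assms(1), of r "k - 5 * j"] r by auto
  moreover have "k - 5 * j - 5 = k - 5 * (j + 1)" by simp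
  ultimately show ?thesis
    using assms r by (intro tile_class_adj[of \<delta> r]) (auto simp: r_def)
qed

lemma tile_class_flip':
  assumes "\<delta> < 2" "k < l" "l < k + 4" "label_weight x l = 0" "(l - j) mod 4 = 1 \<or> (l - j) mod 4 = 2"
  shows "tile_class (1 - \<delta>) j k = tile_class \<delta> j k"
proof -
  define r where "r = l - k"
  have r: "r = 1 \<or> r = 2 \<or> r = 3" using assms by (auto simp: r_def)
  have "(k - 5 * j + r) mod 4 \<noteq> 0" "(k - 5 * j + r) mod 4 \<noteq> 3" using assms(5) unfolding r_def by presburger+
  then have "adj40 (of_int (k - 5 * j + r)) (enc \<delta> (k - 5 * j)) = enc (1 - \<delta>) (k - 5 * j)"
    using adj40_enc[OF assms(1), of r "k - 5 * j"] r by auto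
  then show ?thesis
    using assms r by (intro tile_class_adj[of \<delta> r]) (auto simp: r_def)
qed

context
  assumes x: "x \<in> std_simplex"
begin

lemma weights_x: "weights 5 (label_weight x)" using x by (simp add: std_simplex_iff_weights)

text \<open>If the facet condition \<open>\<mu> m = 0\<close> involves both ends \<open>k\<close> and \<open>k + 4\<close> of the staircase, one first moves from
  \<open>k\<close> to \<open>k + 1\<close>, where the label \<open>m\<close> is in the interior.\<close>

lemma wrap_zero_cases:
  assumes "wrap 4 k (label_weight x) m = 0"
  obtains l where "k < l" "l < k + 4" "label_weight x l = 0" "4 dvd (l - m)"
  | "label_weight x k = 0" "label_weight x (k + 4) = 0" "4 dvd (k - m)"
proof -
  define l where "l = k + (m - k) mod 4"
  have st: "stair 4 k (label_weight x) (wrap 4 k (label_weight x)) (height 4 k (label_weight x))"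
    using weights_5(1)[OF weights_x] .
  have l: "k \<le> l" "l < k + 4" "4 dvd (l - m)" unfolding l_def by (simp, simp, presburger)
  have "wrap 4 k (label_weight x) l = 0"
    using periodic_dvd[of "wrap 4 k (label_weight x)" 4 l m] l(3) assms st by (simp add: stair_def)
  show thesis
  proof (cases "l = k")
    case True
    then have "label_weight x k + label_weight x (k + 4) = 0"
      using st \<open>wrap 4 k (label_weight x) l = 0\<close> by (simp add: stair_def)
    moreover have "0 \<le> label_weight x k" "0 \<le> label_weight x (k + 4)" using weights_x by (simp_all add: weights_def)
    ultimately show thesis using that(2) True l(3) by force
  next
    case False
    then have "label_weight x l = 0"
      using st \<open>wrap 4 k (label_weight x) l = 0\<close> l by (simp add: stair_def)
    then show thesis using that(1) False l by force
  qed
qed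

lemma tile_class_step_lower:
  assumes d: "\<delta> < 2" and "wrap 4 k (label_weight x) j = 0" shows "tile_class \<delta> (j + 1) k = tile_class \<delta> j k"
  using assms(2)
proof (cases rule: wrap_zero_cases)
  case (1 l)
  then show ?thesis by (rule tile_class_step_lower'[OF d])
next
  case 2
  have "4 dvd (k + 4 - j)" using 2(3) by presburger
  then have "tile_class \<delta> (j + 1) (k + 1) = tile_class \<delta> j (k + 1)"
    using 2 by (intro tile_class_step_lower'[OF d, of _ "k + 4"]) auto
  then show ?thesis using tile_class_step[OF d 2(1)] by simp
qed

lemma tile_class_flip_lower:
  assumes d: "\<delta> < 2" and "wrap 4 k (label_weight x) m = 0" and m: "(m - j) mod 4 = 1 \<or> (m - j) mod 4 = 2"
  shows "tile_class (1 - \<delta>) j k = tile_class \<delta> j k"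
  using assms(2)
proof (cases rule: wrap_zero_cases)
  case (1 l)
  have "(l - j) mod 4 = 1 \<or> (l - j) mod 4 = 2" using m 1(4) by presburger
  then show ?thesis using 1 by (intro tile_class_flip'[OF d]) auto
next
  case 2
  have "(k + 4 - j) mod 4 = 1 \<or> (k + 4 - j) mod 4 = 2" using m 2(3) by presburger
  then have "tile_class (1 - \<delta>) j (k + 1) = tile_class \<delta> j (k + 1)"
    using 2 by (intro tile_class_flip'[OF d, of _ "k + 4"]) auto
  moreover have "1 - \<delta> < 2" by simp
  ultimately show ?thesis using tile_class_step[OF d 2(1)] tile_class_step[OF _ 2(1), of "1 - \<delta>"] by simp
qed

lemma tile_class_flip:
  assumes d: "\<delta> < 2" and "wrap 3 j (wrap 4 k (label_weight x)) i = 0"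
  shows "tile_class (1 - \<delta>) j k = tile_class \<delta> j k"
proof -
  let ?\<mu> = "wrap 4 k (label_weight x)"
  have st: "stair 3 j ?\<mu> (wrap 3 j ?\<mu>) (height 3 j ?\<mu>)" using weights_4(1)[OF weights_5(2)[OF weights_x]] .
  define m where "m = j + (i - j) mod 3"
  have m: "m = j \<or> m = j + 1 \<or> m = j + 2" "3 dvd (m - i)" unfolding m_def by presburger+
  have z: "wrap 3 j ?\<mu> m = 0"
    using periodic_dvd[of "wrap 3 j ?\<mu>" 3 m i] m(2) assms(2) st by (simp add: stair_def)
  show ?thesis
  proof (cases "m = j")
    case False
    then have "?\<mu> m = 0" using z m(1) st by (auto simp: stair_def)
    then show ?thesis using m(1) False by (intro tile_class_flip_lower[OF d]) auto
  next
    case True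
    then have "?\<mu> j + ?\<mu> (j + 3) = 0" using z st by (simp add: stair_def)
    moreover have "0 \<le> ?\<mu> j" "0 \<le> ?\<mu> (j + 3)" using st by (simp_all add: stair_def)
    ultimately have z: "?\<mu> j = 0" "?\<mu> (j + 3) = 0" by linarith+
    have d': "1 - \<delta> < 2" by simp
    have "tile_class (1 - \<delta>) (j + 1) k = tile_class \<delta> (j + 1) k"
      by (rule tile_class_flip_lower[OF d z(2)]) simp
    then show ?thesis using tile_class_step_lower[OF d z(1)] tile_class_step_lower[OF d' z(1)] by simp
  qed
qed

lemma tile_class_steps:
  assumes "\<delta> < 2" "k \<le> k'" "\<And>i. k \<le> i \<Longrightarrow> i < k' \<Longrightarrow> label_weight x i = 0"
  shows "tile_class \<delta> j k' = tile_class \<delta> j k"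
  using assms(2,3)
proof (induction k' rule: int_ge_induct)
  case (step i)
  then show ?case using tile_class_step[OF assms(1), of i j] by simp
qed simp

lemma tile_class_steps_lower:
  assumes "\<delta> < 2" "j \<le> j'" "\<And>i. j \<le> i \<Longrightarrow> i < j' \<Longrightarrow> wrap 4 k (label_weight x) i = 0"
  shows "tile_class \<delta> j' k = tile_class \<delta> j k"
  using assms(2,3)
proof (induction j' rule: int_ge_induct)
  case (step i)
  then show ?case using tile_class_step_lower[OF assms(1), of k i] by simp
qed simp

lemma tile_class_translate: "tile_class \<delta> (j + (4 * A - 3 * N)) (k + 5 * N) = tile_class \<delta> j k"
proof -
  have "k + 5 * N - 5 * (j + (4 * A - 3 * N)) = k - 5 * j + 20 * (N - A)" by simp
  then have "(k + 5 * N - 5 * (j + (4 * A - 3 * N))) mod 20 = (k - 5 * j) mod 20" by (metis mod_mult_self2)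
  then show ?thesis by (simp add: tile_class_def enc_def)
qed

text \<open>The construction is undone from the outside: \<open>cover_pt_inj\<close> yields a
  lattice translation, then \<open>stair_unique\<close> compares the tetrahedra and after them the
  4-simplices. Where two staircases differ, the vanishing weights it provides form a path of gluings
  between them.\<close>

lemma tile_pt_inj:
  assumes d: "\<delta> < 2" "\<delta>' < 2" and y: "y \<in> std_simplex"
    and eq: "tile_pt \<delta> 0 k (label_weight x) = tile_pt \<delta>' 0 k' (label_weight y)"
  shows "x = y \<and> tile_class \<delta> 0 k = tile_class \<delta>' 0 k'"
proof -
  let ?w = "label_weight x" and ?w' = "label_weight y"
  have w: "weights 5 ?w" "weights 5 ?w'" using x y by (simp_all add: std_simplex_iff_weights)
  let ?\<mu>' = "wrap 4 k' ?w'"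
  let ?\<xi>' = "wrap 3 0 ?\<mu>'"
  have \<mu>: "weights 4 (wrap 4 k ?w)" "weights 4 ?\<mu>'" using weights_5(2) w by blast+
  obtain A N where AN: "\<And>i. ?\<xi>' (i + A) = wrap 3 0 (wrap 4 k ?w) i"
      "height 3 0 ?\<mu>' = height 3 0 (wrap 4 k ?w) + of_int (4 * A - 3 * N)"
      "height 4 k' ?w' = height 4 k ?w + of_int (5 * N)" "(\<delta> = 0) = (\<delta>' = 0) \<or> (\<exists>i. ?\<xi>' i = 0)"
    using cover_pt_inj[OF weights_4(2)[OF \<mu>(1)] weights_4(2)[OF \<mu>(2)] eq[unfolded tile_pt_def]] by metis
  define j1 where "j1 = 0 + (4 * A - 3 * N)"
  define k1 where "k1 = k + 5 * N"
  let ?\<mu> = "wrap 4 k1 ?w"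
  have \<mu>1: "weights 4 ?\<mu>" using weights_5(2) w by blast
  note tr = tile_translate(2)[OF w(1), where k = k and N = N, folded k1_def]
    tile_translate(3,4)[OF w(1), where k = k and N = N and j = 0 and A = A, folded k1_def j1_def]
  have \<xi>: "wrap 3 j1 ?\<mu> = ?\<xi>'"
  proof
    fix i
    show "wrap 3 j1 ?\<mu> i = ?\<xi>' i" using tr(2)[of "i - A"] AN(1)[of "i - A"] by simp
  qed
  have s: "height 3 j1 ?\<mu> = height 3 0 ?\<mu>'" using tr(3) AN(2) by simp
  have t: "height 4 k1 ?w = height 4 k' ?w'" using tr(1) AN(3) by simp
  have st1: "stair 3 j1 ?\<mu> ?\<xi>' (height 3 0 ?\<mu>')" using weights_4(1)[OF \<mu>1, of j1] by (simp add: \<xi> s)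
  have st2: "stair 3 0 ?\<mu>' ?\<xi>' (height 3 0 ?\<mu>')" by (rule weights_4(1)[OF \<mu>(2)])
  have J: "?\<mu> = ?\<mu>' \<and> tile_class \<delta> j1 k1 = tile_class \<delta> 0 k1"
  proof (cases "j1 \<le> 0")
    case True
    have u: "?\<mu> = ?\<mu>' \<and> (\<forall>i. j1 \<le> i \<and> i < 0 \<longrightarrow> ?\<mu> i = 0)" by (rule stair_unique[OF _ True st1 st2]) simp
    have "tile_class \<delta> 0 k1 = tile_class \<delta> j1 k1"
      by (rule tile_class_steps_lower[OF d(1) True]) (use u in blast)
    then show ?thesis using u by simp
  next
    case False
    then have j1: "0 \<le> j1" by simp
    have u: "?\<mu>' = ?\<mu> \<and> (\<forall>i. 0 \<le> i \<and> i < j1 \<longrightarrow> ?\<mu>' i = 0)" by (rule stair_unique[OF _ j1 st2 st1]) simp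
    have "tile_class \<delta> j1 k1 = tile_class \<delta> 0 k1"
      by (rule tile_class_steps_lower[OF d(1) j1]) (use u in metis)
    then show ?thesis using u by simp
  qed
  have sta: "stair 4 k1 ?w ?\<mu>' (height 4 k' ?w')" using weights_5(1)[OF w(1), of k1] J t by simp
  have stb: "stair 4 k' ?w' ?\<mu>' (height 4 k' ?w')" by (rule weights_5(1)[OF w(2)])
  have K: "?w = ?w' \<and> tile_class \<delta>' 0 k1 = tile_class \<delta>' 0 k'"
  proof (cases "k1 \<le> k'")
    case True
    have u: "?w = ?w' \<and> (\<forall>i. k1 \<le> i \<and> i < k' \<longrightarrow> ?w i = 0)" by (rule stair_unique[OF _ True sta stb]) simp
    have "tile_class \<delta>' 0 k' = tile_class \<delta>' 0 k1"
      by (rule tile_class_steps[OF d(2) True]) (use u in blast)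
    then show ?thesis using u by simp
  next
    case False
    then have k1: "k' \<le> k1" by simp
    have u: "?w' = ?w \<and> (\<forall>i. k' \<le> i \<and> i < k1 \<longrightarrow> ?w' i = 0)" by (rule stair_unique[OF _ k1 stb sta]) simp
    have "tile_class \<delta>' 0 k1 = tile_class \<delta>' 0 k'"
      by (rule tile_class_steps[OF d(2) k1]) (use u in metis)
    then show ?thesis using u by simp
  qed
  \<comment> \<open>Points of different sides coincide only on the rim, where a barycentric
    coordinate vanishes and changing sides keeps the class.\<close>
  have "tile_class \<delta> 0 k1 = tile_class \<delta>' 0 k1"
  proof (cases "\<delta> = \<delta>'")
    case False
    then have e: "\<delta>' = 1 - \<delta>" using d by auto
    have "\<not> (\<delta> = 0) = (\<delta>' = 0)" using False d by auto
    then obtain i where "?\<xi>' i = 0" using AN(4) by blast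
    then have "wrap 3 0 ?\<mu> i = 0" using J by simp
    then show ?thesis using tile_class_flip[OF d(1), of 0 k1 i] e by simp
  qed simp
  moreover have "tile_class \<delta> j1 k1 = tile_class \<delta> 0 k" unfolding j1_def k1_def by (rule tile_class_translate)
  ultimately have "tile_class \<delta> 0 k = tile_class \<delta>' 0 k'" using J K by simp
  then show ?thesis using K label_weight_inj by blast
qed

lemma gem_fun_adj:
  assumes "v < 40" "x $ c = 0" shows "gem_fun (adj40 c v) x = gem_fun v x"
proof -
  let ?w = "label_weight x"
  obtain \<delta> k where v: "\<delta> < 2" "v = enc \<delta> k" using enc_surj[OF assms(1)] by metis
  obtain z where z: "c = of_int z" by (cases c) auto
  \<comment> \<open>The position of the color in the window \<open>k\<close>, ...,
    \<open>k + 4\<close>.\<close>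
  define r where "r = (z - k) mod 5"
  have r: "r \<in> {0, 1, 2, 3, 4}" unfolding r_def by (simp; presburger)
  have "5 dvd (k + r - z)" unfolding r_def by presburger
  then have "(of_int (k + r) :: 5) = of_int z"
    using periodic_dvd[of "of_int :: int \<Rightarrow> 5" 5 "k + r" z] by simp
  then have c: "c = of_int (k + r)" using z by simp
  then have w0: "?w (k + r) = 0" using assms(2) by (simp add: label_weight_def)
  note adj = adj40_enc[OF v(1) r, of k, folded c v(2)]
  note T = gem_fun_enc[OF x]
  have st: "stair 4 k ?w (wrap 4 k ?w) (height 4 k ?w)" by (rule weights_5(1)[OF weights_x])
  have wl: "wrap 4 k ?w m = 0" if "r \<in> {1, 2, 3}" "4 dvd (m - (k + r))" for m
  proof -
    have "wrap 4 k ?w (k + r) = 0" using st w0 that(1) by (auto simp: stair_def)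
    then show ?thesis using periodic_dvd[of "wrap 4 k ?w" 4 m "k + r"] that(2) st by (simp add: stair_def)
  qed
  have gv: "gem_fun v x = tile_pt \<delta> 0 k ?w" using T[OF v(1), of k] v(2) by simp
  have "r = 0 \<or> r = 4 \<or> r \<in> {1, 2, 3}" using r by auto
  moreover have "(k + r) mod 4 = 0 \<or> (k + r) mod 4 = 3 \<or> (k + r) mod 4 = 1 \<or> (k + r) mod 4 = 2" by presburger
  ultimately consider "r = 0" | "r = 4" | "r \<in> {1, 2, 3}" "(k + r) mod 4 = 0" | "r \<in> {1, 2, 3}" "(k + r) mod 4 = 3"
    | "r \<in> {1, 2, 3}" "(k + r) mod 4 = 1 \<or> (k + r) mod 4 = 2" by blast
  then show ?thesis
  proof cases
    case 1
    then show ?thesis using adj T[OF v(1), of "k + 1"] gv tile_pt_step[OF weights_x, of k] w0 by simp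
  next
    case 2
    \<comment> \<open>The vanishing top label \<open>k + 4\<close> is also the bottom label
      \<open>k - 1\<close> of the previous simplex, so the step is taken from there.\<close>
    have "?w (k - 1 + 5) = ?w (k - 1)" by (rule label_weight_periodic)
    then have "?w (k - 1) = 0" using w0 2 by (simp add: add.commute)
    then show ?thesis using 2 adj T[OF v(1), of "k - 1"] gv tile_pt_step[OF weights_x, of "k - 1"] by simp
  next
    case 3
    \<comment> \<open>The lowest corner of the tetrahedron 0 has no weight, so the point lies in the
      tetrahedron 1, which is folded back to 0.\<close>
    have "wrap 4 k ?w 0 = 0" by (rule wl[OF 3(1)]) (use 3(2) in presburger)
    then have "tile_pt \<delta> (0 + 1) k ?w = tile_pt \<delta> 0 k ?w" by (rule tile_pt_step_lower[OF weights_x])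
    moreover have "tile_pt \<delta> 0 (k - 5 * 1) ?w = tile_pt \<delta> 1 k ?w" by (rule tile_pt_fold[OF weights_x])
    moreover have "adj40 c v = enc \<delta> (k - 5)" using adj 3 by auto
    ultimately show ?thesis using T[OF v(1), of "k - 5"] gv by simp
  next
    case 4
    \<comment> \<open>The top corner 3 is -1 modulo 4, the lowest corner of the tetrahedron -1, from
      which the step is taken.\<close>
    have "wrap 4 k ?w (- 1) = 0" by (rule wl[OF 4(1)]) (use 4(2) in presburger)
    then have "tile_pt \<delta> (- 1 + 1) k ?w = tile_pt \<delta> (- 1) k ?w" by (rule tile_pt_step_lower[OF weights_x])
    moreover have "tile_pt \<delta> 0 (k - 5 * - 1) ?w = tile_pt \<delta> (- 1) k ?w" by (rule tile_pt_fold[OF weights_x])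
    moreover have "adj40 c v = enc \<delta> (k + 5)" using adj 4 by auto
    ultimately show ?thesis using T[OF v(1), of "k + 5"] gv by simp
  next
    case 5
    define m where "m = (k + r) mod 4"
    have "wrap 4 k ?w m = 0" by (rule wl[OF 5(1)]) (unfold m_def, presburger)
    moreover have "0 < m" "m < 3" using 5(2) unfolding m_def by auto
    ultimately have "wrap 3 0 (wrap 4 k ?w) m = 0"
      using weights_4(1)[OF weights_5(2)[OF weights_x], of 0 k] by (simp add: stair_def)
    then have "tile_pt (1 - \<delta>) 0 k ?w = tile_pt \<delta> 0 k ?w" by (rule tile_pt_flip[OF weights_x])
    moreover have "adj40 c v = enc (1 - \<delta>) k" using adj 5 by auto
    moreover have "1 - \<delta> < 2" by simp
    ultimately show ?thesis using T[of "1 - \<delta>" k] gv by simp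
  qed
qed

lemma gem_fun_eq_iff:
  assumes v: "v < 40" "v' < 40" and y: "y \<in> std_simplex"
  shows "gem_fun v x = gem_fun v' y \<longleftrightarrow> ((v, x), (v', y)) \<in> (glue_rel {..<40} adj40)\<^sup>*"
proof -
  have g: "((v, x), (v', y)) \<in> (glue_rel {..<40} adj40)\<^sup>* \<longleftrightarrow> y = x \<and> (v, v') \<in> sub_rel {..<40} adj40 (zeros x)"
    using G40.glue_rel_iff[of v x v' y] v x by simp
  show ?thesis
  proof
    assume eq: "gem_fun v x = gem_fun v' y"
    obtain \<delta> k where v1: "\<delta> < 2" "v = enc \<delta> k" using enc_surj[OF v(1)] by metis
    obtain \<delta>' k' where v2: "\<delta>' < 2" "v' = enc \<delta>' k'" using enc_surj[OF v(2)] by metis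
    have "x = y \<and> tile_class \<delta> 0 k = tile_class \<delta>' 0 k'"
      by (rule tile_pt_inj[OF v1(1) v2(1) y]) (use eq v1 v2 gem_fun_enc x y in simp)
    then show "((v, x), (v', y)) \<in> (glue_rel {..<40} adj40)\<^sup>*"
      unfolding g using G40.comp_of_eq_iff[of v v' "zeros x"] v v1(2) v2(2) by (auto simp: tile_class_def)
  next
    assume "((v, x), (v', y)) \<in> (glue_rel {..<40} adj40)\<^sup>*"
    then have yx: "y = x" "(v, v') \<in> sub_rel {..<40} adj40 (zeros x)" unfolding g by auto
    have "gem_fun v x = gem_fun v' x"
      by (rule G40.sub_rel_invariant[OF yx(2), of "\<lambda>v. gem_fun v x"]) (use gem_fun_adj in \<open>auto simp: zeros_def\<close>)
    then show "gem_fun v x = gem_fun v' y" using yx(1) by simp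
  qed
qed

lemma gem_fun_range: assumes "v < 40" shows "gem_fun v x \<in> S2S1S1"
proof -
  let ?\<xi> = "wrap 3 0 (wrap 4 (int (v div 2)) (label_weight x))"
  have "weights 3 ?\<xi>" by (rule weights_4(2)[OF weights_5(2)[OF weights_x]])
  from sphere_pt_range[OF weights_3_bary[OF this]] show ?thesis
    unfolding gem_fun_def tile_pt_def cover_pt_def Let_def S2S1S1_def
    by (auto intro!: circle_pt_range simp: less_imp_le[OF frac_lt_1])
qed

end
end

lemma gem_fun_surj:
  assumes "p \<in> S2S1S1" shows "\<exists>v<40. \<exists>x\<in>std_simplex. gem_fun v x = p"
proof -
  obtain Y q1 q2 where p: "p = (Y, q1, q2)" "Y \<in> frontier (cbox (- 1) 1)" "q1 \<in> frontier (cbox (- 1) 1)"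
    "q2 \<in> frontier (cbox (- 1) 1)" using assms by (auto simp: S2S1S1_def)
  obtain \<tau> where \<tau>: "0 \<le> \<tau>" "\<tau> < 1" "circle_pt \<tau> = q1" using circle_pt_surj[OF p(3)] by blast
  obtain b where b: "0 \<le> b" "b < 1" "circle_pt b = q2" using circle_pt_surj[OF p(4)] by blast
  obtain \<delta> X Y' Z where s: "\<delta> < 2" "bary X Y' Z" "sphere_pt \<delta> \<tau> X Y' Z = Y" using sphere_pt_surj[OF p(2)] by blast
  define \<xi> where "\<xi> i = (if i mod 3 = 0 then X else if i mod 3 = 1 then Y' else Z)" for i :: int
  have \<xi>per: "\<xi> (i + 3) = \<xi> i" for i by (simp add: \<xi>_def)
  have \<xi>nn: "0 \<le> \<xi> i" for i using s(2) by (simp add: \<xi>_def bary_def)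
  have "{0..2} = {0, 1, 2 :: int}" by auto
  then have "sum \<xi> {0..0+(3-1)} = 1" using s(2) by (simp add: \<xi>_def bary_def)
  then have \<xi>1: "sum \<xi> {k..k+(3-1)} = 1" for k using periodic_sum_const[of 3 \<xi> k 0] \<xi>per by simp
  \<comment> \<open>The heights \<open>4 * \<tau> - 3 * b\<close> and \<open>5 * b\<close> solve for
    the prescribed lattice coordinates \<open>\<tau>\<close> and \<open>b\<close>.\<close>
  have "\<exists>j \<mu>. stair 3 j \<mu> \<xi> (4 * \<tau> - 3 * b)"
    using \<xi>per \<xi>nn \<xi>1 by (intro stair_exists) auto
  then obtain j \<mu> where j: "stair 3 j \<mu> \<xi> (4 * \<tau> - 3 * b)" by blast
  have \<mu>per: "\<mu> (m + 4) = \<mu> m" for m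
  proof -
    have "m + 4 = m + 3 + 1" by simp
    then show ?thesis using j unfolding stair_def by metis
  qed
  have "sum \<mu> {j..j+(4-1)} = 1" using stair_total[OF _ j] \<xi>1[of j] by simp
  then have \<mu>1: "sum \<mu> {k..k+(4-1)} = 1" for k using periodic_sum_const[of 4 \<mu> k j] \<mu>per by simp
  have \<mu>nn: "0 \<le> \<mu> m" for m using j by (simp add: stair_def)
  have "\<exists>k w. stair 4 k w \<mu> (5 * b)"
    using \<mu>per \<mu>nn \<mu>1 by (intro stair_exists) auto
  then obtain k w where k: "stair 4 k w \<mu> (5 * b)" by blast
  have wper: "w (m + 5) = w m" for m
  proof -
    have "m + 5 = m + 4 + 1" by simp
    then show ?thesis using k unfolding stair_def by metis
  qed
  have "sum w {k..k+(5-1)} = 1" using stair_total[OF _ k] \<mu>1[of k] by simp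
  then have w1: "sum w {k'..k'+(5-1)} = 1" for k' using periodic_sum_const[of 5 w k' k] wper by simp
  have w: "weights 5 w" using wper w1 k by (simp add: weights_def stair_def)
  have \<mu>eq: "\<mu> = wrap 4 k w" "5 * b = height 4 k w" using stair_determines[OF _ k] by simp_all
  have \<xi>eq: "\<xi> = wrap 3 j \<mu>" "4 * \<tau> - 3 * b = height 3 j \<mu>" using stair_determines[OF _ j] by simp_all
  have a: "(5 * (4 * \<tau> - 3 * b) + 3 * (5 * b)) / 20 = \<tau>" by (simp add: field_simps)
  have fl: "\<lfloor>\<tau>\<rfloor> = 0" "frac \<tau> = \<tau>" "frac b = b" using \<tau> b by (auto simp: frac_eq floor_eq_iff)
  have "tile_pt \<delta> j k w = p"
    unfolding tile_pt_def \<mu>eq[symmetric] \<xi>eq[symmetric] cover_pt_def Let_def a p(1)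
    using fl s(3) \<tau>(3) b(3) by (simp add: \<xi>_def)
  moreover obtain x where x: "label_weight x = w" using label_weight_surj[OF w] .
  moreover have xs: "x \<in> std_simplex" using x w by (simp add: std_simplex_iff_weights)
  ultimately have "gem_fun (enc \<delta> (k - 5 * j)) x = p"
    using gem_fun_enc[OF xs s(1)] tile_pt_fold[OF w, of \<delta> k j] by simp
  then show ?thesis using enc_less[OF s(1)] xs by blast
qed

section \<open>Piecewise affinity of the gem map\<close>

lemma pw_affine_on_wrap: "pw_affine_on std_simplex (\<lambda>x. wrap 3 0 (wrap 4 k (label_weight x)) i)"
proof -
  have c: "pw_affine_on std_simplex (\<lambda>x. label_weight x l)" for l
    unfolding label_weight_def by (rule pw_affine_on_coord)
  have i: "pw_affine_on std_simplex (\<lambda>x. if P then h x else 0)" if "pw_affine_on std_simplex h" for P and h :: "real^5 \<Rightarrow> real"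
    using that pw_affine_on_const[OF polytope_std_simplex] by (cases P) auto
  show ?thesis unfolding wrap_def by (intro pw_affine_on_sum polytope_std_simplex i c)
qed

lemma pw_affine_on_height:
  "pw_affine_on std_simplex (\<lambda>x. height 3 0 (wrap 4 k (label_weight x)))"
  "pw_affine_on std_simplex (\<lambda>x. height 4 k (label_weight x))"
proof -
  have c: "pw_affine_on std_simplex (\<lambda>x. label_weight x l)" for l
    unfolding label_weight_def by (rule pw_affine_on_coord)
  have i: "pw_affine_on std_simplex (\<lambda>x. if P then h x else 0)" if "pw_affine_on std_simplex h" for P and h :: "real^5 \<Rightarrow> real"
    using that pw_affine_on_const[OF polytope_std_simplex] by (cases P) auto
  show "pw_affine_on std_simplex (\<lambda>x. height 3 0 (wrap 4 k (label_weight x)))"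
    unfolding height_def wrap_def by (intro pw_affine_on_sum pw_affine_on_cmult polytope_std_simplex i c)
  show "pw_affine_on std_simplex (\<lambda>x. height 4 k (label_weight x))"
    unfolding height_def by (intro pw_affine_on_sum pw_affine_on_cmult polytope_std_simplex c)
qed

lemma pw_affine_on_divide: "pw_affine_on S f \<Longrightarrow> pw_affine_on S (\<lambda>x. f x / (c::real))"
  using pw_affine_on_cmult[of S f "1 / c"] by simp

lemma pw_affine_on_sphere_pt:
  assumes S: "polytope S" and f: "pw_affine_on S \<tau>" "pw_affine_on S X" "pw_affine_on S Y" "pw_affine_on S Z"
  shows "pw_affine_on S (\<lambda>x. sphere_pt \<delta> (\<tau> x) (X x) (Y x) (Z x))"
proof (rule pw_affine_on_vec[OF S])
  note I = pw_affine_on_diff pw_affine_on_add pw_affine_on_cmult pw_affine_on_divide pw_affine_on_min pw_affine_on_max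
    pw_affine_on_const S f
  define m where "m x = min (X x) (min (Y x) (Z x))" for x
  have m: "pw_affine_on S m" unfolding m_def by (intro I)
  define r where "r x = 1 - 3 * m x" for x
  have r: "pw_affine_on S r" unfolding r_def by (intro I m)
  define \<sigma> where "\<sigma> x = max 0 (min (r x) ((2 * \<tau> x - 1 + r x) / 2))" for x
  have \<sigma>: "pw_affine_on S \<sigma>" unfolding \<sigma>_def by (intro I r)
  have rot: "pw_affine_on S (\<lambda>x. rot (\<sigma> x) (p x) (q x) (s x))"
    if "pw_affine_on S p" "pw_affine_on S q" "pw_affine_on S s" for p q s
    unfolding rot_def transfer_def by (intro I \<sigma> that)
  have c: "pw_affine_on S (\<lambda>x. corner_coord \<delta> (r x) (p x))" if p: "pw_affine_on S p" for p
  proof (cases "\<delta> = 0")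
    case True
    then have e: "corner_coord \<delta> a b = 1 - 2 * min a (2 * b)" for a b by (simp add: corner_coord_def)
    show ?thesis unfolding e by (intro I r p)
  next
    case False
    then have e: "corner_coord \<delta> a b = 2 * (a - min a (2 * b)) - 1" for a b by (simp add: corner_coord_def)
    show ?thesis unfolding e by (intro I r p)
  qed
  have d: "pw_affine_on S (\<lambda>x. X x - m x)" "pw_affine_on S (\<lambda>x. Y x - m x)" "pw_affine_on S (\<lambda>x. Z x - m x)"
    by (intro I m)+
  have eq: "sphere_pt \<delta> (\<tau> x) (X x) (Y x) (Z x) = vector
      [corner_coord \<delta> (r x) (rot (\<sigma> x) (X x - m x) (Y x - m x) (Z x - m x)),
       corner_coord \<delta> (r x) (rot (\<sigma> x) (Y x - m x) (Z x - m x) (X x - m x)),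
       corner_coord \<delta> (r x) (rot (\<sigma> x) (Z x - m x) (X x - m x) (Y x - m x))]" for x
    by (simp only: sphere_pt_def Let_def m_def r_def \<sigma>_def)
  fix i :: 3
  show "pw_affine_on S (\<lambda>x. sphere_pt \<delta> (\<tau> x) (X x) (Y x) (Z x) $ i)"
    unfolding eq using exhaust_3[of i]
    by (elim disjE; simp only: vector_3; intro c rot d)
qed

lemma pw_affine_on_circle_pt:
  assumes S: "polytope S" and f: "pw_affine_on S u" shows "pw_affine_on S (\<lambda>x. circle_pt (u x))"
proof (rule pw_affine_on_vec[OF S])
  note I = pw_affine_on_diff pw_affine_on_add pw_affine_on_cmult pw_affine_on_min pw_affine_on_max
    pw_affine_on_const S f
  fix i :: 2
  show "pw_affine_on S (\<lambda>x. circle_pt (u x) $ i)"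
    unfolding circle_pt_def using exhaust_2[of i]
    by (elim disjE; simp only: vector_2; intro I)
qed

lemma frac_unit_step:
  assumes "real n \<le> u" "u \<le> real n + 1"
  shows "\<lfloor>u\<rfloor> = int n \<and> frac u = u - real n \<or> u = real n + 1 \<and> \<lfloor>u\<rfloor> = int n + 1 \<and> frac u = 0"
proof (cases "u = real n + 1")
  case True
  then have "\<lfloor>u\<rfloor> = int n + 1" by linarith
  then show ?thesis using True by (simp add: frac_def)
next
  case False
  then have "\<lfloor>u\<rfloor> = int n" using assms by linarith
  then show ?thesis by (simp add: frac_def)
qed

lemma pw_affine_on_circle_pt_frac:
  assumes S: "polytope S" and u: "pw_affine_on S u" "\<And>x. x \<in> S \<Longrightarrow> 0 \<le> u x" "\<And>x. x \<in> S \<Longrightarrow> u x \<le> real N + 1"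
  shows "pw_affine_on S (\<lambda>x. circle_pt (frac (u x)))"
proof (rule pw_affine_on_unit_steps[OF u _ S])
  show "pw_affine_on S (\<lambda>x. circle_pt (u x - real n))" for n
    by (intro pw_affine_on_circle_pt pw_affine_on_diff pw_affine_on_const S u)
  show "circle_pt (frac (u x)) = circle_pt (u x - real n)" if "real n \<le> u x" "u x \<le> real n + 1" for n x
    using frac_unit_step[OF that]
  proof (elim disjE conjE)
    assume e: "u x = real n + 1" "frac (u x) = 0"
    show ?thesis unfolding e(2) using e(1) by (simp add: circle_pt_0_1)
  qed simp
qed

lemma pl_on_gem_fun:
  assumes v: "v < 40" shows "pl_on std_simplex (gem_fun v)"
proof -
  define k where "k = int (v div 2)"
  have k: "0 \<le> k" "k < 20" using v by (auto simp: k_def)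
  let ?S = "std_simplex :: (real^5) set"
  define \<xi> where "\<xi> x i = wrap 3 0 (wrap 4 k (label_weight x)) i" for x i
  define s where "s x = height 3 0 (wrap 4 k (label_weight x))" for x
  define t where "t x = height 4 k (label_weight x)" for x
  define a where "a x = (5 * s x + 3 * t x) / 20" for x
  define b where "b x = t x / 5" for x
  have st: "pw_affine_on ?S s" "pw_affine_on ?S t" unfolding s_def t_def by (rule pw_affine_on_height)+
  have \<xi>: "pw_affine_on ?S (\<lambda>x. \<xi> x i)" for i unfolding \<xi>_def by (rule pw_affine_on_wrap)
  have a: "pw_affine_on ?S a" and b: "pw_affine_on ?S b"
    unfolding a_def b_def by (intro pw_affine_on_divide pw_affine_on_add pw_affine_on_cmult st)+
  have w\<xi>: "weights 3 (\<xi> x)" if "x \<in> ?S" for x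
    using weights_4(2)[OF weights_5(2)[OF that[unfolded std_simplex_iff_weights]], of 0 k] by (simp add: \<xi>_def[abs_def])
  have bnd: "0 \<le> s x \<and> s x \<le> 3 \<and> 0 \<le> t x \<and> t x \<le> 23" if x: "x \<in> ?S" for x
  proof -
    note w = x[unfolded std_simplex_iff_weights]
    have w4: "weights 4 (wrap 4 k (label_weight x))" by (rule weights_5(2)[OF w])
    have "0 \<le> wrap 4 k (label_weight x) l" "0 \<le> label_weight x l" for l
      using w w4 by (simp_all add: weights_def)
    from height_bounds[of "wrap 4 k (label_weight x)" 0 3, OF this(1)] height_bounds[of "label_weight x" k 4, OF this(2)]
    show ?thesis using weights_4(3)[OF w4, of 0] weights_5(3)[OF w, of k] k
      unfolding s_def t_def by auto
  qed
  \<comment> \<open>The heights are at most 3 and 23, so \<open>a\<close> is at most 4.2 and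
    \<open>b\<close> at most 4.6: five unit strips suffice.\<close>
  have a_bnd: "0 \<le> a x" "a x \<le> real 4 + 1" and b_bnd: "0 \<le> b x" "b x \<le> real 4 + 1" if "x \<in> ?S" for x
    using bnd[OF that] by (simp_all add: a_def b_def)
  have P: "pw_affine_on ?S (\<lambda>x. sphere_pt (v mod 2) (frac (a x)) (\<xi> x \<lfloor>a x\<rfloor>) (\<xi> x (\<lfloor>a x\<rfloor> + 1)) (\<xi> x (\<lfloor>a x\<rfloor> + 2)))"
  proof (rule pw_affine_on_unit_steps[OF a a_bnd _ polytope_std_simplex])
    show "pw_affine_on ?S (\<lambda>x. sphere_pt (v mod 2) (a x - real n) (\<xi> x (int n)) (\<xi> x (int n + 1)) (\<xi> x (int n + 2)))" for n
      by (intro pw_affine_on_sphere_pt pw_affine_on_diff pw_affine_on_const polytope_std_simplex a \<xi>)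
    fix n x assume x: "x \<in> ?S" and n: "real n \<le> a x" "a x \<le> real n + 1"
    show "sphere_pt (v mod 2) (frac (a x)) (\<xi> x \<lfloor>a x\<rfloor>) (\<xi> x (\<lfloor>a x\<rfloor> + 1)) (\<xi> x (\<lfloor>a x\<rfloor> + 2))
      = sphere_pt (v mod 2) (a x - real n) (\<xi> x (int n)) (\<xi> x (int n + 1)) (\<xi> x (int n + 2))"
      using frac_unit_step[OF n]
    proof (elim disjE conjE)
      \<comment> \<open>The upper end of a strip, where the floor has already jumped: a full third
        of a turn on the old indices equals no rotation on the new ones.\<close>
      assume e: "a x = real n + 1" "\<lfloor>a x\<rfloor> = int n + 1" "frac (a x) = 0"
      have "\<xi> x (int n + 3) = \<xi> x (int n)" using w\<xi>[OF x] by (simp add: weights_def)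
      then show ?thesis unfolding e(2,3)
        using sphere_pt_step[OF weights_3_bary[OF w\<xi>[OF x], of "int n"], of "v mod 2"] e(1)
        by (simp add: add.commute)
    qed simp
  qed
  have "pw_affine_on ?S (\<lambda>x. (sphere_pt (v mod 2) (frac (a x)) (\<xi> x \<lfloor>a x\<rfloor>) (\<xi> x (\<lfloor>a x\<rfloor> + 1)) (\<xi> x (\<lfloor>a x\<rfloor> + 2)),
      circle_pt (frac (a x)), circle_pt (frac (b x))))"
    by (intro pw_affine_on_Pair P pw_affine_on_circle_pt_frac[where N = 4] polytope_std_simplex a b a_bnd b_bnd)
  also have "(\<lambda>x. (sphere_pt (v mod 2) (frac (a x)) (\<xi> x \<lfloor>a x\<rfloor>) (\<xi> x (\<lfloor>a x\<rfloor> + 1)) (\<xi> x (\<lfloor>a x\<rfloor> + 2)),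
      circle_pt (frac (a x)), circle_pt (frac (b x)))) = gem_fun v"
    by (rule ext) (simp only: gem_fun_def tile_pt_def cover_pt_def Let_def a_def b_def \<xi>_def s_def t_def k_def)
  finally show ?thesis by (rule pw_affine_on_imp_pl_on)
qed

lemma gem_of_40: "gem_of {..<40} adj40 S2S1S1"
proof -
  have "gem_map {..<40} adj40 gem_fun S2S1S1"
  proof unfold_locales
    show "v \<in> {..<40} \<Longrightarrow> pl_on std_simplex (gem_fun v)" for v using pl_on_gem_fun by simp
    show "(\<Union>v\<in>{..<40}. gem_fun v ` std_simplex) = S2S1S1"
    proof
      show "(\<Union>v\<in>{..<40}. gem_fun v ` std_simplex) \<subseteq> S2S1S1" using gem_fun_range by auto
      show "S2S1S1 \<subseteq> (\<Union>v\<in>{..<40}. gem_fun v ` std_simplex)"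
      proof
        fix p assume "p \<in> S2S1S1"
        then obtain v x where "v < 40" "x \<in> std_simplex" "gem_fun v x = p" using gem_fun_surj by blast
        then show "p \<in> (\<Union>v\<in>{..<40}. gem_fun v ` std_simplex)" by blast
      qed
    qed
    show "gem_fun v x = gem_fun w y \<longleftrightarrow> ((v, x), w, y) \<in> (glue_rel {..<40} adj40)\<^sup>*"
      if "v \<in> {..<40}" "w \<in> {..<40}" "x \<in> std_simplex" "y \<in> std_simplex" for v w x y
      using gem_fun_eq_iff[OF that(3) _ _ that(4)] that(1,2) by simp
  qed
  then show ?thesis unfolding gem_of_iff by blast
qed

theorem theorem3p1:
  shows "reg_genus_mfd TYPE(5) S2S1S1 = 6 \<and>
    (\<exists>(V :: nat set) (adj :: 5 \<Rightarrow> nat \<Rightarrow> nat).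
        crystallization_of V adj S2S1S1 \<and> card V = 40 \<and> reg_genus_graph V adj = 6)"
proof -
  have fin: "finite (cyc_perms :: 5 list set)"
  proof (rule finite_subset)
    show "cyc_perms \<subseteq> {eps :: 5 list. set eps \<subseteq> UNIV \<and> length eps \<le> CARD(5)}"
      using distinct_card by (force simp: cyc_perms_def)
    show "finite {eps :: 5 list. set eps \<subseteq> UNIV \<and> length eps \<le> CARD(5)}"
      by (rule finite_lists_length_le) simp
  qed
  have ge: "reg_genus_graph V adj \<ge> 6" if "gem_of V adj S2S1S1" for V :: "nat set" and adj :: "5 \<Rightarrow> nat \<Rightarrow> nat"
  proof -
    \<comment> \<open>Any gem shares its Euler number with the 40-vertex one, where it was
      computed.\<close>
    have "euler_number V adj = 0" using euler_number_unique[OF that gem_of_40] euler_number_40 by simp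
    then show ?thesis unfolding reg_genus_graph_def using fin rho_eps_40(1) S2S1S1_rho_eps_ge[OF that]
      by (subst Min_ge_iff) auto
  qed
  have "reg_genus_graph {..<40} adj40 \<le> 6"
    unfolding reg_genus_graph_def using fin rho_eps_40 by (intro Min_le) (auto simp: image_iff intro!: bexI)
  then have eq: "reg_genus_graph {..<40} adj40 = 6" using ge[OF gem_of_40] by simp
  have "reg_genus_mfd TYPE(5) S2S1S1 = 6"
    unfolding reg_genus_mfd_def
  proof (rule cInf_eq_minimum)
    show "6 \<in> {reg_genus_graph V adj |(V :: nat set) (adj :: 5 \<Rightarrow> nat \<Rightarrow> nat). gem_of V adj S2S1S1}"
      using eq gem_of_40 by (auto intro!: exI[of _ "{..<40}"] exI[of _ adj40])
  qed (use ge in auto)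
  moreover have "crystallization_of {..<40} adj40 S2S1S1"
    unfolding crystallization_of_def using gem_of_40 g40_minus by simp
  ultimately show ?thesis using eq by (intro conjI exI[of _ "{..<40}"] exI[of _ adj40]) auto
qed

end
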